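(* Let $s>1/2$, $T>0$ and $v^0\in\dot H^s$. Then the system $$\partial_t v_k=\tfrac12 ik\sum_{k_1+k_2=k}e^{3ikk_1k_2t}v_{k_1}v_{k_2},\qquad k\in\mathbb{Z}_0,\qquad v(0)=v^0,$$ has a solution $v$ on $[0,T]$ (in the sense described in the context) which is the unique solution on $[0,T]$; it belongs to $C([0,T];\dot H^s)$ and satisfies $\|v(t)\|_{\dot H^0}=\|v^0\|_{\dot H^0}$ for all $t\in[0,T]$. Moreover the solution depends Lipschitz continuously on the data: there is a function $L(s,T,r)$ such that for any $v^0,w^0\in\dot H^s$ with corresponding solutions $v,w$, $$\|w(t)-v(t)\|_{\dot H^s}\le L\big(s,T,\|v^0\|_{\dot H^s}+\|w^0\|_{\dot H^s}\big)\,\|w^0-v^0\|_{\dot H^s},\qquad t\in[0,T].$$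
   Context: Write $\mathbb{Z}_0=\mathbb{Z}\setminus\{0\}$. For $s\in\mathbb{R}$, $\dot H^s$ denotes the Hilbert space of sequences $v=(v_k)_{k\in\mathbb{Z}_0}$ of complex numbers with $v_{-k}=\overline{v_k}$ and $\|v\|_{\dot H^s}^2=\sum_{k\in\mathbb{Z}_0}|k|^{2s}|v_k|^2<\infty$. The system above is the periodic KdV equation $\partial_tu=u\partial_xu+\partial_x^3u$ written for $v_k(t)=e^{ik^3t}u_k(t)$, $u_k$ the Fourier coefficients of $u$; sums are over $k_1,k_2\in\mathbb{Z}_0$. A function $v$ is a solution on $[0,T]$ with $v(0)=v^0$ if $v\in L_\infty([0,T];\dot H^0)$ and for every $k\in\mathbb{Z}_0$ and $t\in[0,T]$, $$v_k(t)-v^0_k=\tfrac12 ik\int_0^t\sum_{k_1+k_2=k}e^{3ikk_1k_2\tau}v_{k_1}(\tau)v_{k_2}(\tau)\,d\tau.$$ *)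

theory Defs
  imports "HOL-Analysis.Analysis"
begin

text \<open>Sequences indexed by nonzero integers are represented as functions
  int \<Rightarrow> complex; the value at index 0 is irrelevant and ignored everywhere.\<close>

definition Hs_weight :: "real \<Rightarrow> (int \<Rightarrow> complex) \<Rightarrow> int \<Rightarrow> real" where
  "Hs_weight s v k = (real_of_int \<bar>k\<bar>) powr (2 * s) * (cmod (v k))\<^sup>2"

definition in_Hs :: "real \<Rightarrow> (int \<Rightarrow> complex) \<Rightarrow> bool" where
  "in_Hs s v \<longleftrightarrow> (\<forall>k. k \<noteq> 0 \<longrightarrow> v (-k) = cnj (v k))
      \<and> (Hs_weight s v) summable_on {k. k \<noteq> 0}"

definition Hs_norm :: "real \<Rightarrow> (int \<Rightarrow> complex) \<Rightarrow> real" where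
  "Hs_norm s v = sqrt (infsum (Hs_weight s v) {k. k \<noteq> 0})"

definition kdv_rhs :: "(int \<Rightarrow> complex) \<Rightarrow> real \<Rightarrow> int \<Rightarrow> complex" where
  "kdv_rhs v \<tau> k = infsum (\<lambda>k1. exp (\<i> * complex_of_real (3 * real_of_int k * real_of_int k1
        * real_of_int (k - k1) * \<tau>)) * v k1 * v (k - k1)) {k1. k1 \<noteq> 0 \<and> k1 \<noteq> k}"

text \<open>Solution on [0,T] with v(0) = v0: v in L_infty([0,T]; H^0) (coefficientwise
  Lebesgue measurable, essentially bounded in H^0) satisfying the integral equation.\<close>
definition is_solution :: "real \<Rightarrow> (int \<Rightarrow> complex) \<Rightarrow> (real \<Rightarrow> int \<Rightarrow> complex) \<Rightarrow> bool" where
  "is_solution T v0 v \<longleftrightarrow>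
     (\<forall>k. (\<lambda>t. v t k) \<in> borel_measurable (lebesgue_on {0..T}))
   \<and> (\<exists>C. AE t in lebesgue_on {0..T}. in_Hs 0 (v t) \<and> Hs_norm 0 (v t) \<le> C)
   \<and> (\<forall>k t. k \<noteq> 0 \<and> t \<in> {0..T} \<longrightarrow>
        set_integrable lebesgue {0..t} (\<lambda>\<tau>. kdv_rhs (v \<tau>) \<tau> k)
      \<and> v t k - v0 k = 1/2 * \<i> * of_int k * (LINT \<tau>:{0..t}|lebesgue. kdv_rhs (v \<tau>) \<tau> k))"

end

(*
  Idea.  Integrating the equation by parts in time twice turns the nonlinearity into boundary
  terms plus a remainder.  The phase of the resulting cubic terms is 3(a+c)(c+d)(a+d); where it
  vanishes the terms are bounded as they stand, elsewhere a second integration by parts applies.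
  After it every nonresonant term is bounded by const/|k| in terms of l^2 norms alone, also for
  differences of two solutions and with a weight attached.  On output frequencies |k| > N the
  boundary terms are therefore small in l^2, and for |k| <= N the original equation is used; this
  gives Lipschitz and persistence estimates on time steps whose length depends only on the l^2
  norm (respectively the H^s norm), which are then iterated over [0,T].  The estimates hold for
  truncated systems with a small forcing, so they cover Galerkin approximations (existence, via
  compactness and l^2 conservation) and arbitrary weak solutions (uniqueness) alike.  Bounded
  weights min(|k|,N)^s make all norms finite a priori.
*)
theory Submission
  imports Defs "HOL-Complex_Analysis.Great_Picard"
begin

section \<open>Primitives of bounded measurable functions\<close>

text \<open>The obstacle is the factor \<open>k\<close> in front of the quadratic term. The phase
  \<open>3 * k * a * (k - a)\<close> pays for it exactly, but the time derivative left by the first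
  integration by parts brings back the frequency \<open>k - a\<close>: the cubic term keeps only the
  coefficient \<open>\<i> / (6 * a)\<close>, without decay in \<open>k\<close>. The cubic phase
  supplies three further denominators whose factors add up to \<open>2 * k\<close>, and this sum is
  the source of the decay. A weak solution is controlled in l^2 only, so all manipulations take
  place on finitely many frequencies and the truncation error is carried along as forcing. Its
  weight in the estimates grows with \<open>k\<close>; this does no harm, because the forcing is
  sent to zero for each \<open>k\<close> separately, before any norm in \<open>k\<close> is formed.
  The resulting inequalities are linear in the weighted size \<open>S\<close> of the difference,
  with coefficients made of \<open>C\<close> and \<open>D\<close>. Comparison with the zero solution
  allows \<open>D\<close> to be the plain l^2 bound; comparison of two nonzero solutions takes
  \<open>D\<close> to be a weighted bound, which persistence has provided before.\<close>

definition bmeas :: "real \<Rightarrow> (real \<Rightarrow> 'a::euclidean_space) \<Rightarrow> bool" where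
  "bmeas T f \<longleftrightarrow> f \<in> borel_measurable (lebesgue_on {0..T}) \<and> (\<exists>B. \<forall>t\<in>{0..T}. norm (f t) \<le> B)"

text \<open>These pairs stand in for derivatives: \<open>F\<close> is Lipschitz with derivative
  \<open>f\<close> almost everywhere, which is what the integral form of the equation gives
  directly. Integration by parts becomes the product rule \<open>prim_mult\<close>.\<close>

definition prim :: "real \<Rightarrow> (real \<Rightarrow> 'a::euclidean_space) \<Rightarrow> (real \<Rightarrow> 'a) \<Rightarrow> bool" where
  "prim T F f \<longleftrightarrow> bmeas T f \<and> (\<forall>t\<in>{0..T}. F t = F 0 + integral {0..t} f)"

lemma bmeas_const: "bmeas T (\<lambda>t. c)"
  unfolding bmeas_def by auto

lemma bmeas_add: "bmeas T f \<Longrightarrow> bmeas T g \<Longrightarrow> bmeas T (\<lambda>t. f t + g t)"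
  unfolding bmeas_def by (auto intro!: borel_measurable_add) (meson add_mono norm_triangle_le)

lemma bmeas_sum: "(\<And>i. i \<in> A \<Longrightarrow> bmeas T (f i)) \<Longrightarrow> bmeas T (\<lambda>t. \<Sum>i\<in>A. f i t)"
  by (induction A rule: infinite_finite_induct) (auto intro: bmeas_const bmeas_add)

lemma bmeas_mult:
  fixes f g :: "real \<Rightarrow> 'a::{euclidean_space, real_normed_algebra}"
  assumes "bmeas T f" "bmeas T g" shows "bmeas T (\<lambda>t. f t * g t)"
proof -
  obtain B C where "\<And>t. t\<in>{0..T} \<Longrightarrow> norm (f t) \<le> B" "\<And>t. t\<in>{0..T} \<Longrightarrow> norm (g t) \<le> C"
    using assms unfolding bmeas_def by metis
  then have "norm (f t * g t) \<le> B * C" if "t \<in> {0..T}" for t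
    using that by (meson mult_mono norm_ge_zero norm_mult_ineq order_trans)
  then show ?thesis
    using assms unfolding bmeas_def by (blast intro: borel_measurable_times)
qed

lemma bmeas_cmult:
  fixes f :: "real \<Rightarrow> 'a::{euclidean_space, real_normed_algebra}"
  shows "bmeas T f \<Longrightarrow> bmeas T (\<lambda>t. c * f t)"
  by (intro bmeas_mult bmeas_const)

lemma bmeas_continuous: "continuous_on {0..T} f \<Longrightarrow> bmeas T f"
  unfolding bmeas_def
  using compact_imp_bounded[OF compact_continuous_image[of "{0..T}" f]]
  by (auto simp: bounded_iff intro!: continuous_imp_measurable_on_sets_lebesgue)

lemma bmeas_absolutely_integrable:
  assumes "bmeas T f" "0 \<le> s" "t \<le> T"
  shows "set_integrable lebesgue {s..t} f"
proof -
  obtain B where B: "\<And>t. t\<in>{0..T} \<Longrightarrow> norm (f t) \<le> B"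
    using assms(1) unfolding bmeas_def by blast
  have "integrable (lebesgue_on {0..T}) f"
  proof (rule finite_measure.integrable_const_bound)
    show "finite_measure (lebesgue_on {0..T})"
      by (rule finite_measure_lebesgue_on) simp
    show "AE x in lebesgue_on {0..T}. norm (f x) \<le> B"
      using B by (intro AE_I2) auto
    show "f \<in> borel_measurable (lebesgue_on {0..T})"
      using assms(1) unfolding bmeas_def by blast
  qed
  then have "set_integrable lebesgue {0..T} f"
    by (simp add: integrable_restrict_space set_integrable_def)
  then show ?thesis
    by (rule set_integrable_subset) (use assms in auto)
qed

lemma bmeas_integrable:
  assumes "bmeas T f" "0 \<le> s" "t \<le> T" shows "f integrable_on {s..t}"
  using set_lebesgue_integral_eq_integral(1)[OF bmeas_absolutely_integrable[OF assms]] .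

lemma bmeas_cong: "bmeas T f \<Longrightarrow> (\<And>t. t \<in> {0..T} \<Longrightarrow> f t = g t) \<Longrightarrow> bmeas T g"
  unfolding bmeas_def
  by (smt (verit, best) measurable_cong space_lebesgue_on)

lemma bmeas_norm: "bmeas T f \<Longrightarrow> bmeas T (\<lambda>t. norm (f t))"
  unfolding bmeas_def by auto

lemma primI: "bmeas T f \<Longrightarrow> (\<And>t. t \<in> {0..T} \<Longrightarrow> F t = F 0 + integral {0..t} f) \<Longrightarrow> prim T F f"
  unfolding prim_def by blast

lemma primD: "prim T F f \<Longrightarrow> t \<in> {0..T} \<Longrightarrow> F t = F 0 + integral {0..t} f"
  unfolding prim_def by blast

lemma prim_bmeas_deriv: "prim T F f \<Longrightarrow> bmeas T f"
  unfolding prim_def by blast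

lemma prim_diff:
  assumes "prim T F f" "0 \<le> s" "s \<le> t" "t \<le> T"
  shows "F t - F s = integral {s..t} f"
proof -
  have "f integrable_on {0..t}"
    using assms bmeas_integrable prim_bmeas_deriv by (metis order.refl)
  then have "integral {0..t} f = integral {0..s} f + integral {s..t} f"
    using assms by (intro Henstock_Kurzweil_Integration.integral_combine[symmetric]) auto
  moreover have "F t = F 0 + integral {0..t} f" "F s = F 0 + integral {0..s} f"
    using assms by (auto intro!: primD[OF assms(1)])
  ultimately show ?thesis by simp
qed

lemma prim_lipschitz:
  assumes "prim T F f"
  obtains B where "B \<ge> 0" "\<And>t. t\<in>{0..T} \<Longrightarrow> norm (f t) \<le> B"
    "\<And>s t. s \<in> {0..T} \<Longrightarrow> t \<in> {0..T} \<Longrightarrow> norm (F t - F s) \<le> B * \<bar>t - s\<bar>"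
proof -
  obtain B0 where B0: "\<And>t. t\<in>{0..T} \<Longrightarrow> norm (f t) \<le> B0"
    using assms unfolding prim_def bmeas_def by blast
  define B where "B = max B0 0"
  have B: "B \<ge> 0" "\<And>t. t\<in>{0..T} \<Longrightarrow> norm (f t) \<le> B"
    using B0 by (auto simp: B_def intro: max.coboundedI1)
  have *: "norm (F t - F s) \<le> B * (t - s)" if "0 \<le> s" "s \<le> t" "t \<le> T" for s t
  proof -
    have "norm (integral {s..t} f) \<le> integral {s..t} (\<lambda>_. B)"
      using that B bmeas_integrable[OF prim_bmeas_deriv[OF assms]]
      by (intro integral_norm_bound_integral) auto
    then show ?thesis using prim_diff[OF assms that] that by (simp add: mult.commute)
  qed
  have "norm (F t - F s) \<le> B * \<bar>t - s\<bar>" if "s \<in> {0..T}" "t \<in> {0..T}" for s t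
    using *[of s t] *[of t s] that by (cases "s \<le> t") (auto simp: norm_minus_commute)
  then show ?thesis using that B by blast
qed

lemma prim_continuous: assumes "prim T F f" shows "continuous_on {0..T} F"
proof -
  obtain B where "B \<ge> 0" "\<And>s t. s \<in> {0..T} \<Longrightarrow> t \<in> {0..T} \<Longrightarrow> norm (F t - F s) \<le> B * \<bar>t - s\<bar>"
    using prim_lipschitz[OF assms] by metis
  then have "B-lipschitz_on {0..T} F"
    by (intro lipschitz_onI) (auto simp: dist_norm)
  then show ?thesis by (rule lipschitz_on_continuous_on)
qed

lemma prim_bmeas: "prim T F f \<Longrightarrow> bmeas T F"
  by (rule bmeas_continuous[OF prim_continuous])

lemma prim_cong: "prim T F f \<Longrightarrow> (\<And>t. t \<in> {0..T} \<Longrightarrow> F t = G t)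
   \<Longrightarrow> (\<And>t. t \<in> {0..T} \<Longrightarrow> f t = g t) \<Longrightarrow> prim T G g"
proof -
  assume a: "prim T F f" "\<And>t. t \<in> {0..T} \<Longrightarrow> F t = G t" "\<And>t. t \<in> {0..T} \<Longrightarrow> f t = g t"
  have "integral {0..t} f = integral {0..t} g" if "t \<in> {0..T}" for t
    using that a(3) by (intro Henstock_Kurzweil_Integration.integral_cong) auto
  then show ?thesis
    using a bmeas_cong[of T f g] unfolding prim_def
    by (metis atLeastAtMost_iff order.refl order.trans)
qed

lemma prim_const: "prim T (\<lambda>t. c) (\<lambda>t. 0)"
  unfolding prim_def by (auto intro: bmeas_const)

lemma prim_add: "prim T F f \<Longrightarrow> prim T G g \<Longrightarrow> prim T (\<lambda>t. F t + G t) (\<lambda>t. f t + g t)"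
proof -
  assume a: "prim T F f" "prim T G g"
  have "F t + G t = F 0 + G 0 + integral {0..t} (\<lambda>t. f t + g t)" if "t \<in> {0..T}" for t
    unfolding primD[OF a(1) that] primD[OF a(2) that] using that a
    by (subst Henstock_Kurzweil_Integration.integral_add) (auto intro!: bmeas_integrable prim_bmeas_deriv)
  with a show ?thesis
    by (intro primI[OF bmeas_add[OF prim_bmeas_deriv prim_bmeas_deriv]])
qed

lemma prim_sum: "(\<And>i. i \<in> A \<Longrightarrow> prim T (F i) (f i)) \<Longrightarrow> prim T (\<lambda>t. \<Sum>i\<in>A. F i t) (\<lambda>t. \<Sum>i\<in>A. f i t)"
  by (induction A rule: infinite_finite_induct) (auto intro: prim_const prim_add)

text \<open>The defect \<open>Q\<close> of the product formula satisfies \<open>\<bar>Q t - Q s\<bar> \<le> C (t - s)\<^sup>2\<close>, hence it is constant.\<close>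

lemma prim_mult:
  fixes F G :: "real \<Rightarrow> 'a::{euclidean_space, real_normed_field}"
  assumes F: "prim T F f" and G: "prim T G g"
  shows "prim T (\<lambda>t. F t * G t) (\<lambda>t. f t * G t + F t * g t)"
proof -
  let ?h = "\<lambda>t. f t * G t + F t * g t"
  have h: "bmeas T ?h"
    using F G by (intro bmeas_add bmeas_mult) (auto intro: prim_bmeas prim_bmeas_deriv)
  obtain B where B: "B \<ge> 0" "\<And>t. t\<in>{0..T} \<Longrightarrow> norm (f t) \<le> B"
    "\<And>s t. s \<in> {0..T} \<Longrightarrow> t \<in> {0..T} \<Longrightarrow> norm (F t - F s) \<le> B * \<bar>t - s\<bar>"
    using prim_lipschitz[OF F] by metis
  obtain C where C: "C \<ge> 0" "\<And>t. t\<in>{0..T} \<Longrightarrow> norm (g t) \<le> C"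
    "\<And>s t. s \<in> {0..T} \<Longrightarrow> t \<in> {0..T} \<Longrightarrow> norm (G t - G s) \<le> C * \<bar>t - s\<bar>"
    using prim_lipschitz[OF G] by metis
  define Q where "Q t = F t * G t - integral {0..t} ?h" for t
  have key: "norm (Q t - Q s) \<le> 2 * B * C * (t - s)\<^sup>2" if st: "0 \<le> s" "s \<le> t" "t \<le> T" for s t
  proof -
    have int: "?h integrable_on {s..t}" "f integrable_on {s..t}" "g integrable_on {s..t}" "?h integrable_on {0..t}"
      using st h F G by (auto intro!: bmeas_integrable intro: prim_bmeas_deriv)
    have "integral {0..s} ?h + integral {s..t} ?h = integral {0..t} ?h"
      using st int by (intro Henstock_Kurzweil_Integration.integral_combine) auto
    then have "Q t - Q s = (F t - F s) * G t + F s * (G t - G s) - integral {s..t} ?h"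
      unfolding Q_def by (simp add: algebra_simps)
    also have "\<dots> = integral {s..t} f * G t + F s * integral {s..t} g - integral {s..t} ?h"
      using prim_diff[OF F st] prim_diff[OF G st] by simp
    also have "\<dots> = integral {s..t} (\<lambda>\<tau>. f \<tau> * G t) + integral {s..t} (\<lambda>\<tau>. F s * g \<tau>) - integral {s..t} ?h"
      by simp
    also have "\<dots> = integral {s..t} (\<lambda>\<tau>. f \<tau> * G t + F s * g \<tau> - ?h \<tau>)"
      by (subst Henstock_Kurzweil_Integration.integral_diff[OF integrable_add[OF 
            integrable_on_mult_left[OF int(2)] integrable_on_mult_right[OF int(3)]] int(1)],
          subst Henstock_Kurzweil_Integration.integral_add[OF 
            integrable_on_mult_left[OF int(2)] integrable_on_mult_right[OF int(3)]]) simp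
    also have "norm \<dots> \<le> integral {s..t} (\<lambda>\<tau>. 2 * B * C * (t - s))"
    proof (rule integral_norm_bound_integral)
      show "(\<lambda>\<tau>. f \<tau> * G t + F s * g \<tau> - ?h \<tau>) integrable_on {s..t}"
        using int by (intro integrable_diff[OF integrable_add] integrable_on_mult_right integrable_on_mult_left)
      fix \<tau> assume \<tau>: "\<tau> \<in> {s..t}"
      \<comment> \<open>Freezing the undifferentiated factors at \<open>t\<close> and
        \<open>s\<close> costs their oscillation, one factor \<open>t - s\<close>; the integration
        supplies the second.\<close>
      have "f \<tau> * G t + F s * g \<tau> - ?h \<tau> = f \<tau> * (G t - G \<tau>) + (F s - F \<tau>) * g \<tau>"
        by (simp add: algebra_simps)
      also have "norm \<dots> \<le> norm (f \<tau>) * norm (G t - G \<tau>) + norm (F s - F \<tau>) * norm (g \<tau>)"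
        by (rule order_trans[OF norm_triangle_ineq]) (simp add: norm_mult)
      also have "\<dots> \<le> B * (C * (t - s)) + (B * (t - s)) * C"
      proof (intro add_mono mult_mono)
        have "C * \<bar>t - \<tau>\<bar> \<le> C * (t - s)" "B * \<bar>s - \<tau>\<bar> \<le> B * (t - s)"
          using B(1) C(1) \<tau> by (simp_all add: mult_left_mono)
        moreover have "norm (G t - G \<tau>) \<le> C * \<bar>t - \<tau>\<bar>" "norm (F s - F \<tau>) \<le> B * \<bar>s - \<tau>\<bar>"
          using \<tau> st by (auto intro!: B(3) C(3) simp del: abs_of_nonneg abs_of_nonpos)
        ultimately show "norm (G t - G \<tau>) \<le> C * (t - s)" "norm (F s - F \<tau>) \<le> B * (t - s)"
          by linarith+
      qed (use B C \<tau> st in auto)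
      finally show "norm (f \<tau> * G t + F s * g \<tau> - ?h \<tau>) \<le> 2 * B * C * (t - s)"
        by (simp add: algebra_simps)
    qed auto
    also have "\<dots> = 2 * B * C * (t - s)\<^sup>2"
      using st by (simp add: power2_eq_square)
    finally show ?thesis .
  qed
  have Q0: "Q t = Q 0" if t: "t \<in> {0..T}" for t
  proof (rule has_derivative_zero_unique[where s = "{0..T}" and f = Q])
    fix x assume x: "x \<in> {0..T}"
    have "(Q has_derivative (\<lambda>h. 0)) (at x within {0..T})"
      unfolding has_derivative_within
    proof (intro conjI bounded_linear_zero)
      have b: "norm ((1 / norm (y - x)) *\<^sub>R (Q y - (Q x + 0))) \<le> 2 * B * C * norm (y - x)"
        if y: "y \<in> {0..T}" for y
      proof -
        have "norm (Q y - Q x) \<le> 2 * B * C * (norm (y - x))\<^sup>2"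
          using key[of x y] key[of y x] x y
          by (cases "x \<le> y") (simp_all add: norm_minus_commute power2_commute)
        then have "norm (Q y - Q x) / norm (y - x) \<le> 2 * B * C * norm (y - x)" if "x \<noteq> y"
          using that by (simp add: pos_divide_le_eq power2_eq_square mult.assoc)
        then show ?thesis
          by (cases "x = y") simp_all
      qed
      have lim: "((\<lambda>y. 2 * B * C * norm (y - x)) \<longlongrightarrow> 2 * B * C * norm (x - x)) (at x within {0..T})"
        by (intro tendsto_intros)
      show "((\<lambda>y. (1 / norm (y - x)) *\<^sub>R (Q y - (Q x + 0))) \<longlongrightarrow> 0) (at x within {0..T})"
      proof (rule Lim_null_comparison)
        show "\<forall>\<^sub>F y in at x within {0..T}. norm ((1 / norm (y - x)) *\<^sub>R (Q y - (Q x + 0))) \<le> 2 * B * C * norm (y - x)"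
          unfolding eventually_at_filter using b by (intro always_eventually) blast
        show "((\<lambda>y. 2 * B * C * norm (y - x)) \<longlongrightarrow> 0) (at x within {0..T})"
          using lim by simp
      qed
    qed
    then show "(Q has_derivative (\<lambda>h. 0)) (at x within {0..T})" .
  qed (use t in auto)
  have "F t * G t = F 0 * G 0 + integral {0..t} ?h" if "t \<in> {0..T}" for t
  proof -
    have "Q t = Q 0" using that by (rule Q0)
    moreover have "Q t = F t * G t - integral {0..t} ?h" "Q 0 = F 0 * G 0"
      by (simp_all only: Q_def) simp
    ultimately show ?thesis by (metis diff_add_cancel)
  qed
  with h show ?thesis by (rule primI)
qed

lemma prim_cmult:
  fixes F :: "real \<Rightarrow> 'a::{euclidean_space, real_normed_field}"
  shows "prim T F f \<Longrightarrow> prim T (\<lambda>t. c * F t) (\<lambda>t. c * f t)"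
  using prim_mult[OF prim_const[of T c], of F f] by simp

lemma prim_minus:
  fixes F G :: "real \<Rightarrow> 'a::{euclidean_space, real_normed_field}"
  shows "prim T F f \<Longrightarrow> prim T G g \<Longrightarrow> prim T (\<lambda>t. F t - G t) (\<lambda>t. f t - g t)"
  using prim_add[OF _ prim_cmult[of T G g "-1"], of F f] by simp

lemma prim_cis: assumes "T \<ge> 0" shows "prim T (\<lambda>t. cis (a * t)) (\<lambda>t. \<i> * of_real a * cis (a * t))"
  unfolding prim_def
proof (intro conjI ballI)
  show "bmeas T (\<lambda>t. \<i> * of_real a * cis (a * t))"
    by (intro bmeas_continuous continuous_intros)
  fix t assume t: "t \<in> {0..T}"
  have "((\<lambda>t. \<i> * of_real a * cis (a * t)) has_integral (cis (a * t) - cis (a * 0))) {0..t}"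
  proof (rule fundamental_theorem_of_calculus)
    fix x
    have "((\<lambda>z. exp (\<i> * of_real a * z)) has_field_derivative \<i> * of_real a * cis (a * x)) (at (of_real x))"
      by (auto intro!: derivative_eq_intros simp: cis_conv_exp mult_ac)
    from has_vector_derivative_real_field[OF this]
    show "((\<lambda>t. cis (a * t)) has_vector_derivative \<i> * of_real a * cis (a * x)) (at x within {0..t})"
      by (simp add: cis_conv_exp mult_ac)
  qed (use t in auto)
  then show "cis (a * t) = cis (a * 0) + integral {0..t} (\<lambda>t. \<i> * of_real a * cis (a * t))"
    by (simp only: integral_unique) (simp del: integral_mult_right)
qed

section \<open>Square-summable sequences and resonance kernels\<close>

abbreviation mag :: "int \<Rightarrow> real" where
  "mag k \<equiv> \<bar>real_of_int k\<bar>"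

text \<open>Bounds on finite sections express an l^2 norm bound without a summability side
  condition, and they pass to pointwise limits section by section.\<close>

definition l2bd :: "(int \<Rightarrow> real) \<Rightarrow> real \<Rightarrow> bool" where
  "l2bd f B \<longleftrightarrow> (\<forall>F. finite F \<and> 0 \<notin> F \<longrightarrow> L2_set f F \<le> B)"

lemma l2bdD: "l2bd f B \<Longrightarrow> finite F \<Longrightarrow> 0 \<notin> F \<Longrightarrow> L2_set f F \<le> B"
  unfolding l2bd_def by blast

lemma l2bd_nonneg: "l2bd f B \<Longrightarrow> 0 \<le> B"
  using l2bdD[of f B "{}"] by simp

lemma l2bd_mono: "l2bd f B \<Longrightarrow> B \<le> C \<Longrightarrow> l2bd f C"
  unfolding l2bd_def by force

lemma l2bd_dominated:
  assumes "l2bd f B" "\<And>k. k \<noteq> 0 \<Longrightarrow> \<bar>g k\<bar> \<le> f k" shows "l2bd g B"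
  unfolding l2bd_def
proof (intro allI impI)
  fix F :: "int set" assume F: "finite F \<and> 0 \<notin> F"
  have "L2_set g F = L2_set (\<lambda>k. \<bar>g k\<bar>) F" by (simp add: L2_set_def)
  also have "\<dots> \<le> L2_set f F"
  proof (rule L2_set_mono)
    fix k assume "k \<in> F"
    with F have "k \<noteq> 0" by metis
    then show "\<bar>g k\<bar> \<le> f k" by (rule assms(2))
  qed simp
  also have "\<dots> \<le> B" using F by (intro l2bdD[OF assms(1)]) simp_all
  finally show "L2_set g F \<le> B" .
qed

lemma l2bd_add:
  assumes "l2bd f B" "l2bd g C" shows "l2bd (\<lambda>k. f k + g k) (B + C)"
  unfolding l2bd_def
  by (auto intro!: order_trans[OF L2_set_triangle_ineq] add_mono l2bdD[OF assms(1)] l2bdD[OF assms(2)])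

lemma l2bd_cmult: assumes "l2bd f B" "0 \<le> c" shows "l2bd (\<lambda>k. c * f k) (c * B)"
  using assms unfolding l2bd_def by (auto simp flip: L2_set_right_distrib intro: mult_left_mono)

lemma l2bd_point: "l2bd f B \<Longrightarrow> k \<noteq> 0 \<Longrightarrow> \<bar>f k\<bar> \<le> B"
  using l2bdD[of f B "{k}"] by simp

text \<open>Cauchy-Schwarz along two injections of one index set. Convolutions are the case
  \<open>p a = a\<close>, \<open>q a = k - a\<close>; the sums with shifted denominators use a shift
  for \<open>q\<close>.\<close>

lemma l2bd_sum_mult:
  assumes "l2bd f B" "l2bd g C" "finite A" "inj_on p A" "inj_on q A" "0 \<notin> p ` A" "0 \<notin> q ` A"
    "\<And>k. f k \<ge> 0" "\<And>k. g k \<ge> 0"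
  shows "(\<Sum>a\<in>A. f (p a) * g (q a)) \<le> B * C"
proof -
  have "(\<Sum>a\<in>A. f (p a) * g (q a)) \<le> L2_set (\<lambda>a. f (p a)) A * L2_set (\<lambda>a. g (q a)) A"
    using L2_set_mult_ineq[of "\<lambda>a. f (p a)" "\<lambda>a. g (q a)" A] assms(8,9) by simp
  also have "L2_set (\<lambda>a. f (p a)) A = L2_set f (p ` A)"
    using assms by (simp add: L2_set_def sum.reindex)
  also have "L2_set (\<lambda>a. g (q a)) A = L2_set g (q ` A)"
    using assms by (simp add: L2_set_def sum.reindex)
  also have "L2_set f (p ` A) * L2_set g (q ` A) \<le> B * C"
    using assms by (intro mult_mono l2bdD[of f] l2bdD[of g]) (auto intro: l2bd_nonneg)
  finally show ?thesis .
qed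

section \<open>Square summability of the inverse frequencies\<close>

lemma sum_inverse_squares_le: "(\<Sum>k=1..n. 1 / (real k)\<^sup>2) \<le> 2 - 1 / real (max n 1)"
proof (induction n)
  case (Suc n)
  show ?case
  proof (cases "n = 0")
    case False
    \<comment> \<open>Telescoping, which is why the bound in the induction carries the negative
      term.\<close>
    have "1 / (real (Suc n))\<^sup>2 \<le> 1 / real n - 1 / real (Suc n)"
      using False by (simp add: divide_simps power2_eq_square) 
    moreover have "(\<Sum>k=1..n. 1 / (real k)\<^sup>2) \<le> 2 - 1 / real n"
      using Suc False by (simp add: max_absorb1)
    ultimately show ?thesis by simp
  qed simp
qed simp

lemma finite_int_bounded:
  assumes "finite F" obtains n where "\<And>k. k \<in> F \<Longrightarrow> \<bar>k\<bar> \<le> int n"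
proof -
  have "finite ((\<lambda>k. nat \<bar>k\<bar>) ` F)" using assms by simp
  then obtain n where "\<forall>m\<in>(\<lambda>k. nat \<bar>k\<bar>) ` F. m \<le> n" using finite_nat_set_iff_bounded_le by blast
  then show ?thesis using that[of n] by (simp add: nat_le_iff)
qed

text \<open>Each sign contributes at most 2 to the sum of squares, so the norm is at most the root
  of 4.\<close>

lemma l2bd_inverse: "l2bd (\<lambda>k. 1 / mag k) 2"
  unfolding l2bd_def
proof (intro allI impI)
  fix F :: "int set" assume F: "finite F \<and> 0 \<notin> F"
  then obtain n where n: "\<And>k. k \<in> F \<Longrightarrow> \<bar>k\<bar> \<le> int n" using finite_int_bounded[of F] by metis
  let ?g = "\<lambda>k. (1 / mag k)\<^sup>2"
  have "sum ?g F \<le> sum ?g (int ` {1..n} \<union> (\<lambda>k. - int k) ` {1..n})"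
  proof (rule sum_mono2)
    show "F \<subseteq> int ` {1..n} \<union> (\<lambda>k. - int k) ` {1..n}"
    proof
      fix k assume k: "k \<in> F"
      then have "k \<noteq> 0" using F by metis
      then show "k \<in> int ` {1..n} \<union> (\<lambda>k. - int k) ` {1..n}"
        using n[OF k] by (cases "k > 0") (auto simp: image_iff intro!: bexI[of _ "nat \<bar>k\<bar>"])
    qed
  qed auto
  also have "\<dots> = sum ?g (int ` {1..n}) + sum ?g ((\<lambda>k. - int k) ` {1..n})"
    by (rule sum.union_disjoint) auto
  also have "\<dots> = 2 * (\<Sum>k=1..n. 1 / (real k)\<^sup>2)"
    by (subst (1 2) sum.reindex) (auto simp: inj_on_def power_divide)
  also have "\<dots> \<le> 4" 
    using sum_inverse_squares_le[of n] by (smt (verit) zero_le_divide_1_iff of_nat_0_le_iff)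
  finally show "L2_set (\<lambda>k. 1 / mag k) F \<le> 2"
    unfolding L2_set_def by (intro real_le_lsqrt) (auto intro: sum_nonneg)
qed

text \<open>Provides the cut-off of the short-time argument: beyond \<open>N\<close>, a bound of the
  form const / |k| is small in l^2.\<close>

lemma l2bd_small_tail:
  assumes "\<epsilon> > 0"
  obtains N :: nat where "N \<ge> 1"
    "\<And>F. finite F \<Longrightarrow> \<forall>k\<in>F. \<bar>k\<bar> > int N \<Longrightarrow> L2_set (\<lambda>k. 1 / mag k) F \<le> \<epsilon>"
proof -
  let ?g = "\<lambda>k. (1 / mag k)\<^sup>2" and ?Z = "{k::int. k \<noteq> 0}"
  have "?g summable_on ?Z"
  proof (rule nonneg_bdd_above_summable_on)
    show "bdd_above (sum ?g ` {F. F \<subseteq> ?Z \<and> finite F})"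
    proof (rule bdd_aboveI2)
      fix F assume "F \<in> {F. F \<subseteq> ?Z \<and> finite F}"
      then have "L2_set (\<lambda>k. 1 / mag k) F \<le> 2" by (intro l2bdD[OF l2bd_inverse]) auto
      then show "sum ?g F \<le> 4"
        unfolding L2_set_def by (metis (no_types, lifting) real_sqrt_le_iff real_sqrt_four)
    qed
  qed auto
  then obtain S where "(?g has_sum S) ?Z" unfolding summable_on_def by blast
  then obtain F0 where F0: "finite F0" "F0 \<subseteq> ?Z"
    and c: "\<And>F. finite F \<Longrightarrow> F0 \<subseteq> F \<Longrightarrow> F \<subseteq> ?Z \<Longrightarrow> dist (sum ?g F) S < \<epsilon>\<^sup>2 / 2"
  proof -
    have "\<forall>\<^sub>F F in finite_subsets_at_top ?Z. dist (sum ?g F) S < \<epsilon>\<^sup>2 / 2"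
      using \<open>(?g has_sum S) ?Z\<close> assms unfolding has_sum_def by (intro tendstoD) simp_all
    then show ?thesis using that unfolding eventually_finite_subsets_at_top by metis
  qed
  obtain n where n: "\<forall>k\<in>F0. \<bar>k\<bar> \<le> int n" using finite_int_bounded[OF F0(1)] by metis
  show ?thesis
  proof (rule that[of "max n 1"])
    fix F :: "int set" assume F: "finite F" "\<forall>k\<in>F. \<bar>k\<bar> > int (max n 1)"
    have disj: "F0 \<inter> F = {}" using n F(2) by fastforce
    \<comment> \<open>Both sums lie within \<epsilon>^2 / 2 of the total, so their difference, the
      sum over \<open>F\<close>, is at most \<epsilon>^2.\<close>
    have "dist (sum ?g (F0 \<union> F)) S < \<epsilon>\<^sup>2 / 2" "dist (sum ?g F0) S < \<epsilon>\<^sup>2 / 2"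
      by (rule c; use F F0 in force)+
    then have "sum ?g F \<le> \<epsilon>\<^sup>2"
      unfolding dist_real_def sum.union_disjoint[OF F0(1) F(1) disj] by linarith
    then show "L2_set (\<lambda>k. 1 / mag k) F \<le> \<epsilon>"
      unfolding L2_set_def using assms by (intro real_le_lsqrt) (auto intro: sum_nonneg)
  qed simp
qed

text \<open>In the following sums a vanishing denominator contributes nothing, since \<open>x / 0 = 0\<close>.\<close>

lemma sum_shifted_inverse_le:
  assumes "l2bd f B" "\<And>k. f k \<ge> 0" "finite A" "0 \<notin> A"
  shows "(\<Sum>c\<in>A. f c / mag (c + j)) \<le> 2 * B"
proof -
  let ?A = "A - {-j}"
  have "(\<Sum>c\<in>A. f c / mag (c + j)) = (\<Sum>c\<in>?A. f c * (1 / mag (c + j)))"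
    using assms(3) by (intro sum.mono_neutral_cong_right) auto
  also have "\<dots> \<le> B * 2"
    using assms by (intro l2bd_sum_mult[of f B "\<lambda>k. 1 / mag k" 2 ?A "\<lambda>c. c" "\<lambda>c. c + j"] l2bd_inverse)
      (auto simp: inj_on_def)
  finally show ?thesis by simp
qed

lemma sum_shifted_inverse_le':
  assumes "l2bd f B" "\<And>k. f k \<ge> 0" "finite A" "0 \<notin> A"
  shows "(\<Sum>c\<in>A. f c / mag (j - c)) \<le> 2 * B"
  using sum_shifted_inverse_le[OF assms, of "- j"] by (simp add: abs_minus_commute)

lemma double_sum_le:
  fixes h :: "'a \<Rightarrow> 'b \<Rightarrow> real"
  assumes "\<And>c. c \<in> A \<Longrightarrow> (\<Sum>d\<in>A'. h c d) \<le> K" "(\<Sum>c\<in>A. g c) \<le> L" "\<And>c. c \<in> A \<Longrightarrow> g c \<ge> 0" "K \<ge> 0"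
  shows "(\<Sum>c\<in>A. \<Sum>d\<in>A'. g c * h c d) \<le> L * K"
proof -
  have "(\<Sum>c\<in>A. \<Sum>d\<in>A'. g c * h c d) = (\<Sum>c\<in>A. g c * (\<Sum>d\<in>A'. h c d))"
    by (simp add: sum_distrib_left)
  also have "\<dots> \<le> (\<Sum>c\<in>A. g c * K)"
    using assms by (intro sum_mono mult_left_mono) auto
  also have "\<dots> \<le> L * K"
    using assms by (simp flip: sum_distrib_right add: mult_right_mono)
  finally show ?thesis .
qed

locale l2seq =
  fixes f :: "int \<Rightarrow> real" and B :: real and A :: "int set"
  assumes f: "l2bd f B" "\<And>k. f k \<ge> 0" and A: "finite A" "0 \<notin> A"
begin

lemma B_nonneg: "0 \<le> B" using f(1) by (rule l2bd_nonneg)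

lemma inner1: "(\<Sum>d\<in>A. f d / mag (c + d)) \<le> 2 * B"
  using sum_shifted_inverse_le[OF f A, of c] by (simp add: add.commute)

lemma inner2: "(\<Sum>d\<in>A. f d / mag (k - d)) \<le> 2 * B"
  using sum_shifted_inverse_le'[OF f A, of k] .

lemma inner3: "(\<Sum>d\<in>A. f d / mag d) \<le> 2 * B"
  using sum_shifted_inverse_le[OF f A, of 0] by simp

text \<open>Two of the three factors \<open>k - c\<close>, \<open>k - d\<close>,
  \<open>c + d\<close> already control the double sum: one of them is summed first, uniformly in the
  other variable, and the second one handles what remains.\<close>

lemma pair1: "(\<Sum>c\<in>A. \<Sum>d\<in>A. f c * f d / (mag (k - c) * mag (k - d))) \<le> 4 * B\<^sup>2"
  using double_sum_le[OF inner2[of k] inner2[of k]] f(2) B_nonneg by (simp add: power2_eq_square)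

lemma pair2: "(\<Sum>c\<in>A. \<Sum>d\<in>A. f c * f d / (mag (k - c) * mag (c + d))) \<le> 4 * B\<^sup>2"
  using double_sum_le[OF inner1 inner2[of k]] f(2) B_nonneg by (simp add: power2_eq_square)

lemma pair2': "(\<Sum>c\<in>A. \<Sum>d\<in>A. f c * f d / (mag (k - d) * mag (c + d))) \<le> 4 * B\<^sup>2"
  using pair2[of k] by (subst sum.swap) (simp add: add.commute mult.commute)

lemma pair3: "(\<Sum>c\<in>A. \<Sum>d\<in>A. f c * f d / (mag c * mag (c + d))) \<le> 4 * B\<^sup>2"
  using double_sum_le[OF inner1 inner3] f(2) B_nonneg by (simp add: power2_eq_square)

end

section \<open>Sums over frequency triples against the cubic phase\<close>

text \<open>The phase of the cubic terms is \<open>(a + c) * (c + d) * (a + d)\<close>, so it vanishes exactly on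
  \<open>res_triples\<close>.\<close>

definition triples :: "int set \<Rightarrow> int \<Rightarrow> (int \<times> int \<times> int) set" where
  "triples A k = {(a, c, d). a \<in> A \<and> c \<in> A \<and> d \<in> A \<and> c + d \<in> A \<and> a + c + d = k \<and> a + c \<noteq> 0 \<and> a + d \<noteq> 0}"

definition res_triples :: "int set \<Rightarrow> int \<Rightarrow> (int \<times> int \<times> int) set" where
  "res_triples A k = {(a, c, d). a \<in> A \<and> c \<in> A \<and> d \<in> A \<and> c + d \<in> A \<and> a + c + d = k \<and> (a + c = 0 \<or> a + d = 0)}"

lemma finite_triples: "finite A \<Longrightarrow> finite (triples A k)"
  by (rule finite_subset[of _ "A \<times> A \<times> A"]) (auto simp: triples_def)

text \<open>Because \<open>a + c + d = k\<close>, any two entries determine the triple, so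
  projecting to two of them is injective.\<close>

lemma sum_triples_le:
  fixes g :: "int \<Rightarrow> int \<Rightarrow> real"
  assumes "finite A" "\<And>c d. c \<in> A \<Longrightarrow> d \<in> A \<Longrightarrow> g c d \<ge> 0"
  shows "(\<Sum>(a,c,d)\<in>triples A k. g c d) \<le> (\<Sum>c\<in>A. \<Sum>d\<in>A. g c d)"
    and "(\<Sum>(a,c,d)\<in>triples A k. g a d) \<le> (\<Sum>c\<in>A. \<Sum>d\<in>A. g c d)"
    and "(\<Sum>(a,c,d)\<in>triples A k. g a c) \<le> (\<Sum>c\<in>A. \<Sum>d\<in>A. g c d)"
proof -
  have *: "(\<Sum>x\<in>triples A k. g (fst (p x)) (snd (p x))) \<le> (\<Sum>c\<in>A. \<Sum>d\<in>A. g c d)"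
    if "inj_on p (triples A k)" "p ` triples A k \<subseteq> A \<times> A" for p
  proof -
    have "(\<Sum>x\<in>triples A k. g (fst (p x)) (snd (p x))) = (\<Sum>y\<in>p ` triples A k. g (fst y) (snd y))"
      using that by (simp add: sum.reindex)
    also have "\<dots> \<le> (\<Sum>y\<in>A \<times> A. g (fst y) (snd y))"
      using that assms by (intro sum_mono2) auto
    finally show ?thesis by (simp add: sum.cartesian_product split_def)
  qed
  show "(\<Sum>(a,c,d)\<in>triples A k. g c d) \<le> (\<Sum>c\<in>A. \<Sum>d\<in>A. g c d)"
    using *[of "\<lambda>(a,c,d). (c,d)"] by (force simp: inj_on_def triples_def split_def)
  show "(\<Sum>(a,c,d)\<in>triples A k. g a d) \<le> (\<Sum>c\<in>A. \<Sum>d\<in>A. g c d)"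
    using *[of "\<lambda>(a,c,d). (a,d)"] by (force simp: inj_on_def triples_def split_def)
  show "(\<Sum>(a,c,d)\<in>triples A k. g a c) \<le> (\<Sum>c\<in>A. \<Sum>d\<in>A. g c d)"
    using *[of "\<lambda>(a,c,d). (a,c)"] by (force simp: inj_on_def triples_def split_def)
qed

lemma sum_triples_swap: "(\<Sum>(a,c,d)\<in>triples A k. h a c d) = (\<Sum>(a,c,d)\<in>triples A k. h a d c)"
  by (rule sum.reindex_bij_witness[where i = "\<lambda>(a,c,d). (a,d,c)" and j = "\<lambda>(a,c,d). (a,d,c)"])
     (auto simp: triples_def algebra_simps)

text \<open>The three reciprocal products add up to \<open>(p + q + r) / (p * q * r)\<close>. A
  lower bound on the sum of the phase factors is thereby traded for decay in the output frequency,
  at the price of one denominator.\<close>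

lemma inverse_prod3_le:
  fixes p q r K :: real
  assumes "p > 0" "q > 0" "r > 0" "K > 0" "2 * K \<le> p + q + r"
  shows "1 / (p * q * r) \<le> (1 / (p * q) + 1 / (q * r) + 1 / (p * r)) / (2 * K)"
proof -
  have "(1 / (p * q) + 1 / (q * r) + 1 / (p * r)) = (p + q + r) / (p * q * r)"
    using assms by (simp add: divide_simps)
  then show ?thesis using assms by (simp add: divide_simps)
qed

lemma inverse_prod2_le:
  fixes p q K :: real
  assumes "p > 0" "q > 0" "K > 0" "K \<le> p + q"
  shows "1 / (p * q) \<le> (1 / p + 1 / q) / K"
proof -
  have "1 / p + 1 / q = (p + q) / (p * q)"
    using assms by (simp add: divide_simps)
  then show ?thesis using assms by (simp add: divide_simps)
qed

definition tker :: "int \<Rightarrow> int \<Rightarrow> int \<Rightarrow> real" where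
  "tker a c d = 1 / (mag (a + c) * mag (c + d) * mag (a + d))"

text \<open>A majorant of \<open>tker\<close> after the decay in \<open>k\<close> has been
  extracted, with \<open>a\<close> eliminated: \<open>k - d\<close>, \<open>c + d\<close>,
  \<open>k - c\<close> are the phase factors \<open>a + c\<close>, \<open>c + d\<close>,
  \<open>a + d\<close>.\<close>

definition pker :: "int \<Rightarrow> int \<Rightarrow> int \<Rightarrow> real" where
  "pker k c d = (1 / (mag (k - c) * mag (k - d)) + 1 / (mag (k - c) * mag (c + d)) + 1 / (mag (k - d) * mag (c + d))) / (2 * mag k)"

lemma tker_nonneg: "tker a c d \<ge> 0"
  unfolding tker_def by simp

context l2seq
begin

lemma triples_pos:
  assumes "(a,c,d) \<in> triples A k"
  shows "a \<in> A" "c \<in> A" "d \<in> A" "mag a \<ge> 1" "mag (a + c) \<ge> 1" "mag (c + d) \<ge> 1" "mag (a + d) \<ge> 1"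
    "a + c = k - d" "c + d = k - a" "a + d = k - c"
proof -
  have ge1: "mag j \<ge> 1" if "j \<noteq> 0" for j :: int
    using that by linarith
  have *: "a \<in> A" "c \<in> A" "d \<in> A" "c + d \<in> A" "a + c + d = k" "a + c \<noteq> 0" "a + d \<noteq> 0"
    using assms by (simp_all add: triples_def)
  then have "a \<noteq> 0" "c + d \<noteq> 0" using A(2) by metis+
  with * show "a \<in> A" "c \<in> A" "d \<in> A" "mag a \<ge> 1" "mag (a + c) \<ge> 1" "mag (c + d) \<ge> 1" "mag (a + d) \<ge> 1"
    "a + c = k - d" "c + d = k - a" "a + d = k - c"
    by (auto intro!: ge1)
qed

text \<open>The phase factors add up to \<open>2 * k\<close>, hence the gain. In terms of these
  factors \<open>pker\<close> is symmetric, so on a triple either pair of entries can be kept as the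
  free variables.\<close>

lemma tker_le:
  assumes k: "k \<noteq> 0" and t: "(a,c,d) \<in> triples A k"
  shows "tker a c d \<le> pker k c d" "tker a c d \<le> pker k a d"
proof -
  note p = triples_pos[OF t]
  have "mag (a + c) > 0" "mag (c + d) > 0" "mag (a + d) > 0" using p(5-7) by linarith+
  moreover have "2 * mag k \<le> mag (a + c) + mag (c + d) + mag (a + d)"
  proof -
    have "real_of_int (a + c) + real_of_int (c + d) + real_of_int (a + d) = 2 * real_of_int k"
      using t by (auto simp: triples_def)
    then show ?thesis by linarith
  qed
  ultimately have "tker a c d \<le> (1 / (mag (a + c) * mag (c + d)) + 1 / (mag (c + d) * mag (a + d)) + 1 / (mag (a + c) * mag (a + d))) / (2 * mag k)"
    unfolding tker_def using k by (intro inverse_prod3_le) simp_all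
  also have "\<dots> = pker k c d"
    unfolding pker_def p(8) p(10) by (simp add: ac_simps)
  finally show "tker a c d \<le> pker k c d" .
  also have "pker k c d = pker k a d"
    unfolding pker_def p(9)[symmetric] p(10)[symmetric] p(8)[symmetric] by (simp add: ac_simps)
  finally show "tker a c d \<le> pker k a d" .
qed

lemma pker_sum:
  assumes k: "k \<noteq> 0"
  shows "(\<Sum>c\<in>A. \<Sum>d\<in>A. f c * f d * pker k c d) \<le> 6 * B\<^sup>2 / mag k"
proof -
  have "(\<Sum>c\<in>A. \<Sum>d\<in>A. f c * f d * pker k c d) = ((\<Sum>c\<in>A. \<Sum>d\<in>A. f c * f d / (mag (k - c) * mag (k - d)))
     + (\<Sum>c\<in>A. \<Sum>d\<in>A. f c * f d / (mag (k - c) * mag (c + d))) + (\<Sum>c\<in>A. \<Sum>d\<in>A. f c * f d / (mag (k - d) * mag (c + d)))) / (2 * mag k)"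
    unfolding pker_def sum.distrib[symmetric] sum_divide_distrib
    by (simp add: add_divide_distrib distrib_left)
  also have "\<dots> \<le> (4 * B\<^sup>2 + 4 * B\<^sup>2 + 4 * B\<^sup>2) / (2 * mag k)"
    by (intro divide_right_mono add_mono pair1 pair2 pair2') simp
  finally show ?thesis by (simp add: divide_simps)
qed

lemma tker_sum_cd:
  assumes k: "k \<noteq> 0"
  shows "(\<Sum>(a,c,d)\<in>triples A k. f c * f d * tker a c d) \<le> 6 * B\<^sup>2 / mag k"
proof -
  have "(\<Sum>(a,c,d)\<in>triples A k. f c * f d * tker a c d) \<le> (\<Sum>(a,c,d)\<in>triples A k. f c * f d * pker k c d)"
    using f(2) by (intro sum_mono) (auto intro!: mult_left_mono tker_le(1)[OF k])
  also have "\<dots> \<le> (\<Sum>c\<in>A. \<Sum>d\<in>A. f c * f d * pker k c d)"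
    using f(2) A by (intro sum_triples_le) (simp_all add: pker_def)
  finally show ?thesis using pker_sum[OF k] by linarith
qed

lemma tker_sum_ad:
  assumes k: "k \<noteq> 0"
  shows "(\<Sum>(a,c,d)\<in>triples A k. f a * f d * tker a c d) \<le> 6 * B\<^sup>2 / mag k"
proof -
  have "(\<Sum>(a,c,d)\<in>triples A k. f a * f d * tker a c d) \<le> (\<Sum>(a,c,d)\<in>triples A k. f a * f d * pker k a d)"
    using f(2) by (intro sum_mono) (auto intro!: mult_left_mono tker_le(2)[OF k])
  also have "\<dots> \<le> (\<Sum>c\<in>A. \<Sum>d\<in>A. f c * f d * pker k c d)"
    using f(2) A by (intro sum_triples_le) (simp_all add: pker_def)
  finally show ?thesis using pker_sum[OF k] by linarith
qed

text \<open>Differentiating the factor with frequency \<open>c\<close> costs |c|, while the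
  coefficient only offers 1 / |a|. Since |c| is at most |a + c| + |a|, the cost is paid either by
  the phase factor \<open>a + c\<close> or by that coefficient. In the first case
  \<open>a + (c + d) = k\<close> still yields decay in \<open>k\<close>. The 14 is 4 + 4 +
  6.\<close>

lemma tker_sum_c:
  assumes k: "k \<noteq> 0"
  shows "(\<Sum>(a,c,d)\<in>triples A k. mag c * (f a * f d) / mag a * tker a c d) \<le> 14 * B\<^sup>2 / mag k"
proof -
  let ?K = "mag k"
  define g where "g c d = f c * f d / (mag c * mag (c + d))
     + f c * f d / (mag (k - c) * mag (c + d))" for c d
  have g0: "g c d \<ge> 0" for c d
    unfolding g_def using f(2) by simp
  have "(\<Sum>(a,c,d)\<in>triples A k. mag c * (f a * f d) / mag a * tker a c d) 
     \<le> (\<Sum>(a,c,d)\<in>triples A k. g a d / ?K + f a * f d * tker a c d)"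
  proof (rule sum_mono, clarify)
    fix a c d assume t: "(a,c,d) \<in> triples A k"
    note p = triples_pos[OF t]
    let ?a = "mag a" and ?x = "mag (a + c)" and ?y = "mag (c + d)" and ?z = "mag (a + d)"
    have "mag c / ?a * tker a c d \<le> (?x + ?a) / ?a * tker a c d"
      by (intro mult_right_mono divide_right_mono tker_nonneg) auto
    also have "\<dots> = 1 / (?a * ?y) / ?z + tker a c d"
    proof -
      have "(x + e) / e * (1 / (x * y * z)) = 1 / (e * y) / z + 1 / (x * y * z)"
        if "x \<ge> 1" "y \<ge> 1" "z \<ge> 1" "e \<ge> 1" for x y z e :: real
        using that by (simp add: field_simps)
      from this[OF p(5,6,7,4)] show ?thesis unfolding tker_def .
    qed
    also have "1 / (?a * ?y) \<le> (1 / ?a + 1 / ?y) / ?K"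
      using p(4-7) k t by (intro inverse_prod2_le) (auto simp: triples_def)
    finally have "mag c / ?a * tker a c d \<le> (1 / ?a + 1 / ?y) / ?K / ?z + tker a c d"
      by (simp add: divide_right_mono)
    then have "f a * f d * (mag c / ?a * tker a c d) \<le> f a * f d * ((1 / ?a + 1 / ?y) / ?K / ?z + tker a c d)"
      using f(2) by (intro mult_left_mono) simp_all
    also have "\<dots> = g a d / ?K + f a * f d * tker a c d"
      unfolding g_def p(9) by (simp add: add_divide_distrib algebra_simps)
    finally show "mag c * (f a * f d) / ?a * tker a c d \<le> g a d / ?K + f a * f d * tker a c d"
      by (simp add: mult_ac)
  qed
  also have "\<dots> = (\<Sum>(a,c,d)\<in>triples A k. g a d / ?K) + (\<Sum>(a,c,d)\<in>triples A k. f a * f d * tker a c d)"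
    by (simp add: sum.distrib split_def)
  also have "\<dots> \<le> (\<Sum>c\<in>A. \<Sum>d\<in>A. g c d / ?K) + 6 * B\<^sup>2 / ?K"
    using g0 A k by (intro add_mono sum_triples_le tker_sum_ad) simp_all
  also have "(\<Sum>c\<in>A. \<Sum>d\<in>A. g c d / ?K) = (\<Sum>c\<in>A. \<Sum>d\<in>A. g c d) / ?K"
    by (simp flip: sum_divide_distrib)
  also have "\<dots> \<le> (4 * B\<^sup>2 + 4 * B\<^sup>2) / ?K"
    unfolding g_def sum.distrib using pair3 pair2[of k]
    by (intro divide_right_mono add_mono) simp_all
  finally show ?thesis by (simp add: add_divide_distrib)
qed

lemma tker_sum_d:
  assumes k: "k \<noteq> 0"
  shows "(\<Sum>(a,c,d)\<in>triples A k. mag d * (f a * f c) / mag a * tker a c d) \<le> 14 * B\<^sup>2 / mag k"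
  using tker_sum_c[OF k] 
  by (subst sum_triples_swap) (simp add: tker_def mult_ac add.commute)

text \<open>One summand for each factor that the time derivative can hit, weighted by the frequency
  which the equation puts in front of that factor. The 34 is 6 + 14 + 14.\<close>

lemma tker_sum_deriv:
  assumes k: "k \<noteq> 0"
  shows "(\<Sum>(a,c,d)\<in>triples A k. (mag a * (f c * f d) + mag c * (f a * f d) + mag d * (f a * f c))
     / mag a * tker a c d) \<le> 34 * B\<^sup>2 / mag k"
proof -
  have "(\<Sum>(a,c,d)\<in>triples A k. (mag a * (f c * f d) + mag c * (f a * f d) + mag d * (f a * f c))
     / mag a * tker a c d) = (\<Sum>(a,c,d)\<in>triples A k. f c * f d * tker a c d)
     + (\<Sum>(a,c,d)\<in>triples A k. mag c * (f a * f d) / mag a * tker a c d)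
     + (\<Sum>(a,c,d)\<in>triples A k. mag d * (f a * f c) / mag a * tker a c d)"
    unfolding sum.distrib[symmetric]
  proof (rule sum.cong, simp, clarify)
    fix a c d assume "(a,c,d) \<in> triples A k"
    from triples_pos(4)[OF this] 
    show "(mag a * (f c * f d) + mag c * (f a * f d) + mag d * (f a * f c)) / mag a * tker a c d =
       f c * f d * tker a c d + mag c * (f a * f d) / mag a * tker a c d
       + mag d * (f a * f c) / mag a * tker a c d"
      by (simp add: field_simps)
  qed
  also have "\<dots> \<le> 6 * B\<^sup>2 / mag k + 14 * B\<^sup>2 / mag k + 14 * B\<^sup>2 / mag k"
    by (intro add_mono tker_sum_cd tker_sum_c tker_sum_d k)
  finally show ?thesis by (simp add: add_divide_distrib)
qed

text \<open>Here 1 / |k| comes from \<open>a + (c + d) = k\<close>, which leaves two phase factors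
  for \<open>pair1\<close>; the third sequence value is bounded pointwise by
  \<open>B\<close>.\<close>

lemma tker_sum3:
  assumes k: "k \<noteq> 0"
  shows "(\<Sum>(a,c,d)\<in>triples A k. f a * (f c * f d) / mag a * tker a c d) \<le> 8 * B ^ 3 / mag k"
proof -
  let ?K = "mag k"
  define g where "g c d = f c * f d / (mag (k - c) * mag (k - d))" for c d
  have g0: "g c d \<ge> 0" for c d
    unfolding g_def using f(2) by simp
  have "(\<Sum>(a,c,d)\<in>triples A k. f a * (f c * f d) / mag a * tker a c d) 
     \<le> (\<Sum>(a,c,d)\<in>triples A k. 2 * B / ?K * g c d)"
  proof (rule sum_mono, clarify)
    fix a c d assume t: "(a,c,d) \<in> triples A k"
    note p = triples_pos[OF t]
    let ?a = "mag a" and ?x = "mag (a + c)" and ?y = "mag (c + d)" and ?z = "mag (a + d)"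
    have "1 / (?a * ?y) \<le> (1 / ?a + 1 / ?y) / ?K"
      using p(4-7) k t by (intro inverse_prod2_le) (auto simp: triples_def)
    also have "\<dots> \<le> 2 / ?K"
    proof (rule divide_right_mono)
      have "1 / ?a \<le> 1" "1 / ?y \<le> 1" using p(4) p(6) by (auto simp: divide_le_eq_1)
      then show "1 / ?a + 1 / ?y \<le> 2" by linarith
    qed simp
    finally have 1: "1 / (?a * ?y) \<le> 2 / ?K" .
    have 2: "f a \<le> B" using l2bd_point[OF f(1), of a] p A(2) by force
    have "g c d = f c * f d / (?z * ?x)"
      unfolding g_def p(8) p(10) by (rule refl)
    then have "f a * (f c * f d) / ?a * tker a c d = f a * (1 / (?a * ?y)) * g c d"
      unfolding tker_def by (simp only: times_divide_eq_right times_divide_eq_left divide_divide_eq_left mult_1_right mult_ac)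
    also have "\<dots> \<le> B * (2 / ?K) * g c d"
      using 1 2 f(2) B_nonneg g0 by (intro mult_right_mono mult_mono) simp_all
    finally show "f a * (f c * f d) / ?a * tker a c d \<le> 2 * B / ?K * g c d"
      by (simp add: mult_ac)
  qed
  also have "\<dots> \<le> (\<Sum>c\<in>A. \<Sum>d\<in>A. 2 * B / ?K * g c d)"
    using g0 A B_nonneg by (intro sum_triples_le) simp_all
  also have "\<dots> = 2 * B / ?K * (\<Sum>c\<in>A. \<Sum>d\<in>A. g c d)"
    by (simp add: sum_distrib_left)
  also have "\<dots> \<le> 2 * B / ?K * (4 * B\<^sup>2)"
    unfolding g_def using pair1[of k] B_nonneg by (intro mult_left_mono) simp_all
  finally show ?thesis by (simp add: power2_eq_square power3_eq_cube)
qed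

text \<open>A resonant triple is \<open>(a, - a, k)\<close> or \<open>(a, k, - a)\<close>. So
  \<open>f k\<close> factors out and the sum over \<open>a\<close> is bounded by Cauchy-Schwarz: no
  decay in \<open>k\<close>, but the result is again an l^2 sequence.\<close>

lemma res_sum:
  "(\<Sum>(a,c,d)\<in>res_triples A k. f a * (f c * f d) / mag a) \<le> 2 * B\<^sup>2 * f k"
proof -
  define h where "h = (\<lambda>(a,c,d). f a * (f c * f d))"
  have h0: "h x \<ge> 0" for x unfolding h_def using f(2) by (auto simp: split_def)
  let ?i = "\<lambda>a::int. (a, -a, k)" and ?j = "\<lambda>a::int. (a, k, -a)"
  have "(\<Sum>(a,c,d)\<in>res_triples A k. f a * (f c * f d) / mag a) \<le> sum h (res_triples A k)"
  proof (rule sum_mono, clarify)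
    fix a c d assume "(a,c,d) \<in> res_triples A k"
    then have "a \<noteq> 0" using A(2) by (auto simp: res_triples_def)
    then have "mag a \<ge> 1" by linarith
    then show "f a * (f c * f d) / mag a \<le> h (a,c,d)"
      using divide_left_mono[of 1 "mag a" "h (a,c,d)"] h0[of "(a,c,d)"] by (simp add: h_def)
  qed
  also have "\<dots> \<le> sum h (?i ` A \<union> ?j ` A)"
    using A(1) h0 by (intro sum_mono2) (auto simp: res_triples_def image_iff)
  also have "\<dots> \<le> sum h (?i ` A) + sum h (?j ` A)"
    using sum_Un[of "?i ` A" "?j ` A" h] sum_nonneg[of "?i ` A \<inter> ?j ` A" h] h0 A(1) by simp
  also have "\<dots> = 2 * ((\<Sum>a\<in>A. f a * f (-a)) * f k)"
    by (subst (1 2) sum.reindex) (auto simp: inj_on_def h_def sum_distrib_left mult_ac)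
  also have "(\<Sum>a\<in>A. f a * f (-a)) \<le> B * B"
    using f A by (intro l2bd_sum_mult[where p = "\<lambda>a. a" and q = uminus]) (auto simp: inj_on_def)
  finally show ?thesis using f(2) by (simp add: power2_eq_square mult_right_mono)
qed

end

section \<open>The normal form\<close>

text \<open>The argument is one third of the phase:
  \<open>k ^ 3 - a ^ 3 - b ^ 3 = 3 * k * a * b\<close> when \<open>k = a + b\<close>.\<close>

definition osc :: "int \<Rightarrow> real \<Rightarrow> complex" where
  "osc j t = cis (3 * real_of_int j * t)"

lemma norm_osc: "cmod (osc j t) = 1"
  by (simp add: osc_def)

lemma osc_add: "osc i t * osc j t = osc (i + j) t"
  by (simp add: osc_def cis_mult algebra_simps)

lemma osc_0: "osc 0 t = 1"
  by (simp add: osc_def)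

lemma prim_osc: "T \<ge> 0 \<Longrightarrow> prim T (osc j) (\<lambda>t. 3 * \<i> * of_int j * osc j t)"
  using prim_cis[of T "3 * real_of_int j"] by (simp add: osc_def[abs_def] mult_ac)

definition pairs :: "int set \<Rightarrow> int \<Rightarrow> int set" where
  "pairs A k = {a \<in> A. k - a \<in> A}"

lemma finite_pairs: "finite A \<Longrightarrow> finite (pairs A k)"
  by (simp add: pairs_def)

lemma sum_pairs_flip: "(\<Sum>a\<in>pairs A k. h a (k - a)) = (\<Sum>a\<in>pairs A k. h (k - a) a)"
  by (rule sum.reindex_bij_witness[where i = "\<lambda>a. k - a" and j = "\<lambda>a. k - a"]) (auto simp: pairs_def)

definition quad :: "int set \<Rightarrow> (int \<Rightarrow> complex) \<Rightarrow> real \<Rightarrow> int \<Rightarrow> complex" where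
  "quad A x t k = (\<Sum>a\<in>pairs A k. osc (k * a * (k - a)) t * (x a * x (k - a)))"

text \<open>The coefficient is \<open>\<i> / 2 * k\<close> from the equation divided by
  \<open>3 * \<i> * k * a * (k - a)\<close> from differentiating the oscillation.\<close>

definition bdry2 :: "int set \<Rightarrow> (int \<Rightarrow> complex) \<Rightarrow> real \<Rightarrow> int \<Rightarrow> complex" where
  "bdry2 A x t k = (\<Sum>a\<in>pairs A k. 1 / (6 * of_int a * of_int (k - a)) * (osc (k * a * (k - a)) t * (x a * x (k - a))))"

definition tosc :: "int \<times> int \<times> int \<Rightarrow> real \<Rightarrow> complex" where
  "tosc = (\<lambda>(a,c,d). osc ((a + c) * (c + d) * (a + d)))"

text \<open>The cubic coefficient \<open>\<i> / (6 * a)\<close> divided by \<open>3 * \<i>\<close>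
  times the cubic phase.\<close>

definition tcoef :: "int \<times> int \<times> int \<Rightarrow> complex" where
  "tcoef = (\<lambda>(a,c,d). 1 / (18 * of_int a * of_int (a + c) * of_int (c + d) * of_int (a + d)))"

text \<open>The sign is negative because the cubic terms are subtracted when the derivative is moved
  off the quadratic oscillation.\<close>

definition bdry3 :: "int set \<Rightarrow> (int \<Rightarrow> complex) \<Rightarrow> real \<Rightarrow> int \<Rightarrow> complex" where
  "bdry3 A x t k = (\<Sum>(a,c,d)\<in>triples A k. - tcoef (a,c,d) * (tosc (a,c,d) t * (x a * (x c * x d))))"

definition bdry2_deriv :: "int set \<Rightarrow> (int \<Rightarrow> complex) \<Rightarrow> (int \<Rightarrow> complex) \<Rightarrow> real \<Rightarrow> int \<Rightarrow> complex" where
  "bdry2_deriv A x g t k = (\<Sum>a\<in>pairs A k. 1 / (6 * of_int a * of_int (k - a)) *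
     (3 * \<i> * of_int (k * a * (k - a)) * osc (k * a * (k - a)) t * (x a * x (k - a)) 
      + osc (k * a * (k - a)) t * (g a * x (k - a) + x a * g (k - a))))"

definition bdry3_deriv :: "int set \<Rightarrow> (int \<Rightarrow> complex) \<Rightarrow> (int \<Rightarrow> complex) \<Rightarrow> real \<Rightarrow> int \<Rightarrow> complex" where
  "bdry3_deriv A x g t k = (\<Sum>(a,c,d)\<in>triples A k. - tcoef (a,c,d) *
     (3 * \<i> * of_int ((a + c) * (c + d) * (a + d)) * tosc (a,c,d) t * (x a * (x c * x d))
      + tosc (a,c,d) t * (g a * (x c * x d) + x a * (g c * x d + x c * g d))))"

text \<open>In order: the forcing, the forcing inserted into the quadratic boundary term (symmetry
  doubles 1/6 to 1/3), the resonant cubic terms, and the terms left by the second integration by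
  parts. There \<open>g\<close> is not expanded, so they contain quartic terms and forcing at
  once.\<close>

definition remainder :: "int set \<Rightarrow> (int \<Rightarrow> complex) \<Rightarrow> (int \<Rightarrow> complex) \<Rightarrow> (int \<Rightarrow> complex) \<Rightarrow> real \<Rightarrow> int \<Rightarrow> complex" where
  "remainder A x g E t k = E k
     - (\<Sum>a\<in>pairs A k. 1 / (3 * of_int a * of_int (k - a)) * (osc (k * a * (k - a)) t * (x a * E (k - a))))
     - (\<Sum>(a,c,d)\<in>res_triples A k. \<i> / (6 * of_int a) * (x a * (x c * x d)))
     + (\<Sum>(a,c,d)\<in>triples A k. tcoef (a,c,d) * (tosc (a,c,d) t * (g a * (x c * x d) + x a * (g c * x d + x c * g d))))"

lemma prim_bdry2:
  assumes T: "T \<ge> 0" and "\<And>j. j \<in> A \<Longrightarrow> prim T (\<lambda>t. x t j) (g j)"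
  shows "prim T (\<lambda>t. bdry2 A (x t) t k) (\<lambda>t. bdry2_deriv A (x t) (\<lambda>j. g j t) t k)"
  unfolding bdry2_def bdry2_deriv_def using assms(2)
  by (intro prim_sum prim_cmult prim_mult prim_osc[OF T]) (auto simp: pairs_def)

lemma prim_bdry3:
  assumes T: "T \<ge> 0" and "\<And>j. j \<in> A \<Longrightarrow> prim T (\<lambda>t. x t j) (g j)"
  shows "prim T (\<lambda>t. bdry3 A (x t) t k) (\<lambda>t. bdry3_deriv A (x t) (\<lambda>j. g j t) t k)"
  unfolding bdry3_def bdry3_deriv_def
proof (rule prim_sum, clarify)
  fix a c d assume "(a,c,d) \<in> triples A k"
  then have "a \<in> A" "c \<in> A" "d \<in> A" by (auto simp: triples_def)
  then show "prim T (\<lambda>t. - tcoef (a,c,d) * (tosc (a,c,d) t * (x t a * (x t c * x t d))))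
     (\<lambda>t. - tcoef (a,c,d) *
     (3 * \<i> * of_int ((a + c) * (c + d) * (a + d)) * tosc (a,c,d) t * (x t a * (x t c * x t d))
      + tosc (a,c,d) t * (g a t * (x t c * x t d) + x t a * (g c t * x t d + x t c * g d t))))"
    unfolding tosc_def split using assms(2)
    by (intro prim_cmult prim_mult prim_osc[OF T])
qed

text \<open>Nested pairs arise from inserting the equation for frequency \<open>k - a\<close>. That
  intermediate frequency is \<open>c + d\<close>, which explains the clause
  \<open>c + d \<in> A\<close> in both sets of triples.\<close>

lemma sum_pairs_pairs:
  fixes h :: "int \<Rightarrow> int \<Rightarrow> int \<Rightarrow> complex"
  assumes "finite A"
  shows "(\<Sum>a\<in>pairs A k. \<Sum>c\<in>pairs A (k - a). h a c (k - a - c))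
    = (\<Sum>(a,c,d)\<in>triples A k. h a c d) + (\<Sum>(a,c,d)\<in>res_triples A k. h a c d)"
proof -
  have "(\<Sum>a\<in>pairs A k. \<Sum>c\<in>pairs A (k - a). h a c (k - a - c))
     = (\<Sum>(a,c)\<in>Sigma (pairs A k) (\<lambda>a. pairs A (k - a)). h a c (k - a - c))"
    using assms by (subst sum.Sigma) (auto simp: finite_pairs)
  also have "\<dots> = (\<Sum>(a,c,d)\<in>triples A k \<union> res_triples A k. h a c d)"
  proof (rule sum.reindex_bij_witness[where i = "\<lambda>(a,c,d). (a,c)" and j = "\<lambda>(a,c). (a,c,k - a - c)"])
    fix p assume "p \<in> Sigma (pairs A k) (\<lambda>a. pairs A (k - a))"
    then obtain a c where "p = (a,c)" "a \<in> A" "k - a \<in> A" "c \<in> A" "k - a - c \<in> A"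
      by (auto simp: pairs_def)
    moreover have "c + (k - a - c) = k - a" "a + c + (k - a - c) = k" by simp_all
    ultimately show "(case p of (a,c) \<Rightarrow> (a,c,k - a - c)) \<in> triples A k \<union> res_triples A k"
      unfolding triples_def res_triples_def by (auto simp del: add_diff_cancel_left' diff_add_cancel)
  next
    fix p assume "p \<in> triples A k \<union> res_triples A k"
    then obtain a c d where p: "p = (a,c,d)" "a \<in> A" "c \<in> A" "d \<in> A" "c + d \<in> A" "a + c + d = k"
      by (auto simp: triples_def res_triples_def)
    then have "k - a = c + d" "k - a - c = d" by auto
    with p have "k - a \<in> A" "k - a - c = d" by metis+
    with p show "(case p of (a,c,d) \<Rightarrow> (a,c)) \<in> Sigma (pairs A k) (\<lambda>a. pairs A (k - a))"
      "(case case p of (a,c,d) \<Rightarrow> (a,c) of (a,c) \<Rightarrow> (a,c,k - a - c)) = p"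
      by (simp_all add: pairs_def)
  qed auto
  also have "\<dots> = (\<Sum>(a,c,d)\<in>triples A k. h a c d) + (\<Sum>(a,c,d)\<in>res_triples A k. h a c d)"
  proof (rule sum.union_disjoint)
    show "finite (res_triples A k)"
      using assms by (auto simp: res_triples_def intro: finite_subset[of _ "A \<times> A \<times> A"])
    show "finite (triples A k)" using assms by (rule finite_triples)
    show "triples A k \<inter> res_triples A k = {}" by (auto simp: triples_def res_triples_def)
  qed
  finally show ?thesis .
qed

text \<open>With \<open>d = k - a - c\<close> the right-hand side is
  \<open>(a + c) * (c + d) * (a + d)\<close>, one third of the difference between the cube of a sum
  of three numbers and the sum of their cubes.\<close>

lemma triple_phase: "(k::int) * a * (k - a) + (k - a) * c * (k - a - c) = (a + c) * (k - a) * (k - c)"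
  by (simp add: algebra_simps)

text \<open>Differentiation by parts, performed twice: the sums on the right are the time derivatives of the
  boundary terms when \<open>g\<close> is the time derivative of \<open>x\<close>.\<close>

lemma normal_form_identity:
  assumes A: "finite A" "0 \<notin> A" and k: "k \<in> A"
    and g: "\<And>j. j \<in> A \<Longrightarrow> g j = \<i> / 2 * of_int j * quad A x t j + E j"
  shows "g k = bdry2_deriv A x g t k + bdry3_deriv A x g t k + remainder A x g E t k"
proof -
  define q where "q a = osc (k * a * (k - a)) t" for a
  have q_flip: "q (k - a) = q a" for a unfolding q_def by (simp add: mult_ac)
  have nz: "a \<noteq> 0" "k - a \<noteq> 0" if "a \<in> pairs A k" for a
    using that A(2) unfolding pairs_def by (metis mem_Collect_eq)+
  define S1 where "S1 = (\<Sum>a\<in>pairs A k. 1 / (6 * of_int a * of_int (k - a)) *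
     (3 * \<i> * of_int (k * a * (k - a)) * q a * (x a * x (k - a)) + q a * (g a * x (k - a) + x a * g (k - a))))"
  define SE where "SE = (\<Sum>a\<in>pairs A k. 1 / (3 * of_int a * of_int (k - a)) * (q a * (x a * E (k - a))))"
  define ST where "ST = (\<Sum>(a,c,d)\<in>triples A k. \<i> / (6 * of_int a) * (tosc (a,c,d) t * (x a * (x c * x d))))"
  define SR where "SR = (\<Sum>(a,c,d)\<in>res_triples A k. \<i> / (6 * of_int a) * (x a * (x c * x d)))"
  define SG where "SG = (\<Sum>(a,c,d)\<in>triples A k. tcoef (a,c,d) * (tosc (a,c,d) t * (g a * (x c * x d) + x a * (g c * x d + x c * g d))))"
  have "S1 = (\<Sum>a\<in>pairs A k. \<i> / 2 * of_int k * (q a * (x a * x (k - a)))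
      + 1 / (6 * of_int a * of_int (k - a)) * (q a * (g a * x (k - a))) + 1 / (6 * of_int a * of_int (k - a)) * (q a * (x a * g (k - a))))"
    unfolding S1_def
  proof (rule sum.cong[OF refl])
    fix a assume "a \<in> pairs A k"
    from nz[OF this] have "(of_int a :: complex) \<noteq> 0" "(of_int (k - a) :: complex) \<noteq> 0" 
      unfolding of_int_eq_0_iff by auto
    then show "1 / (6 * of_int a * of_int (k - a)) *
     (3 * \<i> * of_int (k * a * (k - a)) * q a * (x a * x (k - a)) + q a * (g a * x (k - a) + x a * g (k - a)))
      = \<i> / 2 * of_int k * (q a * (x a * x (k - a)))
      + 1 / (6 * of_int a * of_int (k - a)) * (q a * (g a * x (k - a))) + 1 / (6 * of_int a * of_int (k - a)) * (q a * (x a * g (k - a)))"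
      unfolding of_int_mult by (simp add: field_simps del: of_int_diff)
  qed
  also have "\<dots> = \<i> / 2 * of_int k * quad A x t k 
      + (\<Sum>a\<in>pairs A k. 1 / (6 * of_int a * of_int (k - a)) * (q a * (g a * x (k - a))))
      + (\<Sum>a\<in>pairs A k. 1 / (6 * of_int a * of_int (k - a)) * (q a * (x a * g (k - a))))"
    unfolding quad_def q_def sum.distrib by (simp add: sum_distrib_left)
  \<comment> \<open>The reflection of \<open>a\<close> into \<open>k - a\<close> preserves
    coefficient and phase, so the two derivative terms coincide and 1/6 becomes 1/3.\<close>
  also have "(\<Sum>a\<in>pairs A k. 1 / (6 * of_int a * of_int (k - a)) * (q a * (g a * x (k - a))))
     = (\<Sum>a\<in>pairs A k. 1 / (6 * of_int a * of_int (k - a)) * (q a * (x a * g (k - a))))"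
    using sum_pairs_flip[of "\<lambda>a b. 1 / (6 * of_int a * of_int b) * (q a * (g a * x b))" k A]
    by (simp add: q_flip mult_ac)
  also have "\<i> / 2 * of_int k * quad A x t k = g k - E k"
    using g[OF k] by simp
  finally have "g k = S1 + E k - (\<Sum>a\<in>pairs A k. 1 / (3 * of_int a * of_int (k - a)) * (q a * (x a * g (k - a))))"
    by (simp add: mult.assoc sum_distrib_left)
  \<comment> \<open>The frequency \<open>k - a\<close> in front of \<open>quad\<close> cancels the
    denominator \<open>k - a\<close>, leaving \<open>\<i> / (6 * a)\<close> for the cubic
    terms.\<close>
  also have "(\<Sum>a\<in>pairs A k. 1 / (3 * of_int a * of_int (k - a)) * (q a * (x a * g (k - a))))
     = (\<Sum>a\<in>pairs A k. (\<Sum>c\<in>pairs A (k - a). \<i> / (6 * of_int a) * (osc ((a + c) * (c + (k - a - c)) * (a + (k - a - c))) t * (x a * (x c * x (k - a - c)))))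
        + 1 / (3 * of_int a * of_int (k - a)) * (q a * (x a * E (k - a))))"
  proof (rule sum.cong[OF refl])
    fix a assume a: "a \<in> pairs A k"
    have gg: "g (k - a) = \<i> / 2 * of_int (k - a) * quad A x t (k - a) + E (k - a)"
      using a by (intro g) (simp add: pairs_def)
    have "1 / (3 * of_int a * of_int (k - a)) * (q a * (x a * (\<i> / 2 * of_int (k - a) * quad A x t (k - a))))
       = \<i> / (6 * of_int a) * (q a * (x a * quad A x t (k - a)))"
      using nz[OF a] by (simp add: field_simps del: of_int_diff)
    also have "\<dots> = (\<Sum>c\<in>pairs A (k - a). \<i> / (6 * of_int a) * (q a * osc ((k - a) * c * (k - a - c)) t * (x a * (x c * x (k - a - c)))))"
      unfolding quad_def sum_distrib_left by (simp add: mult_ac)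
    also have "\<dots> = (\<Sum>c\<in>pairs A (k - a). \<i> / (6 * of_int a) * (osc ((a + c) * (c + (k - a - c)) * (a + (k - a - c))) t * (x a * (x c * x (k - a - c)))))"
      unfolding q_def osc_add triple_phase by simp
    finally show "1 / (3 * of_int a * of_int (k - a)) * (q a * (x a * g (k - a))) = 
       (\<Sum>c\<in>pairs A (k - a). \<i> / (6 * of_int a) * (osc ((a + c) * (c + (k - a - c)) * (a + (k - a - c))) t * (x a * (x c * x (k - a - c)))))
        + 1 / (3 * of_int a * of_int (k - a)) * (q a * (x a * E (k - a)))"
      unfolding gg by (simp only: distrib_left)
  qed
  also have "\<dots> = ST + (\<Sum>(a,c,d)\<in>res_triples A k. \<i> / (6 * of_int a) * (osc ((a + c) * (c + d) * (a + d)) t * (x a * (x c * x d)))) + SE"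
    unfolding sum.distrib SE_def
    by (subst sum_pairs_pairs[OF A(1), of "\<lambda>a c d. \<i> / (6 * of_int a) * (osc ((a + c) * (c + d) * (a + d)) t * (x a * (x c * x d)))"])
      (simp add: ST_def tosc_def)
  also have "(\<Sum>(a,c,d)\<in>res_triples A k. \<i> / (6 * of_int a) * (osc ((a + c) * (c + d) * (a + d)) t * (x a * (x c * x d)))) = SR"
    unfolding SR_def
  proof (rule sum.cong[OF refl], clarify)
    fix a c d assume "(a,c,d) \<in> res_triples A k"
    then have "(a + c) * (c + d) * (a + d) = 0" by (auto simp: res_triples_def)
    then show "\<i> / (6 * of_int a) * (osc ((a + c) * (c + d) * (a + d)) t * (x a * (x c * x d))) = \<i> / (6 * of_int a) * (x a * (x c * x d))"
      by (simp only: osc_0 mult_1_left)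
  qed
  finally have 1: "g k = S1 + E k - (ST + SR + SE)" .
  have 2: "bdry3_deriv A x g t k = - ST - SG"
    unfolding bdry3_deriv_def ST_def SG_def sum_negf[symmetric] sum_subtractf[symmetric]
  proof (rule sum.cong[OF refl], clarify)
    fix a c d assume t: "(a,c,d) \<in> triples A k"
    have "a \<noteq> 0" "a + c \<noteq> 0" "c + d \<noteq> 0" "a + d \<noteq> 0"
      using t A(2) unfolding triples_def by auto
    then have nz: "(of_int a :: complex) \<noteq> 0" "(of_int (a + c) :: complex) \<noteq> 0" "(of_int (c + d) :: complex) \<noteq> 0" "(of_int (a + d) :: complex) \<noteq> 0"
      unfolding of_int_eq_0_iff by auto
    have co: "tcoef (a,c,d) * (3 * \<i> * of_int ((a + c) * (c + d) * (a + d))) = \<i> / (6 * of_int a)"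
      unfolding tcoef_def of_int_mult split using nz by (simp add: field_simps del: of_int_add)
    have *: "- u * (p * r * m + y) = - (u * p) * (r * m) - u * y" for u p r m y :: complex
      by (simp add: algebra_simps)
    show "- tcoef (a,c,d) * (3 * \<i> * of_int ((a + c) * (c + d) * (a + d)) * tosc (a,c,d) t * (x a * (x c * x d))
      + tosc (a,c,d) t * (g a * (x c * x d) + x a * (g c * x d + x c * g d))) =
       - (\<i> / (6 * of_int a) * (tosc (a,c,d) t * (x a * (x c * x d)))) - tcoef (a,c,d) * (tosc (a,c,d) t * (g a * (x c * x d) + x a * (g c * x d + x c * g d)))"
      unfolding * co by simp
  qed
  show ?thesis
    unfolding 2 bdry2_deriv_def remainder_def SE_def[symmetric, unfolded q_def] SR_def[symmetric] SG_def[symmetric]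
    using 1 unfolding S1_def q_def by simp
qed

lemma prim_normal_form:
  assumes T: "T \<ge> 0" and A: "finite A" "0 \<notin> A" and k: "k \<in> A"
    and x: "\<And>j. j \<in> A \<Longrightarrow> prim T (\<lambda>t. x t j) (g j)"
    and g: "\<And>j t. j \<in> A \<Longrightarrow> t \<in> {0..T} \<Longrightarrow> g j t = \<i> / 2 * of_int j * quad A (x t) t j + E t j"
  shows "prim T (\<lambda>t. x t k - (bdry2 A (x t) t k + bdry3 A (x t) t k)) (\<lambda>t. remainder A (x t) (\<lambda>j. g j t) (E t) t k)"
proof -
  have eq: "g k t - (bdry2_deriv A (x t) (\<lambda>j. g j t) t k + bdry3_deriv A (x t) (\<lambda>j. g j t) t k)
    = remainder A (x t) (\<lambda>j. g j t) (E t) t k" if "t \<in> {0..T}" for t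
    using normal_form_identity[OF A k, of "\<lambda>j. g j t" "x t" t "E t", OF g[OF _ that]] by simp
  show ?thesis
    by (rule prim_cong[OF prim_minus[OF x[OF k] prim_add[OF prim_bdry2[where x = x and A = A, OF T x]
        prim_bdry3[where x = x and A = A, OF T x]]]])
      (auto simp: eq)
qed

section \<open>Multilinear estimates\<close>

text \<open>The choice of the six bounds makes \<open>dom\<close> stable under multiplication of pairs.\<close>

definition dom :: "real \<Rightarrow> real \<Rightarrow> real \<Rightarrow> real \<Rightarrow> real \<Rightarrow> complex \<Rightarrow> complex \<Rightarrow> bool" where
  "dom w D U L S X Y \<longleftrightarrow> cmod X \<le> D \<and> cmod Y \<le> D \<and> w * cmod X \<le> U \<and> w * cmod Y \<le> U
     \<and> cmod (X - Y) \<le> L \<and> w * cmod (X - Y) \<le> S"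

lemma dom_mono:
  "dom w D U L S X Y \<Longrightarrow> D \<le> D' \<Longrightarrow> U \<le> U' \<Longrightarrow> L \<le> L' \<Longrightarrow> S \<le> S' \<Longrightarrow> dom w D' U' L' S' X Y"
  unfolding dom_def by linarith

lemma dom_weight:
  assumes "dom w D U L S X Y" shows "w * cmod (X - Y) \<le> S"
  using assms unfolding dom_def by blast

lemma dom_zero: "dom w 0 0 0 0 0 0"
  unfolding dom_def by simp

lemma dom_add:
  assumes "dom w D U L S X Y" "dom w D' U' L' S' X' Y'" "w \<ge> 0"
  shows "dom w (D + D') (U + U') (L + L') (S + S') (X + X') (Y + Y')"
proof -
  have n: "cmod (X + X') \<le> cmod X + cmod X'" "cmod (Y + Y') \<le> cmod Y + cmod Y'"
    "cmod (X + X' - (Y + Y')) \<le> cmod (X - Y) + cmod (X' - Y')"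
    using norm_triangle_ineq[of "X - Y" "X' - Y'"] by (auto simp: norm_triangle_ineq algebra_simps)
  have "w * cmod (X + X') \<le> w * cmod X + w * cmod X'" "w * cmod (Y + Y') \<le> w * cmod Y + w * cmod Y'"
    "w * cmod (X + X' - (Y + Y')) \<le> w * cmod (X - Y) + w * cmod (X' - Y')"
    unfolding distrib_left[symmetric] using n assms(3) by (auto intro!: mult_left_mono)
  then show ?thesis using assms n unfolding dom_def by linarith
qed

lemma dom_sum:
  assumes "\<And>i. i \<in> A \<Longrightarrow> dom w (D i) (U i) (L i) (S i) (X i) (Y i)" "w \<ge> 0"
  shows "dom w (sum D A) (sum U A) (sum L A) (sum S A) (sum X A) (sum Y A)"
  using assms by (induction A rule: infinite_finite_induct) (auto intro!: dom_zero dom_add)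

lemma dom_unimodular:
  assumes "dom w D U L S X Y" "cmod c = 1" shows "dom w D U L S (c * X) (c * Y)"
  using assms unfolding dom_def right_diff_distrib[symmetric] by (simp add: norm_mult)

text \<open>A Leibniz rule for both the weight and the difference:
  \<open>w \<le> C * (w1 + w2)\<close> places the weight on one factor at a time, and the product
  difference is split into differences of single factors.\<close>

lemma dom_mult:
  assumes 1: "dom w1 D1 U1 L1 S1 X1 Y1" and 2: "dom w2 D2 U2 L2 S2 X2 Y2"
    and w: "0 \<le> w" "w \<le> C * (w1 + w2)" "0 \<le> w1" "0 \<le> w2" "0 \<le> C"
  shows "dom w (D1 * D2) (C * (U1 * D2 + D1 * U2)) (L1 * D2 + D1 * L2)
     (C * (S1 * D2 + L1 * U2 + U1 * L2 + D1 * S2)) (X1 * X2) (Y1 * Y2)"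
proof -
  have nn: "0 \<le> D1" "0 \<le> D2" "0 \<le> L1" "0 \<le> L2" "0 \<le> U1" "0 \<le> U2" "0 \<le> S1" "0 \<le> S2"
    using 1 2 w unfolding dom_def by (meson mult_nonneg_nonneg norm_ge_zero order_trans)+
  have prod: "w * (p * q) \<le> C * (p' * q'' + p'' * q')"
    if "0 \<le> p" "0 \<le> q" "w1 * p \<le> p'" "q \<le> q''" "p \<le> p''" "w2 * q \<le> q'" for p q p' q' p'' q'' :: real
  proof -
    have "w * (p * q) \<le> C * (w1 + w2) * (p * q)"
      using w that by (intro mult_right_mono) auto
    also have "\<dots> = C * (w1 * p * q + p * (w2 * q))" by (simp add: algebra_simps)
    also have "\<dots> \<le> C * (p' * q'' + p'' * q')"
      using that w by (intro mult_left_mono add_mono mult_mono) (auto intro: order_trans[OF _ that(3)] order_trans[OF that(1)] order_trans[OF that(2)])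
    finally show ?thesis .
  qed
  have diff: "X1 * X2 - Y1 * Y2 = (X1 - Y1) * X2 + Y1 * (X2 - Y2)"
    by (simp add: algebra_simps)
  have d: "cmod (X1 * X2 - Y1 * Y2) \<le> cmod (X1 - Y1) * cmod X2 + cmod Y1 * cmod (X2 - Y2)"
    unfolding diff by (rule order_trans[OF norm_triangle_ineq]) (simp add: norm_mult)
  have b: "cmod X1 \<le> D1" "cmod Y1 \<le> D1" "w1 * cmod X1 \<le> U1" "w1 * cmod Y1 \<le> U1" "cmod (X1 - Y1) \<le> L1" "w1 * cmod (X1 - Y1) \<le> S1"
    "cmod X2 \<le> D2" "cmod Y2 \<le> D2" "w2 * cmod X2 \<le> U2" "w2 * cmod Y2 \<le> U2" "cmod (X2 - Y2) \<le> L2" "w2 * cmod (X2 - Y2) \<le> S2"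
    using 1 2 unfolding dom_def by blast+
  have "cmod (X1 * X2) \<le> D1 * D2" "cmod (Y1 * Y2) \<le> D1 * D2"
    unfolding norm_mult using b nn by (auto intro!: mult_mono)
  moreover have "w * cmod (X1 * X2) \<le> C * (U1 * D2 + D1 * U2)" "w * cmod (Y1 * Y2) \<le> C * (U1 * D2 + D1 * U2)"
    unfolding norm_mult using b by (auto intro!: prod)
  moreover have "cmod (X1 * X2 - Y1 * Y2) \<le> L1 * D2 + D1 * L2"
    using b nn by (intro order_trans[OF d] add_mono mult_mono) auto
  moreover have "w * cmod (X1 * X2 - Y1 * Y2) \<le> C * (S1 * D2 + L1 * U2 + U1 * L2 + D1 * S2)"
  proof -
    have "w * cmod (X1 * X2 - Y1 * Y2) \<le> w * (cmod (X1 - Y1) * cmod X2) + w * (cmod Y1 * cmod (X2 - Y2))"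
      using d w(1) by (simp add: mult_left_mono flip: distrib_left)
    also have "\<dots> \<le> C * (S1 * D2 + L1 * U2) + C * (U1 * L2 + D1 * S2)"
      using b by (intro add_mono prod) auto
    finally show ?thesis by (simp add: algebra_simps)
  qed
  ultimately show ?thesis unfolding dom_def by blast
qed

text \<open>All sequences share one profile \<open>\<phi>\<close>. The constants measure plain size
  (\<open>D\<close>), weighted size (\<open>U\<close>), plain difference (\<open>L\<close>) and
  weighted difference (\<open>S\<close>). A product has mixed terms in which the weight and the
  difference fall on different factors; \<open>UL\<close> absorbs them, so every estimate is linear
  in \<open>S\<close> with coefficients made of \<open>C\<close> and \<open>D\<close>.\<close>

locale dominated =
  fixes m :: "int \<Rightarrow> real" and C D U L S :: real and \<phi> :: "int \<Rightarrow> real" and x y :: "int \<Rightarrow> complex"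
  assumes m: "\<And>k. m k \<ge> 0" "\<And>a b. m (a + b) \<le> C * (m a + m b)" and C: "C \<ge> 1"
    and D: "D \<ge> 0" and U: "U \<ge> 0" and L: "L \<ge> 0" and S: "S \<ge> 0" and UL: "L * U \<le> S * D"
    and \<phi>: "l2bd \<phi> 4" "\<And>k. \<phi> k \<ge> 0"
    and dom: "\<And>k. k \<noteq> 0 \<Longrightarrow> dom (m k) (D * \<phi> k) (U * \<phi> k) (L * \<phi> k) (S * \<phi> k) (x k) (y k)"
begin

lemma dom2:
  assumes "a \<noteq> 0" "b \<noteq> 0"
  shows "dom (m (a + b)) (D\<^sup>2 * (\<phi> a * \<phi> b)) (2 * C * U * D * (\<phi> a * \<phi> b)) (2 * L * D * (\<phi> a * \<phi> b))
     (4 * C * S * D * (\<phi> a * \<phi> b)) (x a * x b) (y a * y b)"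
proof -
  have "L * U * (\<phi> a * \<phi> b) \<le> S * D * (\<phi> a * \<phi> b)"
    using UL \<phi>(2) by (intro mult_right_mono) auto
  then have "C * (L * U * (\<phi> a * \<phi> b)) \<le> C * (S * D * (\<phi> a * \<phi> b))"
    using C by (intro mult_left_mono) auto
  moreover have "0 \<le> C" using C by simp
  note dom_mult[OF dom[OF assms(1)] dom[OF assms(2)] m(1) m(2) m(1) m(1) this]
  ultimately show ?thesis
    by (elim dom_mono) (simp_all add: algebra_simps power2_eq_square)
qed

text \<open>The 9 is 1 + 2 + 2 + 4, counted after \<open>UL\<close> has turned \<open>L * U\<close>
  into \<open>S * D\<close> and \<open>C \<ge> 1\<close> has equalised the powers of
  \<open>C\<close>.\<close>

lemma dom3:
  assumes "a \<noteq> 0" "b \<noteq> 0" "c \<noteq> 0"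
  shows "m (a + (b + c)) * cmod (x a * (x b * x c) - y a * (y b * y c)) \<le> 9 * C\<^sup>2 * S * D\<^sup>2 * (\<phi> a * (\<phi> b * \<phi> c))"
proof -
  let ?p = "\<phi> a * (\<phi> b * \<phi> c)"
  have "m (a + (b + c)) * cmod (x a * (x b * x c) - y a * (y b * y c)) \<le>
    C * (S * \<phi> a * (D\<^sup>2 * (\<phi> b * \<phi> c)) + L * \<phi> a * (2 * C * U * D * (\<phi> b * \<phi> c)) + U * \<phi> a * (2 * L * D * (\<phi> b * \<phi> c)) + D * \<phi> a * (4 * C * S * D * (\<phi> b * \<phi> c)))"
    using C by (intro dom_weight[OF dom_mult[OF dom[OF assms(1)] dom2[OF assms(2,3)] m(1) m(2) m(1) m(1)]]) auto
  also have "\<dots> = C * ?p * (S * D\<^sup>2 + 2 * C * D * (L * U) + 2 * D * (L * U) + 4 * C * D * (S * D))"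
    by (simp add: algebra_simps power2_eq_square)
  also have "\<dots> \<le> C * ?p * (C * (S * D\<^sup>2) + 2 * C * D * (S * D) + C * (2 * D * (S * D)) + 4 * C * D * (S * D))"
  proof (rule mult_left_mono)
    have 1: "2 * C * D * (L * U) \<le> 2 * C * D * (S * D)"
      using UL C D by (intro mult_left_mono) auto
    have "2 * D * (L * U) \<le> 2 * D * (S * D)"
      using UL D by (intro mult_left_mono) auto
    also have "\<dots> \<le> C * \<dots>" using C D S mult_right_mono[of 1 C "2 * D * (S * D)"] by simp
    finally have 2: "2 * D * (L * U) \<le> C * (2 * D * (S * D))" .
    have "S * D\<^sup>2 \<le> C * (S * D\<^sup>2)" using C S mult_right_mono[of 1 C "S * D\<^sup>2"] by simp
    with 1 2 show "S * D\<^sup>2 + 2 * C * D * (L * U) + 2 * D * (L * U) + 4 * C * D * (S * D) \<le>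
      C * (S * D\<^sup>2) + 2 * C * D * (S * D) + C * (2 * D * (S * D)) + 4 * C * D * (S * D)"
      by linarith
  qed (use C \<phi>(2) in auto)
  also have "\<dots> = 9 * C\<^sup>2 * S * D\<^sup>2 * ?p" by (simp add: algebra_simps power2_eq_square)
  finally show ?thesis .
qed

end

locale dominated_on = dominated + fixes A :: "int set"
  assumes A: "finite A" "0 \<notin> A"
begin

sublocale l2seq \<phi> 4 A
  using \<phi> A by unfold_locales

lemma nz: "a \<in> A \<Longrightarrow> a \<noteq> 0"
  using A(2) by metis

lemma sum_pairs_le: "(\<Sum>a\<in>pairs A k. \<phi> a * \<phi> (k - a)) \<le> 16"
proof -
  have "(\<Sum>a\<in>pairs A k. \<phi> a * \<phi> (k - a)) \<le> 4 * 4"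
    using A by (intro l2bd_sum_mult[OF \<phi>(1) \<phi>(1), where p = "\<lambda>a. a" and q = "\<lambda>a. k - a"])
     (auto simp: finite_pairs \<phi>(2) inj_on_def pairs_def)
  then show ?thesis by simp
qed

lemma dom_quad:
  "dom (m k) (16 * D\<^sup>2) (32 * C * U * D) (32 * L * D) (64 * C * S * D) (quad A x t k) (quad A y t k)"
proof -
  have "dom (m k) (\<Sum>a\<in>pairs A k. D\<^sup>2 * (\<phi> a * \<phi> (k - a))) (\<Sum>a\<in>pairs A k. 2 * C * U * D * (\<phi> a * \<phi> (k - a)))
     (\<Sum>a\<in>pairs A k. 2 * L * D * (\<phi> a * \<phi> (k - a))) (\<Sum>a\<in>pairs A k. 4 * C * S * D * (\<phi> a * \<phi> (k - a)))
     (quad A x t k) (quad A y t k)"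
    unfolding quad_def
  proof (intro dom_sum dom_unimodular norm_osc m)
    fix a assume "a \<in> pairs A k"
    then have "a \<noteq> 0" "k - a \<noteq> 0" using nz unfolding pairs_def by blast+
    from dom2[OF this] show "dom (m k) (D\<^sup>2 * (\<phi> a * \<phi> (k - a))) (2 * C * U * D * (\<phi> a * \<phi> (k - a))) (2 * L * D * (\<phi> a * \<phi> (k - a)))
     (4 * C * S * D * (\<phi> a * \<phi> (k - a))) (x a * x (k - a)) (y a * y (k - a))"
      by simp
  qed
  then show ?thesis
    unfolding sum_distrib_left[symmetric]
  proof (rule dom_mono)
    have *: "c * (\<Sum>a\<in>pairs A k. \<phi> a * \<phi> (k - a)) \<le> c * 16" if "c \<ge> 0" for c
      using sum_pairs_le that by (rule mult_left_mono)
    have nn: "0 \<le> D\<^sup>2" "0 \<le> 2 * C * U * D" "0 \<le> 2 * L * D" "0 \<le> 4 * C * S * D"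
      using C U D L S by auto
    show "D\<^sup>2 * (\<Sum>a\<in>pairs A k. \<phi> a * \<phi> (k - a)) \<le> 16 * D\<^sup>2"
      "2 * C * U * D * (\<Sum>a\<in>pairs A k. \<phi> a * \<phi> (k - a)) \<le> 32 * C * U * D"
      "2 * L * D * (\<Sum>a\<in>pairs A k. \<phi> a * \<phi> (k - a)) \<le> 32 * L * D"
      "4 * C * S * D * (\<Sum>a\<in>pairs A k. \<phi> a * \<phi> (k - a)) \<le> 64 * C * S * D"
      using *[OF nn(1)] *[OF nn(2)] *[OF nn(3)] *[OF nn(4)] by linarith+
  qed
qed

text \<open>The frequencies \<open>a\<close> and \<open>k - a\<close> add up to \<open>k\<close>,
  which converts their denominators into at most 2 / |k|. This decay is what makes the boundary term
  small at high output frequencies. The 22 rounds up 64 / 3.\<close>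

lemma bdry2_diff:
  assumes k: "k \<noteq> 0"
  shows "m k * cmod (bdry2 A x t k - bdry2 A y t k) \<le> 22 * C * D * S / mag k"
proof -
  have "m k * cmod (bdry2 A x t k - bdry2 A y t k) \<le>
     (\<Sum>a\<in>pairs A k. m k * cmod (1 / (6 * of_int a * of_int (k - a)) * (osc (k * a * (k - a)) t * (x a * x (k - a) - y a * y (k - a)))))"
    unfolding bdry2_def sum_subtractf[symmetric] right_diff_distrib[symmetric] sum_distrib_left[symmetric]
    by (intro mult_left_mono norm_sum m)
  also have "\<dots> \<le> (\<Sum>a\<in>pairs A k. 4 * C * S * D / (3 * mag k) * (\<phi> a * \<phi> (k - a)))"
  proof (rule sum_mono)
    fix a assume "a \<in> pairs A k"
    then have "a \<noteq> 0" "k - a \<noteq> 0" using nz unfolding pairs_def by blast+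
    then have ge1: "mag a \<ge> 1" "mag (k - a) \<ge> 1" by linarith+
    have "1 / (mag a * mag (k - a)) \<le> (1 / mag a + 1 / mag (k - a)) / mag k"
      using ge1 k by (intro inverse_prod2_le) auto
    also have "\<dots> \<le> 2 / mag k"
    proof (rule divide_right_mono)
      have "1 / p \<le> 1" if "p \<ge> 1" for p :: real using that by simp
      from this[OF ge1(1)] this[OF ge1(2)]
      show "1 / mag a + 1 / mag (k - a) \<le> 2" by linarith
    qed simp
    finally have 1: "1 / (mag a * mag (k - a)) \<le> 2 / mag k" .
    have 2: "m k * cmod (x a * x (k - a) - y a * y (k - a)) \<le> 4 * C * S * D * (\<phi> a * \<phi> (k - a))"
      using dom_weight[OF dom2[OF \<open>a \<noteq> 0\<close> \<open>k - a \<noteq> 0\<close>]] by simp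
    have "m k * cmod (1 / (6 * of_int a * of_int (k - a)) * (osc (k * a * (k - a)) t * (x a * x (k - a) - y a * y (k - a))))
      = 1 / 6 * (1 / (mag a * mag (k - a))) * (m k * cmod (x a * x (k - a) - y a * y (k - a)))"
      by (simp add: norm_mult norm_divide norm_osc del: of_int_diff)
    also have "\<dots> \<le> 1 / 6 * (2 / mag k) * (4 * C * S * D * (\<phi> a * \<phi> (k - a)))"
      by (rule mult_mono[OF mult_left_mono[OF 1] 2]) (use m(1) in auto)
    finally show "m k * cmod (1 / (6 * of_int a * of_int (k - a)) * (osc (k * a * (k - a)) t * (x a * x (k - a) - y a * y (k - a))))
      \<le> 4 * C * S * D / (3 * mag k) * (\<phi> a * \<phi> (k - a))" by simp
  qed
  also have "\<dots> \<le> 4 * C * S * D / (3 * mag k) * 16"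
    unfolding sum_distrib_left[symmetric] using sum_pairs_le C S D by (intro mult_left_mono) auto
  also have "\<dots> \<le> 22 * C * D * S / mag k"
    using C S D by (simp add: divide_simps)
  finally show ?thesis .
qed

lemma norm_tcoef: "cmod (tcoef (a,c,d)) = 1 / 18 * (1 / mag a * tker a c d)"
  unfolding tcoef_def tker_def split
  by (simp add: norm_divide norm_mult flip: of_int_add)

lemma norm_tosc: "cmod (tosc (a,c,d) t) = 1"
  unfolding tosc_def by (simp add: norm_osc)

text \<open>The 256 is 9 / 18 * 8 * 4 ^ 3, with factors from \<open>dom3\<close>,
  \<open>tcoef\<close> and \<open>tker_sum3\<close>.\<close>

lemma bdry3_diff:
  assumes k: "k \<noteq> 0"
  shows "m k * cmod (bdry3 A x t k - bdry3 A y t k) \<le> 256 * C\<^sup>2 * D\<^sup>2 * S / mag k"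
proof -
  have "bdry3 A x t k - bdry3 A y t k = (\<Sum>(a,c,d)\<in>triples A k. - tcoef (a,c,d) * (tosc (a,c,d) t * (x a * (x c * x d) - y a * (y c * y d))))"
    unfolding bdry3_def sum_subtractf[symmetric] by (rule sum.cong) (auto simp: algebra_simps)
  then have "m k * cmod (bdry3 A x t k - bdry3 A y t k) \<le>
     (\<Sum>z\<in>triples A k. m k * cmod (case z of (a,c,d) \<Rightarrow> - tcoef (a,c,d) * (tosc (a,c,d) t * (x a * (x c * x d) - y a * (y c * y d)))))"
    unfolding sum_distrib_left[symmetric] by (simp only:) (intro mult_left_mono norm_sum m)
  also have "\<dots> \<le> (\<Sum>(a,c,d)\<in>triples A k. C\<^sup>2 * S * D\<^sup>2 / 2 * (\<phi> a * (\<phi> c * \<phi> d) / mag a * tker a c d))"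
  proof (rule sum_mono, clarify)
    fix a c d assume t: "(a,c,d) \<in> triples A k"
    then have "a \<noteq> 0" "c \<noteq> 0" "d \<noteq> 0" and ks: "a + (c + d) = k" using nz unfolding triples_def by auto
    have "m k * cmod (- tcoef (a,c,d) * (tosc (a,c,d) t * (x a * (x c * x d) - y a * (y c * y d))))
       = 1 / 18 * (1 / mag a * tker a c d) * (m k * cmod (x a * (x c * x d) - y a * (y c * y d)))"
      by (simp only: norm_mult norm_minus_cancel norm_tcoef norm_tosc) simp
    also have "\<dots> \<le> 1 / 18 * (1 / mag a * tker a c d) * (9 * C\<^sup>2 * S * D\<^sup>2 * (\<phi> a * (\<phi> c * \<phi> d)))"
      using dom3[OF \<open>a \<noteq> 0\<close> \<open>c \<noteq> 0\<close> \<open>d \<noteq> 0\<close>] unfolding ks by (intro mult_left_mono) (simp_all add: tker_nonneg)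
    finally show "m k * cmod (- tcoef (a,c,d) * (tosc (a,c,d) t * (x a * (x c * x d) - y a * (y c * y d))))
        \<le> C\<^sup>2 * S * D\<^sup>2 / 2 * (\<phi> a * (\<phi> c * \<phi> d) / mag a * tker a c d)" by (simp add: mult_ac)
  qed
  also have "\<dots> = C\<^sup>2 * S * D\<^sup>2 / 2 * (\<Sum>(a,c,d)\<in>triples A k. \<phi> a * (\<phi> c * \<phi> d) / mag a * tker a c d)"
    by (simp add: sum_distrib_left split_def)
  also have "\<dots> \<le> C\<^sup>2 * S * D\<^sup>2 / 2 * (8 * 4 ^ 3 / mag k)"
    using tker_sum3[OF k] C S by (intro mult_left_mono) auto
  also have "\<dots> = 256 * C\<^sup>2 * D\<^sup>2 * S / mag k" by simp
  finally show ?thesis .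
qed

text \<open>Putting a time derivative on frequency \<open>a\<close> costs the factor
  \<open>mag a\<close> that \<open>tker_sum_deriv\<close> can pay for. The two forcings are bounded
  separately instead of being compared, so their contribution is not proportional to
  \<open>S\<close>. The 128 is half of 128 + 128, where one summand stems from the mixed
  terms.\<close>

lemma deriv_term_diff:
  fixes ga ha Ea Fa :: complex
  assumes a: "a \<in> A" and cd: "c \<noteq> 0" "d \<noteq> 0"
    and g: "ga = \<i> / 2 * of_int a * quad A x t a + Ea" "ha = \<i> / 2 * of_int a * quad A y t a + Fa"
    and E: "cmod (Ea) \<le> mag a * \<eta>" "cmod (Fa) \<le> mag a * \<eta>"
  shows "m (a + (c + d)) * cmod (ga * (x c * x d) - ha * (y c * y d)) \<le>
     mag a * (\<phi> c * \<phi> d) * (128 * C\<^sup>2 * S * D ^ 3 + 2 * m (a + (c + d)) * \<eta> * D\<^sup>2)"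
proof -
  let ?m = "m (a + (c + d))" and ?p = "\<phi> c * \<phi> d" and ?Q = "quad A x t a" and ?R = "quad A y t a"
  have p0: "?p \<ge> 0" using \<phi>(2) by simp
  have "?m * cmod (?Q * (x c * x d) - ?R * (y c * y d)) \<le>
     C * (64 * C * S * D * (D\<^sup>2 * ?p) + 32 * L * D * (2 * C * U * D * ?p) + 32 * C * U * D * (2 * L * D * ?p) + 16 * D\<^sup>2 * (4 * C * S * D * ?p))"
    using C by (intro dom_weight[OF dom_mult[OF dom_quad dom2[OF cd] m(1) m(2) m(1) m(1)]]) auto
  also have "\<dots> = 128 * C\<^sup>2 * (S * D) * D\<^sup>2 * ?p + 128 * C\<^sup>2 * (L * U) * D\<^sup>2 * ?p"
    by (simp add: algebra_simps power2_eq_square)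
  also have "128 * C\<^sup>2 * (L * U) * D\<^sup>2 * ?p \<le> 128 * C\<^sup>2 * (S * D) * D\<^sup>2 * ?p"
    using UL p0 by (intro mult_right_mono mult_left_mono) auto
  finally have 1: "?m * cmod (?Q * (x c * x d) - ?R * (y c * y d)) \<le> 256 * C\<^sup>2 * S * D ^ 3 * ?p"
    by (simp add: power2_eq_square power3_eq_cube algebra_simps)
  have "cmod (x c * x d) \<le> D\<^sup>2 * ?p" "cmod (y c * y d) \<le> D\<^sup>2 * ?p"
    using dom2[OF cd] unfolding dom_def by blast+
  then have "cmod (Ea) * cmod (x c * x d) \<le> mag a * \<eta> * (D\<^sup>2 * ?p)" "cmod (Fa) * cmod (y c * y d) \<le> mag a * \<eta> * (D\<^sup>2 * ?p)"
    using E by (auto intro!: mult_mono order_trans[OF norm_ge_zero E(1)])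
  then have 2: "cmod (Ea * (x c * x d) - Fa * (y c * y d)) \<le> 2 * (mag a * \<eta> * (D\<^sup>2 * ?p))"
    using norm_triangle_ineq4[of "Ea * (x c * x d)" "Fa * (y c * y d)"] by (simp add: norm_mult)
  have "ga * (x c * x d) - ha * (y c * y d) = \<i> / 2 * of_int a * (?Q * (x c * x d) - ?R * (y c * y d)) + (Ea * (x c * x d) - Fa * (y c * y d))"
    unfolding g by (simp add: algebra_simps)
  then have "cmod (ga * (x c * x d) - ha * (y c * y d)) \<le> mag a / 2 * cmod (?Q * (x c * x d) - ?R * (y c * y d)) + cmod (Ea * (x c * x d) - Fa * (y c * y d))"
    by (auto simp: norm_mult norm_divide intro!: order_trans[OF norm_triangle_ineq])
  also have "\<dots> \<le> mag a / 2 * cmod (?Q * (x c * x d) - ?R * (y c * y d)) + 2 * (mag a * \<eta> * (D\<^sup>2 * ?p))"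
    using 2 by simp
  finally have "?m * cmod (ga * (x c * x d) - ha * (y c * y d)) \<le> ?m * \<dots>"
    by (rule mult_left_mono) (rule m)
  also have "\<dots> = mag a / 2 * (?m * cmod (?Q * (x c * x d) - ?R * (y c * y d))) + 2 * ?m * (mag a * \<eta> * (D\<^sup>2 * ?p))"
    by (simp add: algebra_simps)
  also have "\<dots> \<le> mag a / 2 * (256 * C\<^sup>2 * S * D ^ 3 * ?p) + 2 * ?m * (mag a * \<eta> * (D\<^sup>2 * ?p))"
    using 1 by (intro add_right_mono mult_left_mono) auto
  also have "\<dots> = mag a * ?p * (128 * C\<^sup>2 * S * D ^ 3 + 2 * ?m * \<eta> * D\<^sup>2)"
    by (simp add: algebra_simps)
  finally show ?thesis .
qed

text \<open>Among the terms without forcing only the resonant part lacks decay in \<open>k\<close>,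
  and it is proportional to \<open>\<phi> k\<close>. Constants: 48 is 9 / 6 * 2 * 4 ^ 2; the
  auxiliary 31 rounds up 34 * 4 ^ 2 / 18, which gives 62 = 31 * 2 and, rounded up, 4000 for 31 *
  128; 6 rounds up 2 / 3 * 8.\<close>

lemma remainder_diff:
  assumes k: "k \<in> A" and \<eta>: "\<eta> \<ge> 0"
    and g: "\<And>j. j \<in> A \<Longrightarrow> g j = \<i> / 2 * of_int j * quad A x t j + E j"
    and h: "\<And>j. j \<in> A \<Longrightarrow> h j = \<i> / 2 * of_int j * quad A y t j + F j"
    and E: "\<And>j. j \<in> A \<Longrightarrow> cmod (E j) \<le> mag j * \<eta>"
    and F: "\<And>j. j \<in> A \<Longrightarrow> cmod (F j) \<le> mag j * \<eta>"
  shows "m k * cmod (remainder A x g E t k - remainder A y h F t k) \<le>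
     4000 * C\<^sup>2 * D ^ 3 * S / mag k + 48 * C\<^sup>2 * D\<^sup>2 * S * \<phi> k + m k * (2 * mag k + 6 * D + 62 * D\<^sup>2) * \<eta>"
proof -
  let ?K = "mag k"
  define \<Gamma> where "\<Gamma> = 128 * C\<^sup>2 * S * D ^ 3 + 2 * m k * \<eta> * D\<^sup>2"
  have k0: "k \<noteq> 0" using nz k by blast
  then have K1: "?K \<ge> 1" by linarith
  have \<Gamma>0: "\<Gamma> \<ge> 0" unfolding \<Gamma>_def using C S D \<eta> m(1)[of k] by auto
  define e1 where "e1 = E k - F k"
  define e2 where "e2 = (\<Sum>a\<in>pairs A k. 1 / (3 * of_int a * of_int (k - a)) * (osc (k * a * (k - a)) t * (x a * E (k - a) - y a * F (k - a))))"
  define e3 where "e3 = (\<Sum>(a,c,d)\<in>res_triples A k. \<i> / (6 * of_int a) * (x a * (x c * x d) - y a * (y c * y d)))"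
  define e4 where "e4 = (\<Sum>(a,c,d)\<in>triples A k. tcoef (a,c,d) * (tosc (a,c,d) t * 
     ((g a * (x c * x d) - h a * (y c * y d)) + (g c * (x a * x d) - h c * (y a * y d)) + (g d * (x a * x c) - h d * (y a * y c)))))"
  have split: "remainder A x g E t k - remainder A y h F t k = e1 - e2 - e3 + e4"
  proof -
    have "e2 = (\<Sum>a\<in>pairs A k. 1 / (3 * of_int a * of_int (k - a)) * (osc (k * a * (k - a)) t * (x a * E (k - a))))
      - (\<Sum>a\<in>pairs A k. 1 / (3 * of_int a * of_int (k - a)) * (osc (k * a * (k - a)) t * (y a * F (k - a))))"
      unfolding e2_def sum_subtractf[symmetric] by (simp only: right_diff_distrib)
    moreover have "e3 = (\<Sum>(a,c,d)\<in>res_triples A k. \<i> / (6 * of_int a) * (x a * (x c * x d)))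
       - (\<Sum>(a,c,d)\<in>res_triples A k. \<i> / (6 * of_int a) * (y a * (y c * y d)))"
      unfolding e3_def sum_subtractf[symmetric] by (simp only: right_diff_distrib split_def)
    moreover have "e4 = (\<Sum>(a,c,d)\<in>triples A k. tcoef (a,c,d) * (tosc (a,c,d) t * (g a * (x c * x d) + x a * (g c * x d + x c * g d))))
       - (\<Sum>(a,c,d)\<in>triples A k. tcoef (a,c,d) * (tosc (a,c,d) t * (h a * (y c * y d) + y a * (h c * y d + y c * h d))))"
      unfolding e4_def sum_subtractf[symmetric] by (rule sum.cong) (auto simp: algebra_simps)
    ultimately show ?thesis unfolding remainder_def e1_def by simp
  qed
  have b1: "m k * cmod e1 \<le> m k * (2 * ?K * \<eta>)"
  proof (intro mult_left_mono m)
    show "cmod e1 \<le> 2 * ?K * \<eta>"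
      unfolding e1_def using norm_triangle_ineq4[of "E k" "F k"] E[OF k] F[OF k] by linarith
  qed
  have b2: "m k * cmod e2 \<le> m k * (6 * D * \<eta>)"
  proof (intro mult_left_mono m)
    have "cmod e2 \<le> (\<Sum>a\<in>pairs A k. cmod (1 / (3 * of_int a * of_int (k - a)) * (osc (k * a * (k - a)) t * (x a * E (k - a) - y a * F (k - a)))))"
      unfolding e2_def by (rule norm_sum)
    also have "\<dots> \<le> (\<Sum>a\<in>pairs A k. 2 / 3 * D * \<eta> * (\<phi> a / mag a))"
    proof (rule sum_mono)
      fix a assume "a \<in> pairs A k"
      then have a: "a \<noteq> 0" "k - a \<noteq> 0" "k - a \<in> A" using nz unfolding pairs_def by blast+
      have "cmod (x a) \<le> D * \<phi> a" "cmod (y a) \<le> D * \<phi> a"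
        using dom[OF a(1)] unfolding dom_def by blast+
      then have "cmod (x a) * cmod (E (k - a)) \<le> D * \<phi> a * (mag (k - a) * \<eta>)"
        "cmod (y a) * cmod (F (k - a)) \<le> D * \<phi> a * (mag (k - a) * \<eta>)"
        using E[OF a(3)] F[OF a(3)] D \<phi>(2) by (auto intro!: mult_mono simp del: of_int_diff)
      then have "cmod (x a * E (k - a) - y a * F (k - a)) \<le> 2 * (D * \<phi> a * (mag (k - a) * \<eta>))"
        using norm_triangle_ineq4[of "x a * E (k - a)" "y a * F (k - a)"] unfolding norm_mult by linarith
      then have "1 / (3 * mag a * mag (k - a)) * cmod (x a * E (k - a) - y a * F (k - a))
          \<le> 1 / (3 * mag a * mag (k - a)) * (2 * (D * \<phi> a * (mag (k - a) * \<eta>)))"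
        by (intro mult_left_mono) auto
      \<comment> \<open>The growth \<open>mag (k - a)\<close> permitted to the forcing cancels the
        denominator, and a sum that converges remains.\<close>
      also have "\<dots> = 2 / 3 * D * \<eta> * (\<phi> a / mag a)"
      proof -
        have "mag (k - a) > 0" using a(2) by linarith
        then show ?thesis by (simp add: field_simps del: of_int_diff)
      qed
      finally show "cmod (1 / (3 * of_int a * of_int (k - a)) * (osc (k * a * (k - a)) t * (x a * E (k - a) - y a * F (k - a))))
        \<le> 2 / 3 * D * \<eta> * (\<phi> a / mag a)"
        by (simp add: norm_mult norm_divide norm_osc del: of_int_diff)
    qed
    also have "\<dots> \<le> 2 / 3 * D * \<eta> * (\<Sum>a\<in>A. \<phi> a / mag a)"
      unfolding sum_distrib_left[symmetric] using A(1) D \<eta> \<phi>(2)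
      by (intro mult_left_mono sum_mono2) (auto simp: pairs_def)
    also have "\<dots> \<le> 2 / 3 * D * \<eta> * (2 * 4)"
      using inner3 D \<eta> by (intro mult_left_mono) auto
    also have "\<dots> \<le> 6 * D * \<eta>" using D \<eta> by simp
    finally show "cmod e2 \<le> 6 * D * \<eta>" .
  qed
  have b3: "m k * cmod e3 \<le> 48 * C\<^sup>2 * D\<^sup>2 * S * \<phi> k"
  proof -
    have "m k * cmod e3 \<le> (\<Sum>z\<in>res_triples A k. m k * cmod (case z of (a,c,d) \<Rightarrow> \<i> / (6 * of_int a) * (x a * (x c * x d) - y a * (y c * y d))))"
      unfolding e3_def sum_distrib_left[symmetric] by (intro mult_left_mono norm_sum m)
    also have "\<dots> \<le> (\<Sum>(a,c,d)\<in>res_triples A k. 3 / 2 * C\<^sup>2 * S * D\<^sup>2 * (\<phi> a * (\<phi> c * \<phi> d) / mag a))"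
    proof (rule sum_mono, clarify)
      fix a c d assume t: "(a,c,d) \<in> res_triples A k"
      then have "a \<noteq> 0" "c \<noteq> 0" "d \<noteq> 0" and ks: "a + (c + d) = k" using nz unfolding res_triples_def by auto
      have "m k * cmod (\<i> / (6 * of_int a) * (x a * (x c * x d) - y a * (y c * y d))) 
         = 1 / (6 * mag a) * (m k * cmod (x a * (x c * x d) - y a * (y c * y d)))"
        by (simp add: norm_mult norm_divide)
      also have "\<dots> \<le> 1 / (6 * mag a) * (9 * C\<^sup>2 * S * D\<^sup>2 * (\<phi> a * (\<phi> c * \<phi> d)))"
        using dom3[OF \<open>a \<noteq> 0\<close> \<open>c \<noteq> 0\<close> \<open>d \<noteq> 0\<close>] unfolding ks by (intro mult_left_mono) auto
      also have "\<dots> = 3 / 2 * C\<^sup>2 * S * D\<^sup>2 * (\<phi> a * (\<phi> c * \<phi> d) / mag a)" by simp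
      finally show "m k * cmod (\<i> / (6 * of_int a) * (x a * (x c * x d) - y a * (y c * y d)))
          \<le> 3 / 2 * C\<^sup>2 * S * D\<^sup>2 * (\<phi> a * (\<phi> c * \<phi> d) / mag a)" .
    qed
    also have "\<dots> = 3 / 2 * C\<^sup>2 * S * D\<^sup>2 * (\<Sum>(a,c,d)\<in>res_triples A k. \<phi> a * (\<phi> c * \<phi> d) / mag a)"
      by (simp add: sum_distrib_left split_def)
    also have "\<dots> \<le> 3 / 2 * C\<^sup>2 * S * D\<^sup>2 * (2 * 4\<^sup>2 * \<phi> k)"
      using res_sum[of k] S by (intro mult_left_mono) auto
    finally show ?thesis by (simp add: mult_ac)
  qed
  have b4: "m k * cmod e4 \<le> 31 * \<Gamma> / ?K"
  proof -
    have "m k * cmod e4 \<le> (\<Sum>z\<in>triples A k. m k * cmod (case z of (a,c,d) \<Rightarrow> tcoef (a,c,d) * (tosc (a,c,d) t * 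
     ((g a * (x c * x d) - h a * (y c * y d)) + (g c * (x a * x d) - h c * (y a * y d)) + (g d * (x a * x c) - h d * (y a * y c))))))"
      unfolding e4_def sum_distrib_left[symmetric] by (intro mult_left_mono norm_sum m)
    also have "\<dots> \<le> (\<Sum>(a,c,d)\<in>triples A k. \<Gamma> / 18 * ((mag a * (\<phi> c * \<phi> d) + mag c * (\<phi> a * \<phi> d) + mag d * (\<phi> a * \<phi> c))
     / mag a * tker a c d))"
    proof (rule sum_mono, clarify)
      fix a c d assume t: "(a,c,d) \<in> triples A k"
      then have "a \<in> A" "c \<in> A" "d \<in> A" and ks: "a + (c + d) = k" "c + (a + d) = k" "d + (a + c) = k"
        unfolding triples_def by auto
      note n = nz[OF \<open>a \<in> A\<close>] nz[OF \<open>c \<in> A\<close>] nz[OF \<open>d \<in> A\<close>]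
      define u1 where "u1 = g a * (x c * x d) - h a * (y c * y d)"
      define u2 where "u2 = g c * (x a * x d) - h c * (y a * y d)"
      define u3 where "u3 = g d * (x a * x c) - h d * (y a * y c)"
      have "m k * cmod u1 \<le> mag a * (\<phi> c * \<phi> d) * \<Gamma>" "m k * cmod u2 \<le> mag c * (\<phi> a * \<phi> d) * \<Gamma>"
         "m k * cmod u3 \<le> mag d * (\<phi> a * \<phi> c) * \<Gamma>"
        unfolding u1_def u2_def u3_def \<Gamma>_def
        using deriv_term_diff[OF \<open>a \<in> A\<close> n(2,3) g[OF \<open>a \<in> A\<close>] h[OF \<open>a \<in> A\<close>] E[OF \<open>a \<in> A\<close>] F[OF \<open>a \<in> A\<close>]]
         deriv_term_diff[OF \<open>c \<in> A\<close> n(1,3) g[OF \<open>c \<in> A\<close>] h[OF \<open>c \<in> A\<close>] E[OF \<open>c \<in> A\<close>] F[OF \<open>c \<in> A\<close>]]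
         deriv_term_diff[OF \<open>d \<in> A\<close> n(1,2) g[OF \<open>d \<in> A\<close>] h[OF \<open>d \<in> A\<close>] E[OF \<open>d \<in> A\<close>] F[OF \<open>d \<in> A\<close>]]
        unfolding ks by blast+
      moreover have "m k * cmod (u1 + u2 + u3) \<le> m k * cmod u1 + m k * cmod u2 + m k * cmod u3"
        unfolding distrib_left[symmetric] using norm_triangle_ineq[of "u1 + u2" u3] norm_triangle_ineq[of u1 u2]
        by (intro mult_left_mono m) linarith
      ultimately have "m k * cmod (u1 + u2 + u3) \<le> (mag a * (\<phi> c * \<phi> d) + mag c * (\<phi> a * \<phi> d) + mag d * (\<phi> a * \<phi> c)) * \<Gamma>"
        unfolding distrib_right by linarith
      then have "1 / 18 * (1 / mag a * tker a c d) * (m k * cmod (u1 + u2 + u3)) \<le> 1 / 18 * (1 / mag a * tker a c d) * 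
         ((mag a * (\<phi> c * \<phi> d) + mag c * (\<phi> a * \<phi> d) + mag d * (\<phi> a * \<phi> c)) * \<Gamma>)"
        by (intro mult_left_mono) (simp_all add: tker_nonneg)
      moreover have "m k * cmod (tcoef (a,c,d) * (tosc (a,c,d) t * (u1 + u2 + u3))) = 1 / 18 * (1 / mag a * tker a c d) * (m k * cmod (u1 + u2 + u3))"
        by (simp only: norm_mult norm_tcoef norm_tosc) simp
      ultimately show "m k * cmod (tcoef (a,c,d) * (tosc (a,c,d) t * 
     ((g a * (x c * x d) - h a * (y c * y d)) + (g c * (x a * x d) - h c * (y a * y d)) + (g d * (x a * x c) - h d * (y a * y c)))))
     \<le> \<Gamma> / 18 * ((mag a * (\<phi> c * \<phi> d) + mag c * (\<phi> a * \<phi> d) + mag d * (\<phi> a * \<phi> c))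
     / mag a * tker a c d)"
        unfolding u1_def[symmetric] u2_def[symmetric] u3_def[symmetric] by (simp only: mult_ac times_divide_eq_right times_divide_eq_left mult_1_left mult_1_right)
    qed
    also have "\<dots> = \<Gamma> / 18 * (\<Sum>(a,c,d)\<in>triples A k. (mag a * (\<phi> c * \<phi> d) + mag c * (\<phi> a * \<phi> d) + mag d * (\<phi> a * \<phi> c))
     / mag a * tker a c d)"
      by (simp add: sum_distrib_left split_def)
    also have "\<dots> \<le> \<Gamma> / 18 * (34 * 4\<^sup>2 / ?K)"
      using tker_sum_deriv[OF k0] \<Gamma>0 by (intro mult_left_mono) auto
    also have "\<dots> \<le> 31 * \<Gamma> / ?K"
      using \<Gamma>0 K1 by (simp add: divide_simps)
    finally show ?thesis .
  qed
  have "cmod (e1 - e2 - e3 + e4) \<le> cmod e1 + cmod e2 + cmod e3 + cmod e4"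
    using norm_triangle_ineq[of "e1 - e2 - e3" e4] norm_triangle_ineq4[of "e1 - e2" e3] norm_triangle_ineq4[of e1 e2] by linarith
  then have "m k * cmod (e1 - e2 - e3 + e4) \<le> m k * (cmod e1 + cmod e2 + cmod e3 + cmod e4)"
    by (intro mult_left_mono m)
  also have "\<dots> \<le> m k * (2 * ?K * \<eta>) + m k * (6 * D * \<eta>) + 48 * C\<^sup>2 * D\<^sup>2 * S * \<phi> k + 31 * \<Gamma> / ?K"
    using b1 b2 b3 b4 unfolding distrib_left by linarith
  also have "31 * \<Gamma> / ?K = 3968 * C\<^sup>2 * D ^ 3 * S / ?K + 62 * m k * \<eta> * D\<^sup>2 / ?K"
    unfolding \<Gamma>_def by (simp add: add_divide_distrib algebra_simps)
  also have "62 * m k * \<eta> * D\<^sup>2 / ?K \<le> 62 * m k * \<eta> * D\<^sup>2 / 1"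
    using K1 \<eta> m(1)[of k] by (intro divide_left_mono) auto
  also have "3968 * C\<^sup>2 * D ^ 3 * S / ?K \<le> 4000 * C\<^sup>2 * D ^ 3 * S / ?K"
    using S D by (intro divide_right_mono mult_right_mono) auto
  finally show ?thesis unfolding split by (simp add: algebra_simps)
qed

end

section \<open>Increments on short time intervals\<close>

definition freq :: "nat \<Rightarrow> int set" where
  "freq n = {k. k \<noteq> 0 \<and> \<bar>k\<bar> \<le> int n}"

lemma finite_freq: "finite (freq n)" and zero_notin_freq: "0 \<notin> freq n"
proof -
  have "freq n \<subseteq> {- int n..int n}" by (auto simp: freq_def)
  then show "finite (freq n)" by (rule finite_subset) simp
  show "0 \<notin> freq n" by (simp add: freq_def)
qed

text \<open>The bound on the forcing mirrors the derivative in the nonlinearity. It depends on time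
  because the tails of a weak solution are made small in the time integral, not uniformly in
  time.\<close>

definition forced_kdv :: "real \<Rightarrow> nat \<Rightarrow> (real \<Rightarrow> real) \<Rightarrow> (real \<Rightarrow> int \<Rightarrow> complex) \<Rightarrow> bool" where
  "forced_kdv T n \<eta> x \<longleftrightarrow> (\<exists>g E. \<forall>j\<in>freq n. prim T (\<lambda>t. x t j) (g j) \<and>
     (\<forall>t\<in>{0..T}. g j t = \<i> / 2 * of_int j * quad (freq n) (x t) t j + E t j \<and> cmod (E t j) \<le> mag j * \<eta> t))"

lemma forced_kdvE:
  assumes "forced_kdv T n \<eta> x"
  obtains g E where "\<And>j. j \<in> freq n \<Longrightarrow> prim T (\<lambda>t. x t j) (g j)"
    "\<And>j t. j \<in> freq n \<Longrightarrow> t \<in> {0..T} \<Longrightarrow> g j t = \<i> / 2 * of_int j * quad (freq n) (x t) t j + E t j"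
    "\<And>j t. j \<in> freq n \<Longrightarrow> t \<in> {0..T} \<Longrightarrow> cmod (E t j) \<le> mag j * \<eta> t"
  using assms unfolding forced_kdv_def by blast

text \<open>Two truncated solutions, forced by an error that can be made arbitrarily small. Weak solutions
  form such a pair with \<open>K\<close> the set of all frequencies, Galerkin solutions with \<open>K = freq n\<close>.\<close>

definition kdv_pair :: "real \<Rightarrow> int set \<Rightarrow> (real \<Rightarrow> int \<Rightarrow> complex) \<Rightarrow> (real \<Rightarrow> int \<Rightarrow> complex) \<Rightarrow> bool" where
  "kdv_pair T K x y \<longleftrightarrow> 0 \<notin> K \<and> (\<forall>t\<in>{0..T}. \<forall>k. k \<noteq> 0 \<and> k \<notin> K \<longrightarrow> x t k = 0 \<and> y t k = 0) \<and>
     (\<forall>k\<in>K. \<forall>\<epsilon>>0. \<exists>n \<eta>. k \<in> freq n \<and> bmeas T \<eta> \<and> (\<forall>t\<in>{0..T}. 0 \<le> \<eta> t) \<and> integral {0..T} \<eta> \<le> \<epsilon> \<and>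
        forced_kdv T n \<eta> x \<and> forced_kdv T n \<eta> y)"

definition weight :: "real \<Rightarrow> (int \<Rightarrow> real) \<Rightarrow> bool" where
  "weight C m \<longleftrightarrow> (\<forall>k. 0 \<le> m k) \<and> (\<forall>a b. m (a + b) \<le> C * (m a + m b))"

lemma integral_upper:
  assumes "bmeas T f" "0 \<le> s" "s \<le> t" "t \<le> T" "\<And>\<tau>. \<tau> \<in> {s..t} \<Longrightarrow> f \<tau> \<le> (B::real)"
  shows "integral {s..t} f \<le> B * (t - s)"
proof -
  have "integral {s..t} f \<le> integral {s..t} (\<lambda>_. B)"
    using assms bmeas_integrable[OF assms(1,2,4)] by (intro integral_le) auto
  then show ?thesis using assms by (simp add: mult.commute)
qed

lemma integral_subinterval_le:
  assumes "bmeas T f" "0 \<le> s" "s \<le> t" "t \<le> T" "\<And>\<tau>. \<tau> \<in> {0..T} \<Longrightarrow> (0::real) \<le> f \<tau>"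
  shows "integral {s..t} f \<le> integral {0..T} f" "0 \<le> integral {s..t} f"
proof -
  have i: "f integrable_on {s..t}" "f integrable_on {0..T}"
    using assms by (auto intro: bmeas_integrable)
  show "integral {s..t} f \<le> integral {0..T} f"
    using assms i by (intro integral_subset_le) auto
  show "0 \<le> integral {s..t} f"
    using assms i by (intro Henstock_Kurzweil_Integration.integral_nonneg) auto
qed

lemma integral_affine:
  fixes f g :: "real \<Rightarrow> real"
  assumes "f integrable_on {s..t}" "g integrable_on {s..t}" "s \<le> t"
  shows "integral {s..t} (\<lambda>\<tau>. a + b * f \<tau> + c * g \<tau>) = a * (t - s) + b * integral {s..t} f + c * integral {s..t} g"
proof (rule integral_unique)
  have "((\<lambda>\<tau>. a) has_integral (t - s) *\<^sub>R a) {s..t}"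
    using has_integral_const_real[of a s t] assms(3) by simp
  then show "((\<lambda>\<tau>. a + b * f \<tau> + c * g \<tau>) has_integral a * (t - s) + b * integral {s..t} f + c * integral {s..t} g) {s..t}"
    using assms(1,2) by (intro has_integral_add has_integral_mult_right integrable_integral) (simp_all add: mult.commute)
qed

text \<open>Minkowski's integral inequality by duality: pairing with the vector \<open>c\<close> of
  integrals itself gives |c|^2 \<le> |c| * B * (t - s).\<close>

lemma l2bd_integral:
  assumes f: "\<And>k. k \<noteq> 0 \<Longrightarrow> bmeas T (\<lambda>\<tau>. f \<tau> k)" and nn: "\<And>\<tau> k. 0 \<le> f \<tau> k"
    and st: "0 \<le> s" "s \<le> t" "t \<le> T" and B: "\<And>\<tau>. \<tau> \<in> {s..t} \<Longrightarrow> l2bd (f \<tau>) B"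
  shows "l2bd (\<lambda>k. integral {s..t} (\<lambda>\<tau>. f \<tau> k)) (B * (t - s))"
  unfolding l2bd_def
proof (intro allI impI, elim conjE)
  fix F :: "int set" assume F: "finite F" "0 \<notin> F"
  define c where "c k = integral {s..t} (\<lambda>\<tau>. f \<tau> k)" for k
  have k0: "k \<noteq> 0" if "k \<in> F" for k using that F by metis
  have int: "(\<lambda>\<tau>. f \<tau> k) integrable_on {s..t}" if "k \<in> F" for k
    using bmeas_integrable[OF f[OF k0[OF that]] st(1,3)] .
  have c0: "c k \<ge> 0" if "k \<in> F" for k
    unfolding c_def using int[OF that] nn by (intro Henstock_Kurzweil_Integration.integral_nonneg) auto
  have bm: "bmeas T (\<lambda>\<tau>. \<Sum>k\<in>F. c k * f \<tau> k)"
    using f k0 by (intro bmeas_sum bmeas_cmult) auto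
  have "(\<Sum>k\<in>F. (c k)\<^sup>2) = (\<Sum>k\<in>F. integral {s..t} (\<lambda>\<tau>. c k * f \<tau> k))"
    by (simp add: power2_eq_square c_def)
  also have "\<dots> = integral {s..t} (\<lambda>\<tau>. \<Sum>k\<in>F. c k * f \<tau> k)"
    using int F by (intro Henstock_Kurzweil_Integration.integral_sum[symmetric] integrable_on_mult_right) auto
  also have "\<dots> \<le> L2_set c F * B * (t - s)"
  proof (rule integral_upper[OF bm st])
    fix \<tau> assume \<tau>: "\<tau> \<in> {s..t}"
    have "(\<Sum>k\<in>F. c k * f \<tau> k) = (\<Sum>k\<in>F. \<bar>c k\<bar> * \<bar>f \<tau> k\<bar>)"
      using c0 nn by (intro sum.cong) auto
    also have "\<dots> \<le> L2_set c F * L2_set (f \<tau>) F" by (rule L2_set_mult_ineq)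
    also have "\<dots> \<le> L2_set c F * B"
      using l2bdD[OF B[OF \<tau>] F] by (intro mult_left_mono) auto
    finally show "(\<Sum>k\<in>F. c k * f \<tau> k) \<le> L2_set c F * B" .
  qed
  finally have "(L2_set c F)\<^sup>2 \<le> L2_set c F * (B * (t - s))"
    by (simp add: L2_set_def sum_nonneg mult.assoc)
  then have "L2_set c F \<le> B * (t - s)"
  proof (cases "L2_set c F = 0")
    case True
    have "0 \<le> B" using B[of s] st by (intro l2bd_nonneg[of "f s"]) auto
    then show ?thesis using True st by simp
  next
    case False
    then have "0 < L2_set c F" using L2_set_nonneg[of c F] by linarith
    then show ?thesis using \<open>(L2_set c F)\<^sup>2 \<le> L2_set c F * (B * (t - s))\<close> by (simp add: power2_eq_square)
  qed
  then show "L2_set (\<lambda>k. integral {s..t} (\<lambda>\<tau>. f \<tau> k)) F \<le> B * (t - s)"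
    by (simp add: c_def[abs_def])
qed

lemma weighted_increment_le:
  assumes p: "prim T F f" and st: "0 \<le> s" "s \<le> t" "t \<le> T" and b: "bmeas T b" and w: "(w::real) \<ge> 0"
    and le: "\<And>\<tau>. \<tau> \<in> {s..t} \<Longrightarrow> w * norm (f \<tau>) \<le> b \<tau>"
  shows "w * norm (F t - F s) \<le> integral {s..t} b"
proof -
  have f: "f integrable_on {s..t}"
    using p st by (intro bmeas_integrable prim_bmeas_deriv)
  have "w * norm (F t - F s) = norm (integral {s..t} (\<lambda>\<tau>. w *\<^sub>R f \<tau>))"
    using w prim_diff[OF p st] by simp
  also have "\<dots> \<le> integral {s..t} b"
    using f le w bmeas_integrable[OF b st(1,3)] by (intro integral_norm_bound_integral integrable_cmul) auto
  finally show ?thesis .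
qed

locale dominated_pair =
  fixes T :: real and n :: nat and \<eta> :: "real \<Rightarrow> real" and x y :: "real \<Rightarrow> int \<Rightarrow> complex"
    and m :: "int \<Rightarrow> real" and C D U L S :: real and \<phi> :: "real \<Rightarrow> int \<Rightarrow> real" and s t :: real
  assumes \<eta>: "bmeas T \<eta>" "\<And>\<tau>. \<tau> \<in> {0..T} \<Longrightarrow> 0 \<le> \<eta> \<tau>"
    and x: "forced_kdv T n \<eta> x" and y: "forced_kdv T n \<eta> y"
    and st: "0 \<le> s" "s \<le> t" "t \<le> T"
    and dominated: "\<And>\<tau>. \<tau> \<in> {s..t} \<Longrightarrow> dominated m C D U L S (\<phi> \<tau>) (x \<tau>) (y \<tau>)"
begin

lemma dominated_at: "\<tau> \<in> {s..t} \<Longrightarrow> dominated_on m C D U L S (\<phi> \<tau>) (x \<tau>) (y \<tau>) (freq n)"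
  unfolding dominated_on_def dominated_on_axioms_def using dominated finite_freq zero_notin_freq by blast

lemma T0: "0 \<le> T" using st by simp

lemma coeff_nonneg: "0 \<le> m k" "0 \<le> C" "0 \<le> D" "0 \<le> S"
  using dominated[of s] st unfolding dominated_def by auto

text \<open>The boundary terms occur at both ends of the time interval, whence 44 = 2 * 22 and 512 =
  2 * 256. They carry no factor \<open>t - s\<close>: shortening the interval does not help, only
  the decay in \<open>k\<close> does.\<close>

lemma high_increment:
  assumes k: "k \<in> freq n" and \<phi>: "bmeas T (\<lambda>\<tau>. \<phi> \<tau> k)"
  shows "m k * cmod ((x t k - y t k) - (x s k - y s k)) \<le>
     (44 * C * D + 512 * C\<^sup>2 * D\<^sup>2 + 4000 * C\<^sup>2 * D ^ 3 * (t - s)) * S / mag k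
     + 48 * C\<^sup>2 * D\<^sup>2 * S * integral {s..t} (\<lambda>\<tau>. \<phi> \<tau> k) + m k * (2 * mag k + 6 * D + 62 * D\<^sup>2) * integral {0..T} \<eta>"
proof -
  let ?A = "freq n" and ?K = "mag k"
  have k0: "k \<noteq> 0" using k by (auto simp: freq_def)
  obtain g E where g: "\<And>j. j \<in> ?A \<Longrightarrow> prim T (\<lambda>t. x t j) (g j)"
    "\<And>j t. j \<in> ?A \<Longrightarrow> t \<in> {0..T} \<Longrightarrow> g j t = \<i> / 2 * of_int j * quad ?A (x t) t j + E t j"
    "\<And>j t. j \<in> ?A \<Longrightarrow> t \<in> {0..T} \<Longrightarrow> cmod (E t j) \<le> mag j * \<eta> t"
    using forced_kdvE[OF x] by blast
  obtain h F where h: "\<And>j. j \<in> ?A \<Longrightarrow> prim T (\<lambda>t. y t j) (h j)"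
    "\<And>j t. j \<in> ?A \<Longrightarrow> t \<in> {0..T} \<Longrightarrow> h j t = \<i> / 2 * of_int j * quad ?A (y t) t j + F t j"
    "\<And>j t. j \<in> ?A \<Longrightarrow> t \<in> {0..T} \<Longrightarrow> cmod (F t j) \<le> mag j * \<eta> t"
    using forced_kdvE[OF y] by blast
  define Bx where "Bx \<tau> = bdry2 ?A (x \<tau>) \<tau> k + bdry3 ?A (x \<tau>) \<tau> k" for \<tau>
  define By where "By \<tau> = bdry2 ?A (y \<tau>) \<tau> k + bdry3 ?A (y \<tau>) \<tau> k" for \<tau>
  define R where "R \<tau> = remainder ?A (x \<tau>) (\<lambda>j. g j \<tau>) (E \<tau>) \<tau> k - remainder ?A (y \<tau>) (\<lambda>j. h j \<tau>) (F \<tau>) \<tau> k" for \<tau>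
  let ?Z = "\<lambda>\<tau>. (x \<tau> k - Bx \<tau>) - (y \<tau> k - By \<tau>)"
  have p: "prim T ?Z R"
    unfolding Bx_def By_def R_def
    by (rule prim_minus[OF prim_normal_form[OF T0 finite_freq zero_notin_freq k g(1,2)] prim_normal_form[OF T0 finite_freq zero_notin_freq k h(1,2)]])
  define b where "b \<tau> = 4000 * C\<^sup>2 * D ^ 3 * S / ?K + 48 * C\<^sup>2 * D\<^sup>2 * S * \<phi> \<tau> k + m k * (2 * ?K + 6 * D + 62 * D\<^sup>2) * \<eta> \<tau>" for \<tau>
  have b: "bmeas T b"
    unfolding b_def by (intro bmeas_add bmeas_cmult bmeas_const \<phi> \<eta>(1))
  have "m k * cmod (?Z t - ?Z s) \<le> integral {s..t} b"
  proof (rule weighted_increment_le[OF p st b coeff_nonneg(1)])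
    fix \<tau> assume \<tau>: "\<tau> \<in> {s..t}"
    then have \<tau>T: "\<tau> \<in> {0..T}" using st by auto
    interpret dominated_on m C D U L S "\<phi> \<tau>" "x \<tau>" "y \<tau>" "freq n" using dominated_at[OF \<tau>] .
    show "m k * cmod (R \<tau>) \<le> b \<tau>"
      unfolding R_def b_def using \<tau>T by (intro remainder_diff k \<eta> g h)
  qed
  also have "integral {s..t} b = 4000 * C\<^sup>2 * D ^ 3 * S / ?K * (t - s) + 48 * C\<^sup>2 * D\<^sup>2 * S * integral {s..t} (\<lambda>\<tau>. \<phi> \<tau> k)
      + m k * (2 * ?K + 6 * D + 62 * D\<^sup>2) * integral {s..t} \<eta>"
  proof -
    have "(\<lambda>\<tau>. \<phi> \<tau> k) integrable_on {s..t}" "\<eta> integrable_on {s..t}"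
      using bmeas_integrable[OF \<phi> st(1,3)] bmeas_integrable[OF \<eta>(1) st(1,3)] by auto
    then show ?thesis
      unfolding b_def using st by (intro integral_affine)
  qed
  also have "\<dots> \<le> 4000 * C\<^sup>2 * D ^ 3 * S / ?K * (t - s) + 48 * C\<^sup>2 * D\<^sup>2 * S * integral {s..t} (\<lambda>\<tau>. \<phi> \<tau> k)
      + m k * (2 * ?K + 6 * D + 62 * D\<^sup>2) * integral {0..T} \<eta>"
    using integral_subinterval_le(1)[OF \<eta>(1) st \<eta>(2)] coeff_nonneg by (intro add_left_mono mult_left_mono) auto
  finally have 1: "m k * cmod (?Z t - ?Z s) \<le> \<dots>" .
  have B: "m k * cmod (Bx \<tau> - By \<tau>) \<le> 22 * C * D * S / ?K + 256 * C\<^sup>2 * D\<^sup>2 * S / ?K" if \<tau>: "\<tau> \<in> {s..t}" for \<tau>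
  proof -
    interpret dominated_on m C D U L S "\<phi> \<tau>" "x \<tau>" "y \<tau>" "freq n" using dominated_at[OF \<tau>] .
    have "cmod (Bx \<tau> - By \<tau>) \<le> cmod (bdry2 ?A (x \<tau>) \<tau> k - bdry2 ?A (y \<tau>) \<tau> k) + cmod (bdry3 ?A (x \<tau>) \<tau> k - bdry3 ?A (y \<tau>) \<tau> k)"
      unfolding Bx_def By_def add_diff_add by (rule norm_triangle_ineq)
    then have "m k * cmod (Bx \<tau> - By \<tau>) \<le> m k * (cmod (bdry2 ?A (x \<tau>) \<tau> k - bdry2 ?A (y \<tau>) \<tau> k) + cmod (bdry3 ?A (x \<tau>) \<tau> k - bdry3 ?A (y \<tau>) \<tau> k))"
      using coeff_nonneg(1) by (rule mult_left_mono)
    then show ?thesis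
      using bdry2_diff[OF k0] bdry3_diff[OF k0] unfolding distrib_left by (meson add_mono order_trans)
  qed
  have eq: "(x t k - y t k) - (x s k - y s k) = (?Z t - ?Z s) + ((Bx t - By t) - (Bx s - By s))"
    by simp
  have tri: "cmod (p + (q - r)) \<le> cmod p + (cmod q + cmod r)" for p q r
    using norm_triangle_ineq[of p "q - r"] norm_triangle_ineq4[of q r] by linarith
  have "cmod ((x t k - y t k) - (x s k - y s k)) \<le> cmod (?Z t - ?Z s) + (cmod (Bx t - By t) + cmod (Bx s - By s))"
    by (subst eq) (rule tri)
  then have "m k * cmod ((x t k - y t k) - (x s k - y s k)) \<le> m k * (cmod (?Z t - ?Z s) + (cmod (Bx t - By t) + cmod (Bx s - By s)))"
    using coeff_nonneg(1) by (rule mult_left_mono)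
  moreover have "m k * cmod (Bx s - By s) \<le> 22 * C * D * S / ?K + 256 * C\<^sup>2 * D\<^sup>2 * S / ?K"
    "m k * cmod (Bx t - By t) \<le> 22 * C * D * S / ?K + 256 * C\<^sup>2 * D\<^sup>2 * S / ?K"
    using st by (auto intro!: B)
  ultimately have "m k * cmod ((x t k - y t k) - (x s k - y s k)) \<le> m k * cmod (?Z t - ?Z s) + 2 * (22 * C * D * S / ?K + 256 * C\<^sup>2 * D\<^sup>2 * S / ?K)"
  proof -
    have "a \<le> p + 2 * z" if "a \<le> w * (p' + (q + r))" "w * r \<le> z" "w * q \<le> z" "p = w * p'" for a p p' q r w z :: real
      using that by (simp add: distrib_left)
    then show "?thesis" if "m k * cmod ((x t k - y t k) - (x s k - y s k)) \<le> m k * (cmod (?Z t - ?Z s) + (cmod (Bx t - By t) + cmod (Bx s - By s)))"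
     "m k * cmod (Bx s - By s) \<le> 22 * C * D * S / ?K + 256 * C\<^sup>2 * D\<^sup>2 * S / ?K"
    "m k * cmod (Bx t - By t) \<le> 22 * C * D * S / ?K + 256 * C\<^sup>2 * D\<^sup>2 * S / ?K"
      using that by blast
  qed
  moreover have "(44 * C * D + 512 * C\<^sup>2 * D\<^sup>2 + 4000 * C\<^sup>2 * D ^ 3 * (t - s)) * S / ?K
     = 2 * (22 * C * D * S / ?K + 256 * C\<^sup>2 * D\<^sup>2 * S / ?K) + 4000 * C\<^sup>2 * D ^ 3 * S / ?K * (t - s)"
    by (simp add: add_divide_distrib diff_divide_distrib algebra_simps)
  ultimately show ?thesis using 1 by linarith
qed

text \<open>The equation itself, without integration by parts: there is a loss \<open>mag k\<close>,
  but apart from the forcing everything carries the factor \<open>t - s\<close>. The 32 is half of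
  the 64 in \<open>dom_quad\<close>.\<close>

lemma low_increment:
  assumes k: "k \<in> freq n"
  shows "m k * cmod ((x t k - y t k) - (x s k - y s k)) \<le>
     32 * C * D * S * mag k * (t - s) + m k * (2 * mag k) * integral {0..T} \<eta>"
proof -
  let ?A = "freq n" and ?K = "mag k"
  obtain g E where g: "prim T (\<lambda>t. x t k) g"
    "\<And>t. t \<in> {0..T} \<Longrightarrow> g t = \<i> / 2 * of_int k * quad ?A (x t) t k + E t"
    "\<And>t. t \<in> {0..T} \<Longrightarrow> cmod (E t) \<le> ?K * \<eta> t"
  proof -
    obtain g E where "\<And>j. j \<in> ?A \<Longrightarrow> prim T (\<lambda>t. x t j) (g j)"
      "\<And>j t. j \<in> ?A \<Longrightarrow> t \<in> {0..T} \<Longrightarrow> g j t = \<i> / 2 * of_int j * quad ?A (x t) t j + E t j"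
      "\<And>j t. j \<in> ?A \<Longrightarrow> t \<in> {0..T} \<Longrightarrow> cmod (E t j) \<le> mag j * \<eta> t"
      using forced_kdvE[OF x] by blast
    then show ?thesis using that[of "g k" "\<lambda>t. E t k"] k by blast
  qed
  obtain h F where h: "prim T (\<lambda>t. y t k) h"
    "\<And>t. t \<in> {0..T} \<Longrightarrow> h t = \<i> / 2 * of_int k * quad ?A (y t) t k + F t"
    "\<And>t. t \<in> {0..T} \<Longrightarrow> cmod (F t) \<le> ?K * \<eta> t"
  proof -
    obtain g E where "\<And>j. j \<in> ?A \<Longrightarrow> prim T (\<lambda>t. y t j) (g j)"
      "\<And>j t. j \<in> ?A \<Longrightarrow> t \<in> {0..T} \<Longrightarrow> g j t = \<i> / 2 * of_int j * quad ?A (y t) t j + E t j"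
      "\<And>j t. j \<in> ?A \<Longrightarrow> t \<in> {0..T} \<Longrightarrow> cmod (E t j) \<le> mag j * \<eta> t"
      using forced_kdvE[OF y] by blast
    then show ?thesis using that[of "g k" "\<lambda>t. E t k"] k by blast
  qed
  define b where "b \<tau> = 32 * C * D * S * ?K + m k * (2 * ?K) * \<eta> \<tau>" for \<tau>
  have b: "bmeas T b"
    unfolding b_def by (intro bmeas_add bmeas_cmult bmeas_const \<eta>(1))
  have "m k * cmod ((x t k - y t k) - (x s k - y s k)) \<le> integral {s..t} b"
  proof (rule weighted_increment_le[OF prim_minus[OF g(1) h(1)] st b coeff_nonneg(1)])
    fix \<tau> assume \<tau>: "\<tau> \<in> {s..t}"
    then have \<tau>T: "\<tau> \<in> {0..T}" using st by auto
    interpret dominated_on m C D U L S "\<phi> \<tau>" "x \<tau>" "y \<tau>" "freq n" using dominated_at[OF \<tau>] .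
    have "g \<tau> - h \<tau> = \<i> / 2 * of_int k * (quad ?A (x \<tau>) \<tau> k - quad ?A (y \<tau>) \<tau> k) + (E \<tau> - F \<tau>)"
      unfolding g(2)[OF \<tau>T] h(2)[OF \<tau>T] by (simp add: algebra_simps)
    then have "cmod (g \<tau> - h \<tau>) \<le> ?K / 2 * cmod (quad ?A (x \<tau>) \<tau> k - quad ?A (y \<tau>) \<tau> k) + cmod (E \<tau> - F \<tau>)"
      by (auto simp: norm_mult norm_divide intro!: order_trans[OF norm_triangle_ineq])
    also have "cmod (E \<tau> - F \<tau>) \<le> 2 * ?K * \<eta> \<tau>"
      using g(3)[OF \<tau>T] h(3)[OF \<tau>T] norm_triangle_ineq4[of "E \<tau>" "F \<tau>"] by linarith
    finally have "m k * cmod (g \<tau> - h \<tau>) \<le> m k * (?K / 2 * cmod (quad ?A (x \<tau>) \<tau> k - quad ?A (y \<tau>) \<tau> k) + 2 * ?K * \<eta> \<tau>)"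
      using coeff_nonneg(1) by (simp add: mult_left_mono)
    also have "\<dots> = ?K / 2 * (m k * cmod (quad ?A (x \<tau>) \<tau> k - quad ?A (y \<tau>) \<tau> k)) + m k * (2 * ?K) * \<eta> \<tau>"
      by (simp add: algebra_simps)
    also have "\<dots> \<le> ?K / 2 * (64 * C * S * D) + m k * (2 * ?K) * \<eta> \<tau>"
      by (intro add_right_mono mult_left_mono dom_weight[OF dom_quad]) auto
    finally show "m k * cmod (g \<tau> - h \<tau>) \<le> b \<tau>" unfolding b_def by (simp add: algebra_simps)
  qed
  also have "integral {s..t} b = 32 * C * D * S * ?K * (t - s) + m k * (2 * ?K) * integral {s..t} \<eta>"
    unfolding b_def using st bmeas_integrable[OF \<eta>(1) st(1,3)]
      integral_affine[of \<eta> s t \<eta> "32 * C * D * S * ?K" 0 "m k * (2 * ?K)"] by simp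
  also have "\<dots> \<le> 32 * C * D * S * ?K * (t - s) + m k * (2 * ?K) * integral {0..T} \<eta>"
    using integral_subinterval_le(1)[OF \<eta>(1) st \<eta>(2)] coeff_nonneg by (intro add_left_mono mult_left_mono) auto
  finally show ?thesis .
qed

end

section \<open>Estimates on one time step\<close>

text \<open>The function \<open>\<phi>\<close> feeding the multilinear estimates is the sum of the four sequences that are
  under control, each normalised by its bound.\<close>

locale step_data =
  fixes T :: real and K :: "int set" and x y :: "real \<Rightarrow> int \<Rightarrow> complex"
    and m :: "int \<Rightarrow> real" and C D U L S :: real and s e :: real
  assumes pair: "kdv_pair T K x y" and m: "weight C m" and C: "C \<ge> 1"
    and pos: "D > 0" "U > 0" "L > 0" "S > 0" and UL: "L * U \<le> S * D"
    and se: "0 \<le> s" "s \<le> e" "e \<le> T"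
    and bounds: "\<And>\<tau>. \<tau> \<in> {s..e} \<Longrightarrow> l2bd (\<lambda>k. cmod (x \<tau> k) + cmod (y \<tau> k)) D"
      "\<And>\<tau>. \<tau> \<in> {s..e} \<Longrightarrow> l2bd (\<lambda>k. m k * (cmod (x \<tau> k) + cmod (y \<tau> k))) U"
      "\<And>\<tau>. \<tau> \<in> {s..e} \<Longrightarrow> l2bd (\<lambda>k. cmod (x \<tau> k - y \<tau> k)) L"
      "\<And>\<tau>. \<tau> \<in> {s..e} \<Longrightarrow> l2bd (\<lambda>k. m k * cmod (x \<tau> k - y \<tau> k)) S"
begin

lemma m_nonneg: "m k \<ge> 0" using m unfolding weight_def by blast

definition \<phi> :: "real \<Rightarrow> int \<Rightarrow> real" where
  "\<phi> \<tau> k = 1 / D * (cmod (x \<tau> k) + cmod (y \<tau> k)) + 1 / U * (m k * (cmod (x \<tau> k) + cmod (y \<tau> k)))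
     + 1 / L * cmod (x \<tau> k - y \<tau> k) + 1 / S * (m k * cmod (x \<tau> k - y \<tau> k))"

lemma \<phi>_nonneg: "\<phi> \<tau> k \<ge> 0"
  unfolding \<phi>_def using pos m_nonneg by simp

lemma \<phi>_l2bd: assumes "\<tau> \<in> {s..e}" shows "l2bd (\<phi> \<tau>) 4"
proof -
  have "l2bd (\<phi> \<tau>) (1 / D * D + 1 / U * U + 1 / L * L + 1 / S * S)"
    unfolding \<phi>_def using pos bounds assms by (intro l2bd_add l2bd_cmult) auto
  then show ?thesis using pos by simp
qed

lemma is_dominated: assumes \<tau>: "\<tau> \<in> {s..e}" shows "dominated m C D U L S (\<phi> \<tau>) (x \<tau>) (y \<tau>)"
proof
  fix k :: int assume "k \<noteq> 0"
  define p1 where "p1 = cmod (x \<tau> k) + cmod (y \<tau> k)"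
  define p2 where "p2 = m k * (cmod (x \<tau> k) + cmod (y \<tau> k))"
  define p3 where "p3 = cmod (x \<tau> k - y \<tau> k)"
  define p4 where "p4 = m k * cmod (x \<tau> k - y \<tau> k)"
  have nn: "p1 \<ge> 0" "p2 \<ge> 0" "p3 \<ge> 0" "p4 \<ge> 0"
    unfolding p1_def p2_def p3_def p4_def using m_nonneg by simp_all
  have f: "\<phi> \<tau> k = p1 / D + p2 / U + p3 / L + p4 / S"
    unfolding \<phi>_def p1_def p2_def p3_def p4_def by simp
  have d: "p1 / D \<ge> 0" "p2 / U \<ge> 0" "p3 / L \<ge> 0" "p4 / S \<ge> 0" using nn pos by simp_all
  have "p1 \<le> D * \<phi> \<tau> k" "p2 \<le> U * \<phi> \<tau> k" "p3 \<le> L * \<phi> \<tau> k" "p4 \<le> S * \<phi> \<tau> k"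
    using mult_left_mono[of "p1 / D" "\<phi> \<tau> k" D] mult_left_mono[of "p2 / U" "\<phi> \<tau> k" U]
     mult_left_mono[of "p3 / L" "\<phi> \<tau> k" L] mult_left_mono[of "p4 / S" "\<phi> \<tau> k" S] pos d unfolding f by auto
  moreover have "cmod (x \<tau> k) \<le> p1" "cmod (y \<tau> k) \<le> p1" "m k * cmod (x \<tau> k) \<le> p2" "m k * cmod (y \<tau> k) \<le> p2"
    unfolding p1_def p2_def using m_nonneg by (auto intro: mult_left_mono)
  ultimately show "dom (m k) (D * \<phi> \<tau> k) (U * \<phi> \<tau> k) (L * \<phi> \<tau> k) (S * \<phi> \<tau> k) (x \<tau> k) (y \<tau> k)"
    unfolding dom_def p3_def p4_def by linarith
next
  show "\<And>a b. m (a + b) \<le> C * (m a + m b)" using m unfolding weight_def by blast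
qed (use C pos UL m_nonneg \<phi>_l2bd[OF \<tau>] \<phi>_nonneg in auto)

lemma \<phi>_bmeas: assumes "k \<noteq> 0" shows "bmeas T (\<lambda>\<tau>. \<phi> \<tau> k)"
proof -
  have "bmeas T (\<lambda>\<tau>. x \<tau> k) \<and> bmeas T (\<lambda>\<tau>. y \<tau> k)"
  proof (cases "k \<in> K")
    case True
    then obtain n \<eta> where "k \<in> freq n" "forced_kdv T n \<eta> x" "forced_kdv T n \<eta> y"
      using pair unfolding kdv_pair_def by (metis zero_less_one)
    then have "(\<exists>g. prim T (\<lambda>\<tau>. x \<tau> k) g) \<and> (\<exists>g. prim T (\<lambda>\<tau>. y \<tau> k) g)" unfolding forced_kdv_def by metis
    then show ?thesis using prim_bmeas by metis
  next
    case False
    then have z: "x \<tau> k = 0" "y \<tau> k = 0" if "\<tau> \<in> {0..T}" for \<tau>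
      using pair assms that unfolding kdv_pair_def by auto
    have "bmeas T (\<lambda>\<tau>. x \<tau> k)" using z(1) by (intro bmeas_cong[OF bmeas_const[of T 0]]) simp
    moreover have "bmeas T (\<lambda>\<tau>. y \<tau> k)" using z(2) by (intro bmeas_cong[OF bmeas_const[of T 0]]) simp
    ultimately show ?thesis ..
  qed
  then have "bmeas T (\<lambda>\<tau>. cmod (x \<tau> k) + cmod (y \<tau> k))" "bmeas T (\<lambda>\<tau>. cmod (x \<tau> k + - 1 * y \<tau> k))"
    using bmeas_add[OF bmeas_norm bmeas_norm] bmeas_norm[OF bmeas_add[OF _ bmeas_cmult]] by blast+
  then have u: "bmeas T (\<lambda>\<tau>. cmod (x \<tau> k) + cmod (y \<tau> k))" "bmeas T (\<lambda>\<tau>. cmod (x \<tau> k - y \<tau> k))"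
    by simp_all
  show ?thesis
    unfolding \<phi>_def
    by (rule bmeas_add[OF bmeas_add[OF bmeas_add[OF bmeas_cmult[OF u(1)] bmeas_cmult[OF bmeas_cmult[OF u(1)]]]
        bmeas_cmult[OF u(2)]] bmeas_cmult[OF bmeas_cmult[OF u(2)]]])
qed

text \<open>Here \<open>k\<close> is fixed while the forcing tends to zero, so the
  \<open>k\<close>-dependent weights in front of the forcing are harmless. The truncation index may
  change with the accuracy because the remaining bounds do not involve it.\<close>

lemma increments:
  assumes t: "t \<in> {s..e}" and k: "k \<in> K"
  shows "m k * cmod ((x t k - y t k) - (x s k - y s k)) \<le>
     (44 * C * D + 512 * C\<^sup>2 * D\<^sup>2 + 4000 * C\<^sup>2 * D ^ 3 * (t - s)) * S / mag k
     + 48 * C\<^sup>2 * D\<^sup>2 * S * integral {s..t} (\<lambda>\<tau>. \<phi> \<tau> k)" (is "?l \<le> ?h")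
   and "m k * cmod ((x t k - y t k) - (x s k - y s k)) \<le> 32 * C * D * S * mag k * (t - s)" (is "_ \<le> ?h2")
proof -
  have k0: "k \<noteq> 0" using pair k unfolding kdv_pair_def by metis
  define c where "c = m k * (2 * mag k + 6 * D + 62 * D\<^sup>2)"
  have c: "c \<ge> 0" "m k * (2 * mag k) \<le> c"
    unfolding c_def using m_nonneg pos by (auto intro!: mult_left_mono)
  have *: "?l \<le> ?h + \<epsilon>" "?l \<le> ?h2 + \<epsilon>" if \<epsilon>: "\<epsilon> > 0" for \<epsilon>
  proof -
    have "\<epsilon> / (c + 1) > 0" using \<epsilon> c by simp
    then obtain n \<eta> where n: "k \<in> freq n" "bmeas T \<eta>" "\<forall>t\<in>{0..T}. 0 \<le> \<eta> t" "integral {0..T} \<eta> \<le> \<epsilon> / (c + 1)"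
        "forced_kdv T n \<eta> x" "forced_kdv T n \<eta> y"
      using pair k unfolding kdv_pair_def by metis
    interpret dominated_pair T n \<eta> x y m C D U L S \<phi> s t
      by (rule dominated_pair.intro) (use n se t is_dominated in auto)
    have "0 \<le> integral {0..T} \<eta>"
      using n T0 by (intro integral_subinterval_le(2)[of T]) auto
    then have "c * integral {0..T} \<eta> \<le> (c + 1) * integral {0..T} \<eta>" 
      "m k * (2 * mag k) * integral {0..T} \<eta> \<le> c * integral {0..T} \<eta>"
      using c by (auto intro: mult_right_mono)
    moreover have "(c + 1) * integral {0..T} \<eta> \<le> \<epsilon>" using n(4) c by (simp add: pos_le_divide_eq mult.commute)
    ultimately show "?l \<le> ?h + \<epsilon>" "?l \<le> ?h2 + \<epsilon>"
      using high_increment[OF n(1) \<phi>_bmeas[OF k0]] low_increment[OF n(1)] unfolding c_def[symmetric] by linarith+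
  qed
  show "?l \<le> ?h" by (rule field_le_epsilon) (rule *)
  show "?l \<le> ?h2" by (rule field_le_epsilon) (rule *)
qed

end

lemma card_low: "card {k \<in> F. \<bar>k\<bar> \<le> int N} \<le> 2 * N + 1" if "finite F"
proof -
  have "card {k \<in> F. \<bar>k\<bar> \<le> int N} \<le> card {- int N..int N}"
    by (rule card_mono) auto
  then show ?thesis by simp
qed

text \<open>Gain of a factor \<open>1/2\<close> on short time intervals: low output frequencies are treated with the
  equation itself, high ones with the normal form, whose boundary terms decay like \<open>1 / \<bar>k\<bar>\<close>.\<close>

lemma short_time_gain:
  fixes C D :: real
  assumes C: "C \<ge> 1" and D: "D > 0"
  obtains h where "h > 0" "\<And>T K x y m U L S s e Y t. step_data T K x y m C D U L S s e \<Longrightarrow> e - s \<le> h \<Longrightarrow>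
     l2bd (\<lambda>k. m k * cmod (x s k - y s k)) Y \<Longrightarrow> t \<in> {s..e} \<Longrightarrow> l2bd (\<lambda>k. m k * cmod (x t k - y t k)) (Y + S / 2)"
proof -
  define c1 where "c1 = 32 * C * D"
  define c2 where "c2 = 44 * C * D + 512 * C\<^sup>2 * D\<^sup>2 + 4000 * C\<^sup>2 * D ^ 3"
  define c3 where "c3 = 48 * C\<^sup>2 * D\<^sup>2"
  have c: "c1 > 0" "c2 > 0" "c3 > 0"
    unfolding c1_def c2_def c3_def using C D by (auto intro!: add_pos_pos)
  \<comment> \<open>\<open>N\<close> is chosen from \<open>C\<close> and \<open>D\<close> alone,
    before the weight, the solutions and the sizes \<open>U\<close>, \<open>L\<close>,
    \<open>S\<close> are known; the step length inherits this uniformity.\<close>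
  obtain N :: nat where N: "\<And>F. finite F \<Longrightarrow> \<forall>k\<in>F. \<bar>k\<bar> > int N \<Longrightarrow> L2_set (\<lambda>k. 1 / mag k) F \<le> 1 / (6 * c2)"
  proof -
    have "1 / (6 * c2) > 0" using c by simp
    from l2bd_small_tail[OF this] show ?thesis using that by metis
  qed
  \<comment> \<open>At most \<open>2 * N + 1\<close> low frequencies, each contributing at most
    \<open>c1 * N * h * S\<close>; on finitely many frequencies the l^2 norm is simply bounded by
    the sum.\<close>
  define cN where "cN = (2 * real N + 1) * (c1 * real N)"
  have cN: "cN \<ge> 0" unfolding cN_def using c by simp
  \<comment> \<open>The low-frequency part and the resonant part each become at most S / 6, and
    \<open>N\<close> does the same for the part decaying in \<open>k\<close>; together they give S /
    2. The bound \<open>h \<le> 1\<close> absorbs the factor \<open>t - s\<close> into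
    \<open>c2\<close>.\<close>
  define h where "h = min 1 (min (1 / (6 * cN + 1)) (1 / (24 * c3)))"
  have h: "h > 0" "h \<le> 1" "cN * h \<le> 1 / 6" "c3 * (4 * h) \<le> 1 / 6"
  proof -
    show "h > 0" "h \<le> 1" unfolding h_def using c cN by auto
    have "h \<le> 1 / (6 * cN + 1)" "h \<le> 1 / (24 * c3)" unfolding h_def by auto
    then have "h * (6 * cN + 1) \<le> 1" "h * (24 * c3) \<le> 1"
      using c cN by (simp_all add: pos_le_divide_eq)
    then show "cN * h \<le> 1 / 6" "c3 * (4 * h) \<le> 1 / 6"
      using \<open>h > 0\<close> by (simp_all add: algebra_simps)
  qed
  show ?thesis
  proof (rule that[OF h(1)])
    fix T K x y m U L S s e Y t
    assume sd: "step_data T K x y m C D U L S s e" and eh: "e - s \<le> h"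
      and Y: "l2bd (\<lambda>k. m k * cmod (x s k - y s k)) Y" and t: "t \<in> {s..e}"
    interpret step_data T K x y m C D U L S s e by fact
    have ts: "0 \<le> t - s" "t - s \<le> h" using t eh by auto
    define r1 where "r1 k = (if \<bar>k\<bar> \<le> int N then c1 * real N * h * S else 0)" for k :: int
    define r2 where "r2 k = (if \<bar>k\<bar> \<le> int N then 0 else c2 * S * (1 / mag k))" for k :: int
    define r3 where "r3 k = c3 * S * integral {s..t} (\<lambda>\<tau>. \<phi> \<tau> k)" for k
    have r1: "l2bd r1 (S / 6)"
      unfolding l2bd_def
    proof (intro allI impI, elim conjE)
      fix F :: "int set" assume F: "finite F" "0 \<notin> F"
      have "L2_set r1 F \<le> (\<Sum>k\<in>F. \<bar>r1 k\<bar>)" by (rule L2_set_le_sum_abs)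
      also have "\<dots> = (\<Sum>k\<in>{k \<in> F. \<bar>k\<bar> \<le> int N}. c1 * real N * h * S)"
        using F c h pos by (intro sum.mono_neutral_cong_right) (auto simp: r1_def)
      also have "\<dots> \<le> (2 * real N + 1) * (c1 * real N * h * S)"
        using card_low[OF F(1), of N] c h pos by (simp add: mult_right_mono)
      also have "\<dots> = cN * h * S" unfolding cN_def by (simp add: algebra_simps)
      also have "\<dots> \<le> 1 / 6 * S" using h pos by (intro mult_right_mono) auto
      finally show "L2_set r1 F \<le> S / 6" by simp
    qed
    have r2: "l2bd r2 (S / 6)"
      unfolding l2bd_def
    proof (intro allI impI, elim conjE)
      fix F :: "int set" assume F: "finite F" "0 \<notin> F"
      let ?F = "{k \<in> F. \<bar>k\<bar> > int N}"
      have "L2_set r2 F = L2_set (\<lambda>k. c2 * S * (1 / mag k)) ?F"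
        unfolding L2_set_def using F by (intro arg_cong[of _ _ sqrt] sum.mono_neutral_cong_right) (auto simp: r2_def)
      also have "\<dots> = c2 * S * L2_set (\<lambda>k. 1 / mag k) ?F"
        using c pos by (intro L2_set_right_distrib[symmetric]) auto
      also have "\<dots> \<le> c2 * S * (1 / (6 * c2))"
        using F c pos by (intro mult_left_mono N) auto
      finally show "L2_set r2 F \<le> S / 6" using c by simp
    qed
    have r3: "l2bd r3 (S / 6)"
    proof (rule l2bd_mono)
      show "l2bd r3 (c3 * S * (4 * (t - s)))"
        unfolding r3_def using c pos t se
        by (intro l2bd_cmult l2bd_integral[where T = T] \<phi>_bmeas \<phi>_nonneg \<phi>_l2bd) auto
      have "c3 * S * (4 * (t - s)) \<le> c3 * S * (4 * h)"
        using ts c pos by (intro mult_left_mono) auto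
      also have "\<dots> = S * (c3 * (4 * h))" by simp
      also have "\<dots> \<le> S * (1 / 6)" using h pos by (intro mult_left_mono) auto
      finally show "c3 * S * (4 * (t - s)) \<le> S / 6" by simp
    qed
    have I0: "integral {s..t} (\<lambda>\<tau>. \<phi> \<tau> k) \<ge> 0" if "k \<noteq> 0" for k
      using bmeas_integrable[OF \<phi>_bmeas[OF that], of s t] se t \<phi>_nonneg
      by (intro Henstock_Kurzweil_Integration.integral_nonneg) auto
    have "l2bd (\<lambda>k. m k * cmod (x s k - y s k) + (r1 k + r2 k + r3 k)) (Y + (S / 6 + S / 6 + S / 6))"
      by (intro l2bd_add Y r1 r2 r3)
    moreover have "\<bar>m k * cmod (x t k - y t k)\<bar> \<le> m k * cmod (x s k - y s k) + (r1 k + r2 k + r3 k)" if k0: "k \<noteq> 0" for k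
    proof -
      have r0: "r1 k \<ge> 0" "r2 k \<ge> 0" "r3 k \<ge> 0"
        unfolding r1_def r2_def r3_def using c h pos I0[OF k0] by auto
      have le: "m k * cmod ((x t k - y t k) - (x s k - y s k)) \<le> r1 k + r2 k + r3 k"
      proof (cases "k \<in> K")
        case True
        show ?thesis
        proof (cases "\<bar>k\<bar> \<le> int N")
          case low: True
          have "m k * cmod ((x t k - y t k) - (x s k - y s k)) \<le> c1 * S * mag k * (t - s)"
            using increments(2)[OF t True] unfolding c1_def by simp
          also have "\<dots> \<le> c1 * S * real N * h"
            using low ts c pos by (intro mult_mono) auto
          also have "\<dots> = r1 k" using low by (simp add: r1_def)
          finally show ?thesis using r0 by linarith
        next
          case high: False
          have "4000 * C\<^sup>2 * D ^ 3 * (t - s) \<le> 4000 * C\<^sup>2 * D ^ 3 * 1"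
            using ts h C D by (intro mult_left_mono) auto
          then have "(44 * C * D + 512 * C\<^sup>2 * D\<^sup>2 + 4000 * C\<^sup>2 * D ^ 3 * (t - s)) * S / mag k \<le> c2 * S / mag k"
            unfolding c2_def using pos by (intro divide_right_mono mult_right_mono) auto
          also have "\<dots> = r2 k" using high by (simp add: r2_def)
          finally have "m k * cmod ((x t k - y t k) - (x s k - y s k)) \<le> r2 k + r3 k"
            using increments(1)[OF t True] unfolding r3_def c3_def by linarith
          then show ?thesis using r0 by linarith
        qed
      next
        case False
        have "x t k = 0" "y t k = 0" "x s k = 0" "y s k = 0"
          using pair False k0 t se unfolding kdv_pair_def by auto
        then show ?thesis using r0 by simp
      qed
      have "cmod (x t k - y t k) \<le> cmod (x s k - y s k) + cmod ((x t k - y t k) - (x s k - y s k))"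
        by (rule norm_triangle_sub)
      then have "m k * cmod (x t k - y t k) \<le> m k * cmod (x s k - y s k) + m k * cmod ((x t k - y t k) - (x s k - y s k))"
        unfolding distrib_left[symmetric] using m_nonneg by (rule mult_left_mono)
      then show ?thesis using le m_nonneg[of k] by simp
    qed
    ultimately show "l2bd (\<lambda>k. m k * cmod (x t k - y t k)) (Y + S / 2)"
      using l2bd_dominated[of "\<lambda>k. m k * cmod (x s k - y s k) + (r1 k + r2 k + r3 k)" "Y + (S / 6 + S / 6 + S / 6)"] by simp
  qed
qed

section \<open>Iteration of the short-time gain\<close>

lemma l2bd_limit:
  assumes "\<And>j. l2bd f (B + c j)" "c \<longlonglongrightarrow> 0" shows "l2bd f B"
  unfolding l2bd_def
proof (intro allI impI, elim conjE)
  fix F :: "int set" assume F: "finite F" "0 \<notin> F"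
  have "(\<lambda>j. B + c j) \<longlonglongrightarrow> B + 0" using assms(2) by (intro tendsto_intros)
  then show "L2_set f F \<le> B"
    using l2bdD[OF assms(1) F] by (intro LIMSEQ_le_const[of _ B]) auto
qed

text \<open>The map from \<open>S\<close> to \<open>Y + S / 2\<close> has the attracting fixed point
  \<open>2 * Y\<close>. The argument has to start from some finite bound \<open>S0\<close>;
  producing one is the purpose of the bounded weights.\<close>

lemma l2bd_halving:
  assumes "\<And>S. S > 0 \<Longrightarrow> (\<forall>t\<in>I. l2bd (f t) S) \<Longrightarrow> (\<forall>t\<in>I. l2bd (f t) (Y + S / 2))"
    and S0: "S0 > 0" "\<forall>t\<in>I. l2bd (f t) S0" and Y: "Y \<ge> 0"
  shows "\<forall>t\<in>I. l2bd (f t) (2 * Y)"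
proof -
  have "\<forall>t\<in>I. l2bd (f t) (2 * Y + S0 / 2 ^ j)" for j
  proof (induction j)
    case 0
    show ?case using S0 Y by (auto intro: l2bd_mono)
  next
    case (Suc j)
    have "2 * Y + S0 / 2 ^ j > 0" using Y S0 by (intro add_nonneg_pos) auto
    from assms(1)[OF this Suc] show ?case by (simp add: field_simps)
  qed
  moreover have "(\<lambda>j. S0 / 2 ^ j) \<longlonglongrightarrow> 0"
    using tendsto_mult[OF tendsto_const[of S0] LIMSEQ_power_zero[of "1/2::real"]] by (simp add: power_divide)
  ultimately show ?thesis by (intro ballI) (rule l2bd_limit[where c = "\<lambda>j. S0 / 2 ^ j"]; blast)
qed

text \<open>Time steps of fixed length \<open>h\<close>, each costing a factor 2. In the
  applications \<open>h\<close> does not shrink along the way, since the bound \<open>D\<close> that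
  determines it is given on the whole of [0,T].\<close>

lemma l2bd_doubling:
  assumes h: "h > 0" and Y: "l2bd (f 0) Y" and T: "T \<ge> (0::real)"
    and double: "\<And>s e Y. 0 \<le> s \<Longrightarrow> s \<le> e \<Longrightarrow> e \<le> T \<Longrightarrow> e - s \<le> h \<Longrightarrow> l2bd (f s) Y \<Longrightarrow> l2bd (f e) (2 * Y)"
  shows "\<forall>t\<in>{0..T}. l2bd (f t) (2 ^ nat \<lceil>T / h\<rceil> * Y)"
proof
  have *: "\<forall>t\<in>{0..T}. t \<le> real j * h \<longrightarrow> l2bd (f t) (2 ^ j * Y)" for j
  proof (induction j)
    case 0
    show ?case using Y by auto
  next
    case (Suc j)
    show ?case
    proof (intro ballI impI)
      fix t assume t: "t \<in> {0..T}" "t \<le> real (Suc j) * h"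
      define s where "s = min t (real j * h)"
      have "l2bd (f s) (2 ^ j * Y)" using Suc t h unfolding s_def by auto
      moreover have "0 \<le> s" "s \<le> t" "t \<le> T" "t - s \<le> h" using t h unfolding s_def by (auto simp: algebra_simps)
      ultimately show "l2bd (f t) (2 ^ Suc j * Y)" using double[of s t "2 ^ j * Y"] by (simp add: mult.assoc)
    qed
  qed
  fix t assume t: "t \<in> {0..T}"
  have "T / h \<le> real (nat \<lceil>T / h\<rceil>)" by (rule real_nat_ceiling_ge)
  then have "T \<le> real (nat \<lceil>T / h\<rceil>) * h" using h by (simp add: pos_divide_le_eq)
  then show "l2bd (f t) (2 ^ nat \<lceil>T / h\<rceil> * Y)" using *[of "nat \<lceil>T / h\<rceil>"] t by auto
qed

text \<open>Supplies the finite starting bound for \<open>l2bd_halving\<close>.\<close>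

lemma l2bd_weight_bounded:
  assumes "l2bd f B" "\<And>k. 0 \<le> f k" "\<And>k. 0 \<le> m k" "\<And>k. m k \<le> W" "\<And>k. 0 \<le> g k" "\<And>k. g k \<le> f k"
  shows "l2bd (\<lambda>k. m k * g k) (W * B)"
proof (rule l2bd_dominated)
  have "W \<ge> 0" using assms(3)[of 0] assms(4)[of 0] by linarith
  then show "l2bd (\<lambda>k. W * f k) (W * B)" using assms(1) by (intro l2bd_cmult)
  show "\<bar>m k * g k\<bar> \<le> W * f k" for k
    using assms(2-6) \<open>W \<ge> 0\<close> by (simp add: abs_mult mult_mono)
qed

text \<open>With the zero solution as partner the difference is \<open>x\<close> itself, so
  \<open>L = D\<close>, \<open>U = S\<close> and \<open>UL\<close> is an equality. Thus
  \<open>D\<close> is only a plain l^2 bound. The constant \<open>A\<close> is fixed before the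
  weight and its bound \<open>W\<close>, which serves for finiteness alone.\<close>

lemma persistence:
  assumes C: "C \<ge> 1" and D: "D > 0" and T: "T \<ge> 0"
  obtains A where "A \<ge> 0" "\<And>K x m W B t. kdv_pair T K x (\<lambda>_ _. 0) \<Longrightarrow> weight C m \<Longrightarrow> (\<And>k. m k \<le> W) \<Longrightarrow>
    (\<And>t. t \<in> {0..T} \<Longrightarrow> l2bd (\<lambda>k. cmod (x t k)) D) \<Longrightarrow> l2bd (\<lambda>k. m k * cmod (x 0 k)) B \<Longrightarrow>
    t \<in> {0..T} \<Longrightarrow> l2bd (\<lambda>k. m k * cmod (x t k)) (A * B)"
proof -
  obtain h where h: "h > 0" and gain: "\<And>T K x y m U L S s e Y t. step_data T K x y m C D U L S s e \<Longrightarrow> e - s \<le> h \<Longrightarrow>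
     l2bd (\<lambda>k. m k * cmod (x s k - y s k)) Y \<Longrightarrow> t \<in> {s..e} \<Longrightarrow> l2bd (\<lambda>k. m k * cmod (x t k - y t k)) (Y + S / 2)"
    using short_time_gain[OF C D] by blast
  show ?thesis
  proof (rule that[of "2 ^ nat \<lceil>T / h\<rceil>"])
    fix K x m W B t
    assume pair: "kdv_pair T K x (\<lambda>_ _. 0)" and m: "weight C m" "\<And>k. m k \<le> W"
      and x: "\<And>t. t \<in> {0..T} \<Longrightarrow> l2bd (\<lambda>k. cmod (x t k)) D" and B: "l2bd (\<lambda>k. m k * cmod (x 0 k)) B" and t: "t \<in> {0..T}"
    have m0: "m k \<ge> 0" for k using m(1) unfolding weight_def by blast
    have W0: "W \<ge> 0" using m0[of 0] m(2)[of 0] by linarith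
    have "\<forall>t\<in>{0..T}. l2bd (\<lambda>k. m k * cmod (x t k)) (2 ^ nat \<lceil>T / h\<rceil> * B)"
    proof (rule l2bd_doubling[where f = "\<lambda>t k. m k * cmod (x t k)", OF h B T])
      fix s e Y assume se: "0 \<le> s" "s \<le> e" "e \<le> T" "e - s \<le> h" and Y: "l2bd (\<lambda>k. m k * cmod (x s k)) Y"
      have "\<forall>t\<in>{s..e}. l2bd (\<lambda>k. m k * cmod (x t k)) (2 * Y)"
      proof (rule l2bd_halving)
        show "W * D + 1 > 0" using W0 D by (intro add_nonneg_pos) auto
        show "\<forall>t\<in>{s..e}. l2bd (\<lambda>k. m k * cmod (x t k)) (W * D + 1)"
        proof
          fix t assume "t \<in> {s..e}"
          then have "l2bd (\<lambda>k. m k * cmod (x t k)) (W * D)"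
            using x se m0 m(2) by (intro l2bd_weight_bounded[of "\<lambda>k. cmod (x t k)"]) auto
          then show "l2bd (\<lambda>k. m k * cmod (x t k)) (W * D + 1)" by (rule l2bd_mono) simp
        qed
        show "Y \<ge> 0" using Y by (rule l2bd_nonneg)
        fix S :: real assume S: "S > 0" "\<forall>t\<in>{s..e}. l2bd (\<lambda>k. m k * cmod (x t k)) S"
        have "step_data T K x (\<lambda>_ _. 0) m C D S D S s e"
          using pair m C D S se x by unfold_locales (auto simp: mult.commute)
        from gain[OF this se(4)] Y show "\<forall>t\<in>{s..e}. l2bd (\<lambda>k. m k * cmod (x t k)) (Y + S / 2)" by simp
      qed
      then show "l2bd (\<lambda>k. m k * cmod (x e k)) (2 * Y)" using se by auto
    qed
    then show "l2bd (\<lambda>k. m k * cmod (x t k)) (2 ^ nat \<lceil>T / h\<rceil> * B)" using t by blast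
  qed simp
qed

text \<open>Now \<open>U = D\<close> and \<open>L = S\<close>: since the weight is at least 1 off
  zero, the weighted bounds also control the unweighted ones, and \<open>UL\<close> is again an
  equality. The price is that \<open>D\<close> must bound the weighted norms of both
  solutions.\<close>

lemma lipschitz_dependence:
  assumes C: "C \<ge> 1" and D: "D > 0" and T: "T \<ge> 0"
  obtains A where "A \<ge> 0" "\<And>K x y m B t. kdv_pair T K x y \<Longrightarrow> weight C m \<Longrightarrow> (\<And>k. k \<noteq> 0 \<Longrightarrow> 1 \<le> m k) \<Longrightarrow>
    (\<And>t. t \<in> {0..T} \<Longrightarrow> l2bd (\<lambda>k. m k * (cmod (x t k) + cmod (y t k))) D) \<Longrightarrow> l2bd (\<lambda>k. m k * cmod (x 0 k - y 0 k)) B \<Longrightarrow>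
    t \<in> {0..T} \<Longrightarrow> l2bd (\<lambda>k. m k * cmod (x t k - y t k)) (A * B)"
proof -
  obtain h where h: "h > 0" and gain: "\<And>T K x y m U L S s e Y t. step_data T K x y m C D U L S s e \<Longrightarrow> e - s \<le> h \<Longrightarrow>
     l2bd (\<lambda>k. m k * cmod (x s k - y s k)) Y \<Longrightarrow> t \<in> {s..e} \<Longrightarrow> l2bd (\<lambda>k. m k * cmod (x t k - y t k)) (Y + S / 2)"
    using short_time_gain[OF C D] by blast
  show ?thesis
  proof (rule that[of "2 ^ nat \<lceil>T / h\<rceil>"])
    fix K x y m B t
    assume pair: "kdv_pair T K x y" and m: "weight C m" "\<And>k. k \<noteq> 0 \<Longrightarrow> 1 \<le> m k"
      and xy: "\<And>t. t \<in> {0..T} \<Longrightarrow> l2bd (\<lambda>k. m k * (cmod (x t k) + cmod (y t k))) D"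
      and B: "l2bd (\<lambda>k. m k * cmod (x 0 k - y 0 k)) B" and t: "t \<in> {0..T}"
    have m0: "m k \<ge> 0" for k using m(1) unfolding weight_def by blast
    have unweighted: "l2bd f S" if "l2bd (\<lambda>k. m k * f k) S" "\<And>k. f k \<ge> 0" for f S
    proof (rule l2bd_dominated[OF that(1)])
      fix k :: int assume "k \<noteq> 0"
      from mult_right_mono[OF m(2)[OF this] that(2)] show "\<bar>f k\<bar> \<le> m k * f k" using that(2)[of k] by simp
    qed
    have "\<forall>t\<in>{0..T}. l2bd (\<lambda>k. m k * cmod (x t k - y t k)) (2 ^ nat \<lceil>T / h\<rceil> * B)"
    proof (rule l2bd_doubling[where f = "\<lambda>t k. m k * cmod (x t k - y t k)", OF h B T])
      fix s e Y assume se: "0 \<le> s" "s \<le> e" "e \<le> T" "e - s \<le> h" and Y: "l2bd (\<lambda>k. m k * cmod (x s k - y s k)) Y"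
      have "\<forall>t\<in>{s..e}. l2bd (\<lambda>k. m k * cmod (x t k - y t k)) (2 * Y)"
      proof (rule l2bd_halving)
        show "\<forall>t\<in>{s..e}. l2bd (\<lambda>k. m k * cmod (x t k - y t k)) D"
        proof
          fix t assume "t \<in> {s..e}"
          then have "l2bd (\<lambda>k. m k * (cmod (x t k) + cmod (y t k))) D" using xy se by auto
          then show "l2bd (\<lambda>k. m k * cmod (x t k - y t k)) D"
            by (rule l2bd_dominated) (auto simp: abs_mult m0 intro!: mult_left_mono norm_triangle_ineq4)
        qed
        show "Y \<ge> 0" using Y by (rule l2bd_nonneg)
        fix S :: real assume S: "S > 0" "\<forall>t\<in>{s..e}. l2bd (\<lambda>k. m k * cmod (x t k - y t k)) S"
        have "step_data T K x y m C D D S S s e"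
          using pair m C D S se xy by unfold_locales (auto intro: unweighted)
        from gain[OF this se(4) Y] show "\<forall>t\<in>{s..e}. l2bd (\<lambda>k. m k * cmod (x t k - y t k)) (Y + S / 2)" by simp
      qed (rule D)
      then show "l2bd (\<lambda>k. m k * cmod (x e k - y e k)) (2 * Y)" using se by auto
    qed
    then show "l2bd (\<lambda>k. m k * cmod (x t k - y t k)) (2 ^ nat \<lceil>T / h\<rceil> * B)" using t by blast
  qed simp
qed

section \<open>Weak solutions\<close>

lemma nonneg_sums_bounded:
  fixes f :: "'a \<Rightarrow> real"
  assumes "\<And>x. x \<in> A \<Longrightarrow> f x \<ge> 0" "\<And>F. finite F \<Longrightarrow> F \<subseteq> A \<Longrightarrow> sum f F \<le> B"
  shows "f summable_on A" "infsum f A \<le> B"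
proof -
  show s: "f summable_on A"
    using assms by (intro nonneg_bdd_above_summable_on bdd_aboveI2[where M = B]) auto
  show "infsum f A \<le> B"
    using assms(2) by (intro infsum_le_finite_sums s) auto
qed

lemma bounded_sums_norm:
  fixes f :: "'a \<Rightarrow> complex"
  assumes "\<And>F. finite F \<Longrightarrow> F \<subseteq> A \<Longrightarrow> (\<Sum>x\<in>F. norm (f x)) \<le> B"
  shows "f summable_on A" "norm (infsum f A) \<le> B"
proof -
  note n = nonneg_sums_bounded[of A "\<lambda>x. norm (f x)" B, OF norm_ge_zero assms]
  from n(1) show "f summable_on A" by (rule abs_summable_summable)
  show "norm (infsum f A) \<le> B" using norm_infsum_bound[OF n(1)] n(2) by linarith
qed

section \<open>Sobolev weights and their bounded truncations\<close>

definition nonzero :: "int set" where "nonzero = {k. k \<noteq> 0}"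

definition hw :: "real \<Rightarrow> int \<Rightarrow> real" where
  "hw s k = real_of_int \<bar>k\<bar> powr s"

definition hwt :: "real \<Rightarrow> nat \<Rightarrow> int \<Rightarrow> real" where
  "hwt s N k = min (real_of_int \<bar>k\<bar>) (real N) powr s"

lemma hw_nonneg: "hw s k \<ge> 0" by (simp add: hw_def)

lemma hwt_le_hw: "s \<ge> 0 \<Longrightarrow> hwt s N k \<le> hw s k"
  unfolding hwt_def hw_def by (intro powr_mono2) auto

lemma hwt_eq_hw: "\<bar>k\<bar> \<le> int N \<Longrightarrow> hwt s N k = hw s k"
  unfolding hwt_def hw_def by (simp add: min_absorb1)

lemma hwt_bounded: "s \<ge> 0 \<Longrightarrow> hwt s N k \<le> real N powr s"
  unfolding hwt_def by (intro powr_mono2) auto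

lemma one_le_hwt: "s \<ge> 0 \<Longrightarrow> N \<ge> 1 \<Longrightarrow> k \<noteq> 0 \<Longrightarrow> 1 \<le> hwt s N k"
  unfolding hwt_def by (intro ge_one_powr_ge_zero) auto

text \<open>The truncated modulus is subadditive, hence at most twice the larger of the two values.
  The constant \<open>2 powr s\<close> does not see the cut-off \<open>N\<close>, which allows
  \<open>N\<close> to tend to infinity later.\<close>

lemma weight_hwt: assumes "s \<ge> 0" shows "weight (2 powr s) (hwt s N)"
  unfolding weight_def
proof (intro conjI allI)
  show "0 \<le> hwt s N k" for k by (simp add: hwt_def)
  fix a b :: int
  define p where "p = min (real_of_int \<bar>a\<bar>) (real N)"
  define q where "q = min (real_of_int \<bar>b\<bar>) (real N)"
  have pq: "p \<ge> 0" "q \<ge> 0" unfolding p_def q_def by auto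
  have "min (real_of_int \<bar>a + b\<bar>) (real N) \<le> 2 * max p q"
    unfolding p_def q_def by linarith
  then have "hwt s N (a + b) \<le> (2 * max p q) powr s"
    unfolding hwt_def using assms by (intro powr_mono2) auto
  also have "\<dots> = 2 powr s * (max p q powr s)" using pq by (simp add: powr_mult)
  also have "max p q powr s \<le> p powr s + q powr s" by (simp add: max_def)
  finally show "hwt s N (a + b) \<le> 2 powr s * (hwt s N a + hwt s N b)"
    by (simp add: p_def q_def hwt_def)
qed

text \<open>A finite section contains only bounded frequencies, and there the two weights agree once
  \<open>N\<close> is large.\<close>

lemma l2bd_hwt_iff:
  assumes "s \<ge> 0" "\<And>k. f k \<ge> 0"
  shows "l2bd (\<lambda>k. hw s k * f k) B \<longleftrightarrow> (\<forall>N\<ge>1. l2bd (\<lambda>k. hwt s N k * f k) B)"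
proof (intro iffI allI impI)
  fix N :: nat assume "l2bd (\<lambda>k. hw s k * f k) B"
  then show "l2bd (\<lambda>k. hwt s N k * f k) B"
    by (rule l2bd_dominated) (use assms hwt_le_hw in \<open>auto simp: abs_mult hwt_def intro: mult_right_mono\<close>)
next
  assume *: "\<forall>N\<ge>1. l2bd (\<lambda>k. hwt s N k * f k) B"
  show "l2bd (\<lambda>k. hw s k * f k) B"
    unfolding l2bd_def
  proof (intro allI impI, elim conjE)
    fix F :: "int set" assume F: "finite F" "0 \<notin> F"
    obtain n where n: "\<And>k. k \<in> F \<Longrightarrow> \<bar>k\<bar> \<le> int n" using finite_int_bounded[OF F(1)] by blast
    have "L2_set (\<lambda>k. hw s k * f k) F = L2_set (\<lambda>k. hwt s (max n 1) k * f k) F"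
      using n by (intro L2_set_cong) (fastforce simp: hwt_eq_hw)+
    then show "L2_set (\<lambda>k. hw s k * f k) F \<le> B" using * l2bdD[OF _ F] by simp
  qed
qed

lemma Hs_weight_eq: "Hs_weight s v k = (hw s k * cmod (v k))\<^sup>2"
  unfolding Hs_weight_def hw_def power_mult_distrib
  by (simp add: power2_eq_square flip: powr_add)

lemma L2_set_le_iff: "B \<ge> 0 \<Longrightarrow> L2_set f F \<le> B \<longleftrightarrow> (\<Sum>k\<in>F. (f k)\<^sup>2) \<le> B\<^sup>2"
  unfolding L2_set_def using real_sqrt_le_iff[of "\<Sum>k\<in>F. (f k)\<^sup>2" "B\<^sup>2"] by simp

lemma l2bd_Hs:
  assumes "l2bd (\<lambda>k. hw s k * cmod (v k)) B"
  shows "Hs_weight s v summable_on {k. k \<noteq> 0}" "Hs_norm s v \<le> B"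
proof -
  have B: "B \<ge> 0" using assms by (rule l2bd_nonneg)
  have *: "sum (Hs_weight s v) F \<le> B\<^sup>2" if "finite F" "F \<subseteq> {k. k \<noteq> 0}" for F
    using l2bdD[OF assms that(1)] that(2) B unfolding Hs_weight_eq[abs_def] by (auto simp: L2_set_le_iff)
  show "Hs_weight s v summable_on {k. k \<noteq> 0}"
    by (rule nonneg_sums_bounded(1)[OF _ *]) (auto simp: Hs_weight_def)
  have "infsum (Hs_weight s v) {k. k \<noteq> 0} \<le> B\<^sup>2"
    by (rule nonneg_sums_bounded(2)[OF _ *]) (auto simp: Hs_weight_def)
  then show "Hs_norm s v \<le> B" unfolding Hs_norm_def using B by (intro real_le_lsqrt) (auto simp: Hs_weight_def intro: infsum_nonneg)
qed

lemma Hs_l2bd: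
  assumes "Hs_weight s v summable_on {k. k \<noteq> 0}"
  shows "l2bd (\<lambda>k. hw s k * cmod (v k)) (Hs_norm s v)"
  unfolding l2bd_def
proof (intro allI impI, elim conjE)
  fix F :: "int set" assume F: "finite F" "0 \<notin> F"
  have "sum (Hs_weight s v) F \<le> infsum (Hs_weight s v) {k. k \<noteq> 0}"
    using F by (intro finite_sum_le_infsum assms) (auto simp: Hs_weight_def intro!: Nat.gr0I)
  then show "L2_set (\<lambda>k. hw s k * cmod (v k)) F \<le> Hs_norm s v"
    unfolding L2_set_def Hs_norm_def Hs_weight_eq by (rule real_sqrt_le_mono)
qed

lemma Hs_norm_nonneg: "Hs_norm s v \<ge> 0"
  unfolding Hs_norm_def by (auto intro!: infsum_nonneg simp: Hs_weight_def)

lemma l2bd_hw0_iff: "l2bd (\<lambda>k. hw 0 k * f k) B \<longleftrightarrow> l2bd f B"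
proof -
  have "L2_set (\<lambda>k. hw 0 k * f k) F = L2_set f F" if "0 \<notin> F" for F
    using that by (intro L2_set_cong) (auto simp: hw_def)
  then show ?thesis unfolding l2bd_def by auto
qed

lemma l2bd_unweighted:
  assumes "s \<ge> 0" "l2bd (\<lambda>k. hw s k * f k) B" "\<And>k. f k \<ge> 0" shows "l2bd f B"
proof (rule l2bd_dominated[OF assms(2)])
  fix k :: int assume "k \<noteq> 0"
  then have "1 \<le> hw s k" unfolding hw_def using assms(1) by (intro ge_one_powr_ge_zero) auto
  from mult_right_mono[OF this assms(3)] show "\<bar>f k\<bar> \<le> hw s k * f k" using assms(3)[of k] by simp
qed

section \<open>The nonlinearity and its frequency tails\<close>

definition tail :: "nat \<Rightarrow> (int \<Rightarrow> complex) \<Rightarrow> int \<Rightarrow> complex" where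
  "tail n v k = (if \<bar>k\<bar> \<le> int n then 0 else v k)"

abbreviation kdv_dom :: "int \<Rightarrow> int set" where
  "kdv_dom k \<equiv> {k1. k1 \<noteq> 0 \<and> k1 \<noteq> k}"

lemma kdv_rhs_osc: "kdv_rhs v \<tau> k = infsum (\<lambda>a. osc (k * a * (k - a)) \<tau> * (v a * v (k - a))) (kdv_dom k)"
  unfolding kdv_rhs_def osc_def by (simp add: cis_conv_exp mult_ac)

lemma convolution_sum_le:
  assumes "l2bd (\<lambda>k. cmod (u k)) B" "l2bd (\<lambda>k. cmod (v k)) C" "finite F" "F \<subseteq> kdv_dom k"
  shows "(\<Sum>a\<in>F. cmod (u a) * cmod (v (k - a))) \<le> B * C"
  using assms by (intro l2bd_sum_mult[where p = "\<lambda>a. a" and q = "\<lambda>a. k - a"]) (auto simp: inj_on_def)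

lemma kdv_rhs_bound:
  assumes "l2bd (\<lambda>k. cmod (v k)) M"
  shows "(\<lambda>a. osc (k * a * (k - a)) \<tau> * (v a * v (k - a))) summable_on (kdv_dom k)"
    "cmod (kdv_rhs v \<tau> k) \<le> M * M"
  unfolding kdv_rhs_osc
  using bounded_sums_norm[of "kdv_dom k" "\<lambda>a. osc (k * a * (k - a)) \<tau> * (v a * v (k - a))" "M * M"]
    convolution_sum_le[OF assms assms, of _ k] by (auto simp: norm_mult norm_osc)

lemma kdv_rhs_diff:
  assumes "l2bd (\<lambda>k. cmod (u k)) B" "l2bd (\<lambda>k. cmod (v k)) C" "l2bd (\<lambda>k. cmod (u k - v k)) D"
  shows "cmod (kdv_rhs u \<tau> k - kdv_rhs v \<tau> k) \<le> D * (B + C)"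
proof -
  have "kdv_rhs u \<tau> k - kdv_rhs v \<tau> k = infsum (\<lambda>a. osc (k * a * (k - a)) \<tau> * (u a * u (k - a)) - osc (k * a * (k - a)) \<tau> * (v a * v (k - a))) (kdv_dom k)"
    unfolding kdv_rhs_osc using kdv_rhs_bound(1)[OF assms(1)] kdv_rhs_bound(1)[OF assms(2)]
    by (simp add: infsum_add infsum_uminus summable_on_uminus diff_conv_add_uminus del: add_uminus_conv_diff)
  also have "cmod \<dots> \<le> D * B + C * D"
  proof (rule bounded_sums_norm(2))
    fix F assume F: "finite F" "F \<subseteq> kdv_dom k"
    have "(\<Sum>a\<in>F. cmod (osc (k * a * (k - a)) \<tau> * (u a * u (k - a)) - osc (k * a * (k - a)) \<tau> * (v a * v (k - a))))
      \<le> (\<Sum>a\<in>F. cmod (u a - v a) * cmod (u (k - a)) + cmod (v a) * cmod (u (k - a) - v (k - a)))"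
    proof (rule sum_mono)
      fix a
      have "osc (k * a * (k - a)) \<tau> * (u a * u (k - a)) - osc (k * a * (k - a)) \<tau> * (v a * v (k - a))
        = osc (k * a * (k - a)) \<tau> * ((u a - v a) * u (k - a) + v a * (u (k - a) - v (k - a)))"
        by (simp add: algebra_simps)
      then have "cmod (osc (k * a * (k - a)) \<tau> * (u a * u (k - a)) - osc (k * a * (k - a)) \<tau> * (v a * v (k - a)))
        = cmod ((u a - v a) * u (k - a) + v a * (u (k - a) - v (k - a)))"
        by (simp add: norm_mult norm_osc)
      also have "\<dots> \<le> cmod (u a - v a) * cmod (u (k - a)) + cmod (v a) * cmod (u (k - a) - v (k - a))"
        by (rule order_trans[OF norm_triangle_ineq]) (simp add: norm_mult)
      finally show "cmod (osc (k * a * (k - a)) \<tau> * (u a * u (k - a)) - osc (k * a * (k - a)) \<tau> * (v a * v (k - a))) \<le> \<dots>" .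
    qed
    also have "\<dots> \<le> D * B + C * D"
      unfolding sum.distrib using convolution_sum_le[OF assms(3,1) F] convolution_sum_le[OF assms(2,3) F] by (rule add_mono)
    finally show "(\<Sum>a\<in>F. cmod (osc (k * a * (k - a)) \<tau> * (u a * u (k - a)) - osc (k * a * (k - a)) \<tau> * (v a * v (k - a)))) \<le> D * B + C * D" .
  qed
  finally show ?thesis by (simp add: algebra_simps)
qed

lemma kdv_rhs_truncated:
  assumes "\<And>j. j \<noteq> 0 \<Longrightarrow> j \<notin> freq n \<Longrightarrow> v j = 0"
  shows "kdv_rhs v \<tau> k = quad (freq n) v \<tau> k"
proof -
  have "kdv_rhs v \<tau> k = infsum (\<lambda>a. osc (k * a * (k - a)) \<tau> * (v a * v (k - a))) (pairs (freq n) k)"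
    unfolding kdv_rhs_osc
  proof (rule infsum_cong_neutral)
    fix a assume "a \<in> kdv_dom k - pairs (freq n) k"
    then have "v a = 0 \<or> v (k - a) = 0"
      using assms[of a] assms[of "k - a"] by (auto simp: pairs_def)
    then show "osc (k * a * (k - a)) \<tau> * (v a * v (k - a)) = 0" by auto
  qed (auto simp: pairs_def freq_def)
  then show ?thesis
    unfolding quad_def by (simp add: infsum_finite finite_pairs finite_freq)
qed

lemma quad_cong: "(\<And>j. j \<in> A \<Longrightarrow> u j = v j) \<Longrightarrow> quad A u t k = quad A v t k"
  unfolding quad_def by (rule sum.cong) (auto simp: pairs_def)

text \<open>\<open>quad\<close> is the full nonlinearity of the truncated sequence, so the error is
  a difference of two values of one quadratic map whose arguments differ by the tail.\<close>

lemma kdv_rhs_quad_diff: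
  assumes v: "l2bd (\<lambda>k. cmod (v k)) M" and t: "l2bd (\<lambda>k. cmod (tail n v k)) \<epsilon>"
  shows "cmod (kdv_rhs v \<tau> k - quad (freq n) v \<tau> k) \<le> 2 * M * \<epsilon>"
proof -
  define u where "u j = v j - tail n v j" for j
  have "l2bd (\<lambda>k. cmod (u k)) M"
    by (rule l2bd_dominated[OF v]) (auto simp: u_def tail_def)
  moreover have "l2bd (\<lambda>k. cmod (v k - u k)) \<epsilon>" using t unfolding u_def by simp
  ultimately have "cmod (kdv_rhs v \<tau> k - kdv_rhs u \<tau> k) \<le> \<epsilon> * (M + M)"
    using v by (intro kdv_rhs_diff)
  moreover have "kdv_rhs u \<tau> k = quad (freq n) u \<tau> k"
    by (rule kdv_rhs_truncated) (auto simp: u_def tail_def freq_def)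
  moreover have "quad (freq n) u \<tau> k = quad (freq n) v \<tau> k"
    by (rule quad_cong) (auto simp: u_def tail_def freq_def)
  ultimately show ?thesis by (simp add: algebra_simps)
qed

definition l2sq :: "(int \<Rightarrow> complex) \<Rightarrow> real" where
  "l2sq v = infsum (\<lambda>k. (cmod (v k))\<^sup>2) nonzero"

text \<open>The l^2 norm beyond frequency \<open>n\<close>, written as total energy minus a finite
  sum: convergence to zero and measurability in time then both follow from convergence of partial
  sums.\<close>

definition tail_norm :: "nat \<Rightarrow> (int \<Rightarrow> complex) \<Rightarrow> real" where
  "tail_norm n v = sqrt (l2sq v - (\<Sum>k\<in>freq n. (cmod (v k))\<^sup>2))"

lemma l2bd_summable:
  assumes "l2bd (\<lambda>k. cmod (v k)) M"
  shows "(\<lambda>k. (cmod (v k))\<^sup>2) summable_on nonzero" "l2sq v \<le> M\<^sup>2"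
proof -
  have M: "M \<ge> 0" using assms by (rule l2bd_nonneg)
  have *: "(\<Sum>k\<in>F. (cmod (v k))\<^sup>2) \<le> M\<^sup>2" if "finite F" "F \<subseteq> nonzero" for F
    using l2bdD[OF assms that(1)] that M by (auto simp: L2_set_le_iff nonzero_def)
  show "(\<lambda>k. (cmod (v k))\<^sup>2) summable_on nonzero" by (rule nonneg_sums_bounded(1)[OF _ *]) auto
  show "l2sq v \<le> M\<^sup>2" unfolding l2sq_def by (rule nonneg_sums_bounded(2)[OF _ *]) auto
qed

lemma freq_exhausts:
  assumes "finite F" "0 \<notin> F" obtains n where "\<And>m. m \<ge> n \<Longrightarrow> F \<subseteq> freq m"
proof -
  obtain n where n: "\<And>k. k \<in> F \<Longrightarrow> \<bar>k\<bar> \<le> int n" using finite_int_bounded[OF assms(1)] by blast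
  have "F \<subseteq> freq m" if "m \<ge> n" for m
    using n that assms(2) by (force simp: freq_def)
  then show ?thesis using that by blast
qed

lemma filterlim_freq: "filterlim freq (finite_subsets_at_top nonzero) sequentially"
  unfolding filterlim_finite_subsets_at_top
proof (intro allI impI, elim conjE)
  fix X assume X: "finite X" "X \<subseteq> nonzero"
  then obtain n where "\<And>m. m \<ge> n \<Longrightarrow> X \<subseteq> freq m" using freq_exhausts[of X] by (auto simp: nonzero_def)
  then show "\<forall>\<^sub>F n in sequentially. finite (freq n) \<and> X \<subseteq> freq n \<and> freq n \<subseteq> nonzero"
    unfolding eventually_sequentially using finite_freq by (auto simp: freq_def nonzero_def)
qed

lemma sum_freq_tendsto:
  assumes "f summable_on nonzero" shows "(\<lambda>n. sum f (freq n)) \<longlonglongrightarrow> infsum f nonzero"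
  using filterlim_compose[OF infsum_tendsto[OF assms] filterlim_freq] .

lemma tail_norm_l2bd:
  assumes "l2bd (\<lambda>k. cmod (v k)) M"
  shows "l2bd (\<lambda>k. cmod (tail n v k)) (tail_norm n v)" "0 \<le> tail_norm n v" "tail_norm n v \<le> M"
proof -
  note s = l2bd_summable[OF assms]
  have fin: "(\<Sum>k\<in>F. (cmod (v k))\<^sup>2) \<le> l2sq v" if "finite F" "F \<subseteq> nonzero" for F
    unfolding l2sq_def using that s by (intro finite_sum_le_infsum) auto
  have f: "freq n \<subseteq> nonzero" by (auto simp: freq_def nonzero_def)
  show "l2bd (\<lambda>k. cmod (tail n v k)) (tail_norm n v)"
    unfolding l2bd_def
  proof (intro allI impI, elim conjE)
    fix F :: "int set" assume F: "finite F" "0 \<notin> F"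
    have "(\<Sum>k\<in>F. (cmod (tail n v k))\<^sup>2) = (\<Sum>k\<in>F - freq n. (cmod (v k))\<^sup>2)"
      using F by (intro sum.mono_neutral_cong_right) (auto simp: tail_def freq_def)
    also have "\<dots> + (\<Sum>k\<in>freq n. (cmod (v k))\<^sup>2) = (\<Sum>k\<in>(F - freq n) \<union> freq n. (cmod (v k))\<^sup>2)"
      using F finite_freq by (intro sum.union_disjoint[symmetric]) auto
    also have "\<dots> \<le> l2sq v" using F finite_freq f by (intro fin) (auto simp: nonzero_def)
    finally have "(\<Sum>k\<in>F. (cmod (tail n v k))\<^sup>2) + (\<Sum>k\<in>freq n. (cmod (v k))\<^sup>2) \<le> l2sq v" .
    then show "L2_set (\<lambda>k. cmod (tail n v k)) F \<le> tail_norm n v"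
      unfolding L2_set_def tail_norm_def by (intro real_sqrt_le_mono) simp
  qed
  then show "0 \<le> tail_norm n v" by (rule l2bd_nonneg)
  have "tail_norm n v \<le> sqrt (M\<^sup>2)"
    unfolding tail_norm_def using s(2) sum_nonneg[of "freq n" "\<lambda>k. (cmod (v k))\<^sup>2"]
    by (intro real_sqrt_le_mono) (auto intro: order_trans[OF _ s(2)])
  then show "tail_norm n v \<le> M" using l2bd_nonneg[OF assms] by simp
qed

lemma tail_norm_tendsto:
  assumes "l2bd (\<lambda>k. cmod (v k)) M" shows "(\<lambda>n. tail_norm n v) \<longlonglongrightarrow> 0"
proof -
  have "(\<lambda>n. sqrt (l2sq v - (\<Sum>k\<in>freq n. (cmod (v k))\<^sup>2))) \<longlonglongrightarrow> sqrt (l2sq v - l2sq v)"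
    unfolding l2sq_def using l2bd_summable[OF assms] by (intro tendsto_intros sum_freq_tendsto)
  then show ?thesis by (simp add: tail_norm_def[abs_def])
qed

lemma bmeas_limit:
  fixes f :: "nat \<Rightarrow> real \<Rightarrow> 'a::euclidean_space"
  assumes "\<And>n. bmeas T (f n)" "\<And>t. t \<in> {0..T} \<Longrightarrow> (\<lambda>n. f n t) \<longlonglongrightarrow> g t" "\<And>t. t \<in> {0..T} \<Longrightarrow> norm (g t) \<le> B"
  shows "bmeas T g"
  unfolding bmeas_def
proof (intro conjI)
  show "g \<in> borel_measurable (lebesgue_on {0..T})"
    using assms(1,2) unfolding bmeas_def by (auto intro: borel_measurable_LIMSEQ_metric[of f])
qed (use assms(3) in blast)

section \<open>Weak solutions as forced truncated systems\<close>

text \<open>Solutions whose values are square summable at every time, not just almost everywhere.\<close>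

definition kdv_sol :: "real \<Rightarrow> (real \<Rightarrow> int \<Rightarrow> complex) \<Rightarrow> bool" where
  "kdv_sol T x \<longleftrightarrow> (\<exists>M. \<forall>t\<in>{0..T}. l2bd (\<lambda>k. cmod (x t k)) M) \<and>
     (\<forall>k. k \<noteq> 0 \<longrightarrow> prim T (\<lambda>t. x t k) (\<lambda>t. \<i> / 2 * of_int k * kdv_rhs (x t) t k))"

lemma kdv_solE:
  assumes "kdv_sol T x" obtains M where "\<And>t. t \<in> {0..T} \<Longrightarrow> l2bd (\<lambda>k. cmod (x t k)) M"
proof -
  obtain M where "\<forall>t\<in>{0..T}. l2bd (\<lambda>k. cmod (x t k)) M"
    using assms[unfolded kdv_sol_def, THEN conjunct1] ..
  then show ?thesis using that[of M] by blast
qed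

lemma kdv_solD: "kdv_sol T x \<Longrightarrow> k \<noteq> 0 \<Longrightarrow> prim T (\<lambda>t. x t k) (\<lambda>t. \<i> / 2 * of_int k * kdv_rhs (x t) t k)"
  unfolding kdv_sol_def by simp

lemma kdv_solI:
  assumes "\<And>t. t \<in> {0..T} \<Longrightarrow> l2bd (\<lambda>k. cmod (x t k)) M"
    "\<And>k. k \<noteq> 0 \<Longrightarrow> prim T (\<lambda>t. x t k) (\<lambda>t. \<i> / 2 * of_int k * kdv_rhs (x t) t k)"
  shows "kdv_sol T x"
  unfolding kdv_sol_def using assms by (intro conjI exI[of _ M]) simp_all

lemma kdv_sol_zero: "kdv_sol T (\<lambda>_ _. 0)"
proof -
  have "kdv_rhs (\<lambda>_. 0) t k = 0" for t k by (simp add: kdv_rhs_def)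
  moreover have "l2bd (\<lambda>k. cmod 0) 0" by (simp add: l2bd_def L2_set_def)
  ultimately show ?thesis unfolding kdv_sol_def by (auto intro: prim_const)
qed

lemma tail_norm_bmeas:
  assumes "kdv_sol T x" shows "bmeas T (\<lambda>t. tail_norm n (x t))"
proof -
  obtain M where M: "\<And>t. t \<in> {0..T} \<Longrightarrow> l2bd (\<lambda>k. cmod (x t k)) M"
    using kdv_solE[OF assms] by metis
  have c: "continuous_on {0..T} (\<lambda>t. x t k)" if "k \<noteq> 0" for k
    using prim_continuous[OF kdv_solD[OF assms that]] .
  show ?thesis
  proof (rule bmeas_limit)
    fix N
    \<comment> \<open>For \<open>N < n\<close> the argument of the root can be negative;
      \<open>sqrt\<close> is continuous on the whole real line.\<close>
    show "bmeas T (\<lambda>t. sqrt ((\<Sum>k\<in>freq N. (cmod (x t k))\<^sup>2) - (\<Sum>k\<in>freq n. (cmod (x t k))\<^sup>2)))"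
      by (intro bmeas_continuous continuous_intros c) (auto simp: freq_def)
  next
    fix t assume t: "t \<in> {0..T}"
    show "(\<lambda>N. sqrt ((\<Sum>k\<in>freq N. (cmod (x t k))\<^sup>2) - (\<Sum>k\<in>freq n. (cmod (x t k))\<^sup>2))) \<longlonglongrightarrow> tail_norm n (x t)"
      unfolding tail_norm_def l2sq_def using l2bd_summable[OF M[OF t]] by (intro tendsto_intros sum_freq_tendsto)
    show "norm (tail_norm n (x t)) \<le> M" using tail_norm_l2bd[OF M[OF t], of n] by simp
  qed
qed

lemma kdv_sol_forced:
  assumes x: "kdv_sol T x" and M: "\<And>t. t \<in> {0..T} \<Longrightarrow> l2bd (\<lambda>k. cmod (x t k)) M"
    and le: "\<And>t. t \<in> {0..T} \<Longrightarrow> M * tail_norm n (x t) \<le> \<eta> t"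
  shows "forced_kdv T n \<eta> x"
proof -
  let ?g = "\<lambda>j t. \<i> / 2 * of_int j * kdv_rhs (x t) t j"
  let ?E = "\<lambda>t j. \<i> / 2 * of_int j * (kdv_rhs (x t) t j - quad (freq n) (x t) t j)"
  have "prim T (\<lambda>t. x t j) (?g j)" if "j \<in> freq n" for j
    using kdv_solD[OF x] that by (auto simp: freq_def)
  moreover have "?g j t = \<i> / 2 * of_int j * quad (freq n) (x t) t j + ?E t j" for j t
    by (simp add: algebra_simps)
  moreover have "cmod (?E t j) \<le> mag j * \<eta> t" if "t \<in> {0..T}" for t j
  proof -
    have "cmod (?E t j) = mag j * (cmod (kdv_rhs (x t) t j - quad (freq n) (x t) t j) / 2)"
      by (simp add: norm_mult norm_divide)
    also have "cmod (kdv_rhs (x t) t j - quad (freq n) (x t) t j) / 2 \<le> \<eta> t"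
      using kdv_rhs_quad_diff[OF M[OF that] tail_norm_l2bd(1)[OF M[OF that]], of t j n] le[OF that]
      by (simp add: mult.assoc)
    finally show ?thesis by (simp add: mult_left_mono)
  qed
  ultimately show ?thesis
    unfolding forced_kdv_def by (intro exI[of _ ?g] exI[of _ ?E]) blast
qed

text \<open>At each time the tails tend to zero, with a rate that may depend on the time. Dominated
  convergence makes their time integral small, and \<open>kdv_pair\<close> asks for exactly
  that.\<close>

lemma kdv_sol_pair:
  assumes x: "kdv_sol T x" and y: "kdv_sol T y" and T: "T \<ge> 0"
  shows "kdv_pair T nonzero x y"
  unfolding kdv_pair_def
proof (intro conjI ballI allI impI)
  fix k :: int and \<epsilon> :: real assume k: "k \<in> nonzero" and \<epsilon>: "\<epsilon> > 0"
  obtain M1 M2 where M1: "\<And>t. t \<in> {0..T} \<Longrightarrow> l2bd (\<lambda>k. cmod (x t k)) M1" and M2: "\<And>t. t \<in> {0..T} \<Longrightarrow> l2bd (\<lambda>k. cmod (y t k)) M2"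
    using kdv_solE[OF x] kdv_solE[OF y] by metis
  define M where "M = max M1 M2"
  have M: "l2bd (\<lambda>k. cmod (x t k)) M" "l2bd (\<lambda>k. cmod (y t k)) M" if "t \<in> {0..T}" for t
    unfolding M_def by (rule l2bd_mono[OF M1[OF that]] l2bd_mono[OF M2[OF that]]; simp)+
  have M0: "M \<ge> 0" using l2bd_nonneg[OF M(1)[of 0]] T by simp
  define \<eta> where "\<eta> n t = M * (tail_norm n (x t) + tail_norm n (y t))" for n t
  have \<eta>: "bmeas T (\<eta> n)" for n
    unfolding \<eta>_def by (rule bmeas_cmult[OF bmeas_add[OF tail_norm_bmeas[OF x] tail_norm_bmeas[OF y]]])
  have \<eta>0: "0 \<le> \<eta> n t" "\<eta> n t \<le> M * (M + M)" "M * tail_norm n (x t) \<le> \<eta> n t" "M * tail_norm n (y t) \<le> \<eta> n t" if "t \<in> {0..T}" for n t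
    unfolding \<eta>_def using tail_norm_l2bd(2,3)[OF M(1)[OF that], of n] tail_norm_l2bd(2,3)[OF M(2)[OF that], of n] M0
    by (auto intro!: mult_left_mono mult_nonneg_nonneg)
  have "(\<lambda>n. integral {0..T} (\<eta> n)) \<longlonglongrightarrow> integral {0..T} (\<lambda>t. 0)"
  proof (rule dominated_convergence(2))
    show "\<eta> n integrable_on {0..T}" for n using bmeas_integrable[OF \<eta>, of 0 T] by simp
    show "(\<lambda>t. M * (M + M)) integrable_on {0..T}" by (rule integrable_const_ivl)
    show "norm (\<eta> n t) \<le> M * (M + M)" if "t \<in> {0..T}" for n t using \<eta>0[OF that] by simp
    fix t assume t: "t \<in> {0..T}"
    have "(\<lambda>n. \<eta> n t) \<longlonglongrightarrow> M * (0 + 0)"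
      unfolding \<eta>_def by (intro tendsto_intros tail_norm_tendsto[OF M(1)[OF t]] tail_norm_tendsto[OF M(2)[OF t]])
    then show "(\<lambda>n. \<eta> n t) \<longlonglongrightarrow> 0" by simp
  qed
  then have "\<forall>\<^sub>F n in sequentially. integral {0..T} (\<eta> n) < \<epsilon>"
    using \<epsilon> by (intro order_tendstoD) auto
  moreover have "\<forall>\<^sub>F n in sequentially. n \<ge> nat \<bar>k\<bar>" by (rule eventually_ge_at_top)
  ultimately have "\<forall>\<^sub>F n in sequentially. integral {0..T} (\<eta> n) < \<epsilon> \<and> n \<ge> nat \<bar>k\<bar>" by (rule eventually_conj)
  then obtain n where n: "integral {0..T} (\<eta> n) < \<epsilon>" "n \<ge> nat \<bar>k\<bar>"
    using eventually_happens'[OF sequentially_bot] by blast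
  have "k \<in> freq n" using n(2) k by (auto simp: freq_def nonzero_def nat_le_iff)
  moreover have "forced_kdv T n (\<eta> n) x" "forced_kdv T n (\<eta> n) y"
    using kdv_sol_forced[OF x M(1) \<eta>0(3)] kdv_sol_forced[OF y M(2) \<eta>0(4)] by blast+
  ultimately show "\<exists>n \<eta>. k \<in> freq n \<and> bmeas T \<eta> \<and> (\<forall>t\<in>{0..T}. 0 \<le> \<eta> t) \<and> integral {0..T} \<eta> \<le> \<epsilon> \<and> forced_kdv T n \<eta> x \<and> forced_kdv T n \<eta> y"
    using n(1) \<eta> \<eta>0(1) by (intro exI[of _ n] exI[of _ "\<eta> n"]) auto
qed (auto simp: nonzero_def)

text \<open>Clamping the argument extends \<open>f\<close> continuously to the line. The sublevel
  set is then closed, so an almost everywhere bound fills the open interval, and taking the closure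
  adds the endpoints.\<close>

lemma AE_le_continuous:
  fixes f :: "real \<Rightarrow> real"
  assumes T: "T > 0" and f: "continuous_on {0..T} f" and AE: "AE t in lebesgue_on {0..T}. f t \<le> C" and t: "t \<in> {0..T}"
  shows "f t \<le> C"
proof -
  define g where "g t = f (max 0 (min T t))" for t
  have g: "continuous_on UNIV g"
    unfolding g_def using T by (intro continuous_on_compose2[OF f] continuous_intros) auto
  have "x \<in> {x. g x \<le> C}" if "x \<in> {0<..<T}" for x
  proof (rule mem_closed_if_AE_lebesgue_open[of "{0<..<T}"])
    show "closed {x. g x \<le> C}" using g by (intro closed_Collect_le continuous_on_const)
    have "AE x in lebesgue. x \<in> {0..T} \<longrightarrow> f x \<le> C"
      using AE by (subst (asm) AE_restrict_space_iff) auto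
    then show "AE x \<in> {0<..<T} in lebesgue. x \<in> {x. g x \<le> C}"
      by eventually_elim (auto simp: g_def max_def min_def)
  qed (use that in auto)
  then have "g ` closure {0<..<T} \<subseteq> {..C}"
    using g by (intro image_closure_subset) (auto intro: continuous_on_subset)
  then have "g t \<le> C" using t T by (auto simp: closure_greaterThanLessThan image_subset_iff)
  moreover have "max 0 (min T t) = t" using t by auto
  ultimately show ?thesis by (simp add: g_def)
qed

text \<open>By the integral equation each coefficient is continuous in time. The norm of a finite
  section is therefore continuous too, and its almost everywhere bound holds at every time; the
  bound \<open>C\<close> is the same for all sections.\<close>

lemma is_solution_kdv_sol:
  assumes T: "T > 0" and w: "is_solution T v0 w"
  shows "kdv_sol T w" "\<And>k. k \<noteq> 0 \<Longrightarrow> w 0 k = v0 k"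
proof -
  obtain C where C: "AE t in lebesgue_on {0..T}. in_Hs 0 (w t) \<and> Hs_norm 0 (w t) \<le> C"
    using w unfolding is_solution_def by blast
  have int: "set_integrable lebesgue {0..T} (\<lambda>\<tau>. kdv_rhs (w \<tau>) \<tau> k)" if "k \<noteq> 0" for k
    using w that T unfolding is_solution_def by auto
  have eq: "w t k = v0 k + \<i> / 2 * of_int k * integral {0..t} (\<lambda>\<tau>. kdv_rhs (w \<tau>) \<tau> k)" if "k \<noteq> 0" "t \<in> {0..T}" for k t
  proof -
    have "set_integrable lebesgue {0..t} (\<lambda>\<tau>. kdv_rhs (w \<tau>) \<tau> k)"
      "w t k - v0 k = 1/2 * \<i> * of_int k * (LINT \<tau>:{0..t}|lebesgue. kdv_rhs (w \<tau>) \<tau> k)"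
      using w that unfolding is_solution_def by auto
    then have "w t k = v0 k + 1/2 * \<i> * of_int k * integral {0..t} (\<lambda>\<tau>. kdv_rhs (w \<tau>) \<tau> k)"
      by (metis add.commute diff_add_cancel set_lebesgue_integral_eq_integral(2))
    then show ?thesis by simp
  qed
  show init: "w 0 k = v0 k" if "k \<noteq> 0" for k using eq[OF that, of 0] T by simp
  have cont: "continuous_on {0..T} (\<lambda>t. w t k)" if "k \<noteq> 0" for k
  proof -
    have "continuous_on {0..T} (\<lambda>t. integral {0..t} (\<lambda>\<tau>. kdv_rhs (w \<tau>) \<tau> k))"
      using set_lebesgue_integral_eq_integral(1)[OF int[OF that]] by (rule indefinite_integral_continuous_1)
    then have "continuous_on {0..T} (\<lambda>t. v0 k + \<i> / 2 * of_int k * integral {0..t} (\<lambda>\<tau>. kdv_rhs (w \<tau>) \<tau> k))"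
      by (intro continuous_intros)
    then show ?thesis using eq[OF that] by (subst continuous_on_cong[OF refl]) auto
  qed
  have M: "l2bd (\<lambda>k. cmod (w t k)) C" if t: "t \<in> {0..T}" for t
    unfolding l2bd_def
  proof (intro allI impI, elim conjE)
    fix F :: "int set" assume F: "finite F" "0 \<notin> F"
    show "L2_set (\<lambda>k. cmod (w t k)) F \<le> C"
    proof (rule AE_le_continuous[OF T _ _ t])
      show "continuous_on {0..T} (\<lambda>t. L2_set (\<lambda>k. cmod (w t k)) F)"
        unfolding L2_set_def using F by (intro continuous_intros cont) metis
      show "AE t in lebesgue_on {0..T}. L2_set (\<lambda>k. cmod (w t k)) F \<le> C"
        using C
      proof eventually_elim
        fix t assume t: "in_Hs 0 (w t) \<and> Hs_norm 0 (w t) \<le> C"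
        then have "l2bd (\<lambda>k. hw 0 k * cmod (w t k)) C"
          unfolding in_Hs_def by (blast intro: l2bd_mono[OF Hs_l2bd])
        then show "L2_set (\<lambda>k. cmod (w t k)) F \<le> C"
          unfolding l2bd_hw0_iff using F by (rule l2bdD)
      qed
    qed
  qed
  have "prim T (\<lambda>t. w t k) (\<lambda>t. \<i> / 2 * of_int k * kdv_rhs (w t) t k)" if k: "k \<noteq> 0" for k
  proof (rule primI)
    have "(\<lambda>\<tau>. kdv_rhs (w \<tau>) \<tau> k) \<in> borel_measurable (lebesgue_on {0..T})"
      using int[OF k] unfolding set_integrable_def by (simp add: integrable_restrict_space[symmetric] borel_measurable_integrable)
    moreover have "cmod (kdv_rhs (w \<tau>) \<tau> k) \<le> C * C" if "\<tau> \<in> {0..T}" for \<tau>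
      using kdv_rhs_bound(2)[OF M[OF that]] .
    ultimately have "bmeas T (\<lambda>\<tau>. kdv_rhs (w \<tau>) \<tau> k)" unfolding bmeas_def by blast
    then show "bmeas T (\<lambda>t. \<i> / 2 * of_int k * kdv_rhs (w t) t k)" by (rule bmeas_cmult)
    fix t assume "t \<in> {0..T}"
    from eq[OF k this] show "w t k = w 0 k + integral {0..t} (\<lambda>t. \<i> / 2 * of_int k * kdv_rhs (w t) t k)"
      using init[OF k] by simp
  qed
  then show "kdv_sol T w" using M by (intro kdv_solI)
qed

section \<open>Galerkin approximations\<close>

definition gal_rhs :: "nat \<Rightarrow> (int \<Rightarrow> complex) \<Rightarrow> real \<Rightarrow> int \<Rightarrow> complex" where
  "gal_rhs n x t k = \<i> / 2 * of_int k * quad (freq n) x t k"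

definition real_seq :: "(int \<Rightarrow> complex) \<Rightarrow> bool" where
  "real_seq v \<longleftrightarrow> (\<forall>k. k \<noteq> 0 \<longrightarrow> v (- k) = cnj (v k))"

lemma real_seqD: "real_seq v \<Longrightarrow> k \<noteq> 0 \<Longrightarrow> v (- k) = cnj (v k)"
  unfolding real_seq_def by blast

lemma freq_uminus: "- k \<in> freq n \<longleftrightarrow> k \<in> freq n"
  by (auto simp: freq_def)

lemma cnj_osc: "cnj (osc j t) = osc (- j) t"
  by (simp add: osc_def cis_cnj)

text \<open>The quadratic phase is odd under a simultaneous change of sign of \<open>k\<close> and
  \<open>a\<close>, and so is the factor \<open>k\<close>, whose sign compensates the conjugation of
  \<open>\<i>\<close>.\<close>

lemma gal_rhs_real: assumes "real_seq x" shows "gal_rhs n x t (- k) = cnj (gal_rhs n x t k)"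
proof -
  have "quad (freq n) x t (- k) = (\<Sum>a\<in>pairs (freq n) k. osc ((- k) * (- a) * (- k - (- a))) t * (x (- a) * x (- k - (- a))))"
    unfolding quad_def
    by (rule sum.reindex_bij_witness[where i = uminus and j = uminus]) (auto simp: pairs_def freq_def)
  also have "\<dots> = (\<Sum>a\<in>pairs (freq n) k. osc (- (k * a * (k - a))) t * (x (- a) * x (- (k - a))))"
    by (simp add: algebra_simps)
  also have "\<dots> = cnj (quad (freq n) x t k)"
    unfolding quad_def cnj_sum complex_cnj_mult cnj_osc
    by (intro sum.cong refl arg_cong2[of _ _ _ _ "(*)"] real_seqD[OF assms]) (auto simp: pairs_def freq_def)
  finally show ?thesis unfolding gal_rhs_def by simp
qed

lemma continuous_quad:
  assumes "\<And>j. j \<in> freq n \<Longrightarrow> continuous_on S (\<lambda>t. x t j)"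
  shows "continuous_on S (\<lambda>t. gal_rhs n (x t) t k)"
  unfolding gal_rhs_def quad_def osc_def using assms
  by (intro continuous_intros) (auto simp: pairs_def)

lemma card_freq: "card (freq n) \<le> 2 * n + 1"
proof -
  have "card (freq n) \<le> card {- int n..int n}"
    by (rule card_mono) (auto simp: freq_def)
  then show ?thesis by simp
qed

text \<open>A crude bound by the number of pairs. Its growth in \<open>n\<close> is harmless, since
  it only serves the solvability of each single truncated system.\<close>

lemma quad_diff_le:
  assumes "\<And>j. cmod (x j) \<le> R" "\<And>j. cmod (y j) \<le> R" "\<And>j. cmod (x j - y j) \<le> d"
  shows "cmod (quad (freq n) x t k - quad (freq n) y t k) \<le> (2 * real n + 1) * (2 * R * d)"
proof -
  have R: "0 \<le> R" "0 \<le> d" using assms(1)[of 0] assms(3)[of 0] norm_ge_zero order_trans by blast+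
  have "cmod (quad (freq n) x t k - quad (freq n) y t k) \<le> (\<Sum>a\<in>pairs (freq n) k. 2 * R * d)"
    unfolding quad_def sum_subtractf[symmetric] right_diff_distrib[symmetric]
  proof (rule sum_norm_le)
    fix a
    have "x a * x (k - a) - y a * y (k - a) = (x a - y a) * x (k - a) + y a * (x (k - a) - y (k - a))"
      by (simp add: algebra_simps)
    then have "cmod (x a * x (k - a) - y a * y (k - a)) \<le> cmod (x a - y a) * cmod (x (k - a)) + cmod (y a) * cmod (x (k - a) - y (k - a))"
      by (metis norm_mult norm_triangle_ineq)
    also have "\<dots> \<le> d * R + R * d"
      using assms R by (intro add_mono mult_mono) auto
    also have "\<dots> = 2 * R * d" by simp
    finally show "cmod (osc (k * a * (k - a)) t * (x a * x (k - a) - y a * y (k - a))) \<le> 2 * R * d"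
      unfolding norm_mult[of "osc (k * a * (k - a)) t"] norm_osc mult_1_left .
  qed
  also have "\<dots> \<le> (2 * real n + 1) * (2 * R * d)"
  proof -
    have "card (pairs (freq n) k) \<le> card (freq n)"
      using finite_freq by (intro card_mono) (auto simp: pairs_def)
    then have "real (card (pairs (freq n) k)) \<le> 2 * real n + 1" using card_freq[of n] by linarith
    then show ?thesis using R by (simp add: mult_right_mono)
  qed
  finally show ?thesis .
qed

text \<open>Slices over one frequency are open because \<open>int\<close> is discrete. This permits
  a whole system to be treated as one bounded continuous function of time and frequency.\<close>

lemma continuous_on_prod_int:
  fixes f :: "real \<times> int \<Rightarrow> complex"
  assumes "\<And>k. continuous_on UNIV (\<lambda>t. f (t, k))" shows "continuous_on UNIV f"
proof -
  have "continuous_on (\<Union>k. UNIV \<times> {k::int}) f"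
  proof (rule continuous_on_open_Union)
    fix S :: "(real \<times> int) set" assume "S \<in> range (\<lambda>k. UNIV \<times> {k::int})"
    then obtain k where S: "S = UNIV \<times> {k}" by blast
    show "open S" unfolding S by (intro open_Times open_discrete open_UNIV)
    have "continuous_on S (\<lambda>z. f (fst z, k))"
      by (rule continuous_on_compose2[OF assms continuous_on_fst[OF continuous_on_id]]) auto
    then show "continuous_on S f" unfolding S by (rule continuous_on_eq) auto
  qed
  moreover have "(\<Union>k. UNIV \<times> {k::int}) = (UNIV :: (real \<times> int) set)" by auto
  ultimately show ?thesis by simp
qed

text \<open>The library has completeness of \<open>\<Rightarrow>\<^sub>C\<close> only over metric domains, and \<open>int\<close> is not declared as one.\<close>

lemma Cauchy_bcontfun_convergent:
  fixes u :: "nat \<Rightarrow> ('a::topological_space \<Rightarrow>\<^sub>C complex)"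
  assumes "Cauchy u" shows "\<exists>l. u \<longlonglongrightarrow> l"
proof -
  have "\<exists>N. \<forall>m\<ge>N. \<forall>n\<ge>N. \<forall>z. dist (u m z) (u n z) < e" if "e > 0" for e
    using assms that unfolding Cauchy_def by (meson dist_fun_lt_imp_dist_val_lt)
  then obtain g where "uniform_limit UNIV (\<lambda>n. apply_bcontfun (u n)) g sequentially"
    using uniformly_convergent_eq_cauchy[of "\<lambda>_. True" "\<lambda>n. apply_bcontfun (u n)"]
    unfolding uniform_limit_sequentially_iff by (metis (no_types, lifting))
  from uniform_limit_bcontfunE[OF this sequentially_bot] show ?thesis by metis
qed

text \<open>Picard iteration for a system on finitely many frequencies. The step \<open>h\<close>
  depends on \<open>M\<close> and \<open>n\<close> but not on the starting time or the data, so it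
  can be repeated as long as the bound \<open>M\<close> persists.\<close>

lemma galerkin_local:
  assumes M: "M \<ge> 0"
  shows "\<exists>h>0. \<forall>s a. (\<forall>k. cmod (a k) \<le> M) \<and> (\<forall>k. k \<notin> freq n \<longrightarrow> a k = 0) \<and> real_seq a \<longrightarrow>
    (\<exists>x. (\<forall>k. continuous_on {s..s+h} (\<lambda>t. x t k)) \<and> (\<forall>t k. k \<notin> freq n \<longrightarrow> x t k = 0) \<and> (\<forall>t. real_seq (x t)) \<and>
      (\<forall>t\<in>{s..s+h}. \<forall>k\<in>freq n. x t k = a k + integral {s..t} (\<lambda>\<tau>. gal_rhs n (x \<tau>) \<tau> k)))"
proof -
  \<comment> \<open>The ball has room 1 beyond the data for the integral term. On it,
    \<open>c\<close> is a Lipschitz constant of the right-hand side: number of pairs, times a bound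
    for the frequency factor, times \<open>2 * R\<close> from a difference of products.\<close>
  define R where "R = M + 1"
  define c where "c = (2 * real n + 1) * (real n + 1) * (2 * R)"
  have R: "R \<ge> 1" unfolding R_def using M by simp
  have c: "c > 0" unfolding c_def using R by (intro mult_pos_pos) auto
  \<comment> \<open>\<open>c * R * h = 1 / 2\<close> keeps the integral term within the room 1, and
    as \<open>R \<ge> 1\<close> it also makes the contraction factor at most 1/2.\<close>
  define h where "h = 1 / (2 * c * R)"
  have h: "h > 0" "c * R * h = 1 / 2" unfolding h_def using c R by auto
  have ch: "c * h \<le> 1 / 2"
  proof -
    have "1 * (c * h) \<le> R * (c * h)" using h(1) c R by (intro mult_right_mono) auto
    also have "\<dots> = c * R * h" by simp
    finally show ?thesis using h(2) by simp
  qed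
  have rhs_diff: "cmod (gal_rhs n x t k - gal_rhs n y t k) \<le> c * d"
    if k: "k \<in> freq n" and xy: "\<And>j. cmod (x j) \<le> R" "\<And>j. cmod (y j) \<le> R" "\<And>j. cmod (x j - y j) \<le> d" for x y t k d
  proof -
    have d: "d \<ge> 0" using xy(3)[of 0] norm_ge_zero order_trans by blast
    have eq: "gal_rhs n x t k - gal_rhs n y t k = \<i> / 2 * of_int k * (quad (freq n) x t k - quad (freq n) y t k)"
      unfolding gal_rhs_def by (simp add: algebra_simps)
    have "cmod (gal_rhs n x t k - gal_rhs n y t k) = mag k / 2 * cmod (quad (freq n) x t k - quad (freq n) y t k)"
      unfolding eq by (simp add: norm_mult norm_divide)
    also have "\<dots> \<le> (real n + 1) * ((2 * real n + 1) * (2 * R * d))"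
      using k d R by (intro mult_mono quad_diff_le xy) (auto simp: freq_def)
    finally show ?thesis unfolding c_def by (simp add: mult_ac)
  qed
  have rhs_bound: "cmod (gal_rhs n x t k) \<le> c * R" if "k \<in> freq n" "\<And>j. cmod (x j) \<le> R" for x t k
    using rhs_diff[OF that(1), of x "\<lambda>_. 0" R t] that(2) R by (simp add: gal_rhs_def quad_def)
  show ?thesis
  proof (intro exI[of _ h] conjI h(1) allI impI, elim conjE)
    fix s :: real and a :: "int \<Rightarrow> complex"
    assume a': "\<forall>k. cmod (a k) \<le> M" "\<forall>k. k \<notin> freq n \<longrightarrow> a k = 0" and r: "real_seq a"
    have a: "\<And>k. cmod (a k) \<le> M" "\<And>k. k \<notin> freq n \<Longrightarrow> a k = 0" "real_seq a"
      using a' r by simp_all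
    \<comment> \<open>Clamping time to the step makes the iterates bounded and continuous on the
      whole line, so that they live in a space of bounded continuous functions.\<close>
    define cl where "cl t = max s (min (s + h) t)" for t :: real
    have cl: "cl t \<in> {s..s+h}" "t \<in> {s..s+h} \<Longrightarrow> cl t = t" for t
      unfolding cl_def using h(1) by auto
    have cl_cont: "continuous_on UNIV cl" unfolding cl_def by (intro continuous_intros)
    let ?r = "\<lambda>(u :: (real \<times> int) \<Rightarrow>\<^sub>C complex) \<tau>. \<lambda>j. apply_bcontfun u (\<tau>, j)"
    define \<Psi> where "\<Psi> u = (\<lambda>(t,k). if k \<in> freq n then a k + integral {s..cl t} (\<lambda>\<tau>. gal_rhs n (?r u \<tau>) \<tau> k) else 0)"
      for u :: "(real \<times> int) \<Rightarrow>\<^sub>C complex"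
    \<comment> \<open>The reality condition is closed and preserved by the iteration, so it is built
      into the set and the fixed point satisfies it at once.\<close>
    define X where "X = {u :: (real \<times> int) \<Rightarrow>\<^sub>C complex. (\<forall>z. cmod (apply_bcontfun u z) \<le> R) \<and> (\<forall>t. real_seq (?r u t))}"
    have u_cont: "continuous_on S (\<lambda>t. ?r u t j)" for u S j
      by (rule continuous_on_compose2[OF continuous_on_apply_bcontfun[of UNIV]]) (auto intro!: continuous_intros)
    have int: "(\<lambda>\<tau>. gal_rhs n (?r u \<tau>) \<tau> k) integrable_on {s..t}" for u k t
      by (intro integrable_continuous_interval continuous_quad u_cont)
    have \<Psi>_bound: "cmod (\<Psi> u z) \<le> R" if u: "u \<in> X" for u z
    proof (cases z)
      case (Pair t k)
      show ?thesis
      proof (cases "k \<in> freq n")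
        case True
        have "cmod (integral {s..cl t} (\<lambda>\<tau>. gal_rhs n (?r u \<tau>) \<tau> k)) \<le> integral {s..cl t} (\<lambda>\<tau>. c * R)"
          using u True by (intro integral_norm_bound_integral int rhs_bound) (auto simp: X_def)
        also have "\<dots> \<le> c * R * h" using cl(1)[of t] c R by (auto simp: mult.commute intro!: mult_left_mono)
        finally have "cmod (integral {s..cl t} (\<lambda>\<tau>. gal_rhs n (?r u \<tau>) \<tau> k)) \<le> 1" using h(2) by linarith
        then have "cmod (a k + integral {s..cl t} (\<lambda>\<tau>. gal_rhs n (?r u \<tau>) \<tau> k)) \<le> M + 1"
          using a(1)[of k] by (intro order_trans[OF norm_triangle_ineq] add_mono)
        then show ?thesis using True by (simp add: Pair \<Psi>_def R_def)
      qed (use R in \<open>simp add: Pair \<Psi>_def\<close>)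
    qed
    have \<Psi>_in: "\<Psi> u \<in> bcontfun" if u: "u \<in> X" for u
      unfolding bcontfun_def
    proof (intro CollectI conjI)
      show "bounded (range (\<Psi> u))" using \<Psi>_bound[OF u] by (auto simp: bounded_iff)
      show "continuous_on UNIV (\<Psi> u)"
      proof (rule continuous_on_prod_int)
        fix k
        have "continuous_on {s..s+h} (\<lambda>t. integral {s..t} (\<lambda>\<tau>. gal_rhs n (?r u \<tau>) \<tau> k))"
          by (intro indefinite_integral_continuous_1 int)
        then have "continuous_on UNIV (\<lambda>t. integral {s..cl t} (\<lambda>\<tau>. gal_rhs n (?r u \<tau>) \<tau> k))"
          using cl by (intro continuous_on_compose2[OF _ cl_cont]) auto
        then show "continuous_on UNIV (\<lambda>t. \<Psi> u (t, k))"
          by (cases "k \<in> freq n") (auto simp: \<Psi>_def intro!: continuous_intros)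
      qed
    qed
    define \<Phi> where "\<Phi> u = Bcontfun (\<Psi> u)" for u
    have \<Phi>: "apply_bcontfun (\<Phi> u) = \<Psi> u" if "u \<in> X" for u
      unfolding \<Phi>_def using \<Psi>_in[OF that] by (rule Bcontfun_inverse)
    have real: "real_seq (\<lambda>k. \<Psi> u (t, k))" if u: "u \<in> X" for u t
      unfolding real_seq_def
    proof (intro allI impI)
      fix k :: int assume k: "k \<noteq> 0"
      have "integral {s..cl t} (\<lambda>\<tau>. gal_rhs n (?r u \<tau>) \<tau> (- k)) = integral {s..cl t} (\<lambda>\<tau>. cnj (gal_rhs n (?r u \<tau>) \<tau> k))"
        using u by (simp add: gal_rhs_real X_def)
      then show "\<Psi> u (t, - k) = cnj (\<Psi> u (t, k))"
        using real_seqD[OF a(3) k] by (simp add: \<Psi>_def freq_uminus integral_cnj)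
    qed
    have "\<exists>!u\<in>X. \<Phi> u = u"
    proof (rule Banach_fix[where c = "1/2"])
      show "complete X"
        unfolding complete_def
      proof (intro allI impI, elim conjE)
        fix u assume u: "\<forall>i. u i \<in> X" and "Cauchy u"
        then obtain l where lim: "u \<longlonglongrightarrow> l" using Cauchy_bcontfun_convergent by blast
        have p: "(\<lambda>i. apply_bcontfun (u i) z) \<longlonglongrightarrow> apply_bcontfun l z" for z
          using tendsto_bcontfun_uniform_limit[OF lim] by (rule tendsto_uniform_limitI) simp
        have "cmod (apply_bcontfun (u i) z) \<le> R" for i z
          using u unfolding X_def by blast
        then have "cmod (apply_bcontfun l z) \<le> R" for z
          by (intro LIMSEQ_le_const2[OF tendsto_norm[OF p[of z]]] exI allI impI)
        moreover have "apply_bcontfun l (t, - k) = cnj (apply_bcontfun l (t, k))" if "k \<noteq> 0" for t k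
        proof (rule LIMSEQ_unique[OF p])
          have "(\<lambda>i. cnj (apply_bcontfun (u i) (t, k))) \<longlonglongrightarrow> cnj (apply_bcontfun l (t, k))"
            by (intro tendsto_intros p)
          moreover have "apply_bcontfun (u i) (t, - k) = cnj (apply_bcontfun (u i) (t, k))" for i
            using u that unfolding X_def real_seq_def by blast
          ultimately show "(\<lambda>i. apply_bcontfun (u i) (t, - k)) \<longlonglongrightarrow> cnj (apply_bcontfun l (t, k))" by simp
        qed
        ultimately have "l \<in> X" unfolding X_def real_seq_def by blast
        with lim show "\<exists>l\<in>X. u \<longlonglongrightarrow> l" by blast
      qed
      have "const_bcontfun 0 \<in> X" using R by (simp add: X_def real_seq_def const_bcontfun.rep_eq)
      then show "X \<noteq> {}" by blast
      show "\<Phi> ` X \<subseteq> X" using \<Phi> \<Psi>_bound real by (auto simp: X_def)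
      fix u w assume u: "u \<in> X" and w: "w \<in> X"
      show "dist (\<Phi> u) (\<Phi> w) \<le> 1 / 2 * dist u w"
      proof (rule dist_bound)
        fix z :: "real \<times> int"
        obtain t k where z: "z = (t, k)" by (cases z)
        show "dist (apply_bcontfun (\<Phi> u) z) (apply_bcontfun (\<Phi> w) z) \<le> 1 / 2 * dist u w"
        proof (cases "k \<in> freq n")
          case True
          have "\<Psi> u z - \<Psi> w z = integral {s..cl t} (\<lambda>\<tau>. gal_rhs n (?r u \<tau>) \<tau> k) - integral {s..cl t} (\<lambda>\<tau>. gal_rhs n (?r w \<tau>) \<tau> k)"
            using True by (simp add: \<Psi>_def z)
          also have "\<dots> = integral {s..cl t} (\<lambda>\<tau>. gal_rhs n (?r u \<tau>) \<tau> k - gal_rhs n (?r w \<tau>) \<tau> k)"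
            by (intro Henstock_Kurzweil_Integration.integral_diff[symmetric] int)
          also have "cmod \<dots> \<le> integral {s..cl t} (\<lambda>\<tau>. c * dist u w)"
          proof (intro integral_norm_bound_integral integrable_diff int rhs_diff True)
            show "cmod (?r u \<tau> j) \<le> R" "cmod (?r w \<tau> j) \<le> R" for \<tau> j using u w by (auto simp: X_def)
            show "cmod (?r u \<tau> j - ?r w \<tau> j) \<le> dist u w" for \<tau> j
              using dist_bounded[of u "(\<tau>, j)" w] by (simp add: dist_norm)
          qed auto
          also have "\<dots> = c * (cl t - s) * dist u w" using cl(1)[of t] by (simp add: mult_ac)
          also have "\<dots> \<le> c * h * dist u w" using cl(1)[of t] c by (intro mult_right_mono mult_left_mono) auto
          also have "\<dots> \<le> 1 / 2 * dist u w" using ch by (intro mult_right_mono) auto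
          finally show ?thesis using \<Phi> u w by (simp add: dist_norm)
        next
          case False
          then have "\<Psi> u z = \<Psi> w z" by (simp add: \<Psi>_def z)
          then show ?thesis using \<Phi> u w by simp
        qed
      qed
    qed auto
    then obtain u where u: "u \<in> X" "\<Phi> u = u" by blast
    have eq: "?r u t k = \<Psi> u (t, k)" for t k using \<Phi>[OF u(1)] u(2) by metis
    show "\<exists>x. (\<forall>k. continuous_on {s..s+h} (\<lambda>t. x t k)) \<and> (\<forall>t k. k \<notin> freq n \<longrightarrow> x t k = 0) \<and> (\<forall>t. real_seq (x t)) \<and>
      (\<forall>t\<in>{s..s+h}. \<forall>k\<in>freq n. x t k = a k + integral {s..t} (\<lambda>\<tau>. gal_rhs n (x \<tau>) \<tau> k))"
    proof (intro exI[of _ "?r u"] conjI allI ballI impI)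
      show "continuous_on {s..s+h} (\<lambda>t. ?r u t k)" for k by (rule u_cont)
      show "?r u t k = 0" if "k \<notin> freq n" for t k using that by (simp add: eq \<Psi>_def)
      show "real_seq (?r u t)" for t using u(1) by (simp add: X_def)
      show "?r u t k = a k + integral {s..t} (\<lambda>\<tau>. gal_rhs n (?r u \<tau>) \<tau> k)" if "t \<in> {s..s+h}" "k \<in> freq n" for t k
        using that cl(2)[OF that(1)] by (subst eq) (simp add: \<Psi>_def)
    qed
  qed
qed

section \<open>Energy conservation and global Galerkin solutions\<close>

definition galerkin :: "real \<Rightarrow> nat \<Rightarrow> (int \<Rightarrow> complex) \<Rightarrow> (real \<Rightarrow> int \<Rightarrow> complex) \<Rightarrow> bool" where
  "galerkin T n a x \<longleftrightarrow> (\<forall>k\<in>freq n. prim T (\<lambda>t. x t k) (\<lambda>t. gal_rhs n (x t) t k)) \<and>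
     (\<forall>t k. k \<notin> freq n \<longrightarrow> x t k = 0) \<and> (\<forall>t\<in>{0..T}. real_seq (x t)) \<and> (\<forall>k\<in>freq n. x 0 k = a k)"

text \<open>The energy flux is \<open>\<Sum> c w(a,b,c)\<close> over \<open>a + b + c = 0\<close> with \<open>w\<close> symmetric, so three times it
  is \<open>\<Sum> (a + b + c) w(a,b,c) = 0\<close>.\<close>

lemma energy_flux_zero:
  "(\<Sum>k\<in>freq n. gal_rhs n x t k * x (- k)) = 0"
proof -
  let ?A = "freq n"
  define P where "P = {(a,b,c). a \<in> ?A \<and> b \<in> ?A \<and> c \<in> ?A \<and> a + b + c = 0}"
  define w where "w = (\<lambda>(a,b,c). osc (- (a * b * c)) t * (x a * (x b * x c)))"
  define f where "f i = (\<Sum>p\<in>P. of_int (i p) * w p)" for i :: "int \<times> int \<times> int \<Rightarrow> int"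
  have "(\<Sum>k\<in>?A. gal_rhs n x t k * x (- k)) = (\<Sum>k\<in>?A. \<Sum>a\<in>pairs ?A k. \<i> / 2 * of_int k * (osc (k * a * (k - a)) t * (x a * (x (k - a) * x (- k)))))"
    unfolding gal_rhs_def quad_def by (simp add: sum_distrib_left sum_distrib_right mult_ac)
  also have "\<dots> = (\<Sum>(k,a)\<in>Sigma ?A (pairs ?A). \<i> / 2 * of_int k * (osc (k * a * (k - a)) t * (x a * (x (k - a) * x (- k)))))"
    by (subst sum.Sigma) (auto simp: finite_freq finite_pairs)
  \<comment> \<open>With \<open>b = k - a\<close> and \<open>c = - k\<close> the phase is
    \<open>- (a * b * c)\<close>; the derivative factor \<open>k = - c\<close> is then the only
    asymmetric part of the summand.\<close>
  also have "\<dots> = (\<Sum>p\<in>P. - (\<i> / 2) * (of_int (snd (snd p)) * w p))"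
  proof (rule sum.reindex_bij_witness[where i = "\<lambda>(a,b,c). (- c, a)" and j = "\<lambda>(k,a). (a, k - a, - k)"])
    fix p assume "p \<in> P"
    moreover obtain a b c where p: "p = (a,b,c)" by (cases p)
    ultimately have abc: "a \<in> ?A" "b \<in> ?A" "c \<in> ?A" "a + b + c = 0" by (simp_all add: P_def)
    then have "b = - c - a" by linarith
    with p abc show "(case case p of (a,b,c) \<Rightarrow> (- c, a) of (k,a) \<Rightarrow> (a, k - a, - k)) = p"
      "(case p of (a,b,c) \<Rightarrow> (- c, a)) \<in> Sigma ?A (pairs ?A)"
      by (auto simp: pairs_def freq_uminus)
  qed (auto simp: P_def pairs_def freq_uminus w_def mult_ac)
  also have "\<dots> = - (\<i> / 2) * f (\<lambda>p. snd (snd p))"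
    unfolding f_def by (simp only: sum_distrib_left)
  also have "f (\<lambda>p. snd (snd p)) = 0"
  proof -
    have "f (\<lambda>p. snd (snd p)) = f fst"
      unfolding f_def
      by (rule sum.reindex_bij_witness[where i = "\<lambda>(a,b,c). (c,b,a)" and j = "\<lambda>(a,b,c). (c,b,a)"])
         (auto simp: P_def w_def algebra_simps)
    moreover have "f (\<lambda>p. snd (snd p)) = f (\<lambda>p. fst (snd p))"
      unfolding f_def
      by (rule sum.reindex_bij_witness[where i = "\<lambda>(a,b,c). (a,c,b)" and j = "\<lambda>(a,b,c). (a,c,b)"])
         (auto simp: P_def w_def algebra_simps)
    moreover have "f fst + f (\<lambda>p. fst (snd p)) + f (\<lambda>p. snd (snd p)) = (\<Sum>p\<in>P. of_int (fst p + fst (snd p) + snd (snd p)) * w p)"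
      unfolding f_def by (simp add: sum.distrib[symmetric] distrib_right)
    moreover have "\<dots> = 0" by (rule sum.neutral) (auto simp: P_def simp del: of_int_add)
    ultimately have "3 * f (\<lambda>p. snd (snd p)) = 0" by simp
    then show ?thesis by simp
  qed
  finally show ?thesis by simp
qed

text \<open>The energy is written as the sum of \<open>x k * x (- k)\<close>: this is polynomial, so
  \<open>prim_mult\<close> differentiates it, and reality turns it into a sum of squared
  moduli.\<close>

lemma galerkin_energy:
  assumes g: "galerkin T n a x" and T: "T \<ge> 0" and t: "t \<in> {0..T}"
  shows "(\<Sum>k\<in>freq n. (cmod (x t k))\<^sup>2) = (\<Sum>k\<in>freq n. (cmod (a k))\<^sup>2)"
proof -
  have p: "prim T (\<lambda>t. x t k) (\<lambda>t. gal_rhs n (x t) t k)" if "k \<in> freq n" for k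
    using g that unfolding galerkin_def by blast
  have p': "prim T (\<lambda>t. x t (- k)) (\<lambda>t. gal_rhs n (x t) t (- k))" if "k \<in> freq n" for k
    using p that by (simp add: freq_uminus)
  have "prim T (\<lambda>t. \<Sum>k\<in>freq n. x t k * x t (- k)) (\<lambda>t. \<Sum>k\<in>freq n. gal_rhs n (x t) t k * x t (- k) + x t k * gal_rhs n (x t) t (- k))"
    by (rule prim_sum) (rule prim_mult[OF p p'])
  moreover have "(\<Sum>k\<in>freq n. gal_rhs n (x t) t k * x t (- k) + x t k * gal_rhs n (x t) t (- k)) = 0" for t
  proof -
    have "(\<Sum>k\<in>freq n. x t k * gal_rhs n (x t) t (- k)) = (\<Sum>k\<in>freq n. gal_rhs n (x t) t k * x t (- k))"
      by (rule sum.reindex_bij_witness[where i = uminus and j = uminus]) (auto simp: freq_uminus mult_ac)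
    then show ?thesis by (simp add: sum.distrib energy_flux_zero)
  qed
  ultimately have "prim T (\<lambda>t. \<Sum>k\<in>freq n. x t k * x t (- k)) (\<lambda>t. 0)" by simp
  from primD[OF this t] have eq: "(\<Sum>k\<in>freq n. x t k * x t (- k)) = (\<Sum>k\<in>freq n. x 0 k * x 0 (- k))"
    by simp
  have sq: "(\<Sum>k\<in>freq n. x \<tau> k * x \<tau> (- k)) = of_real (\<Sum>k\<in>freq n. (cmod (x \<tau> k))\<^sup>2)" if "\<tau> \<in> {0..T}" for \<tau>
    unfolding of_real_sum
  proof (rule sum.cong[OF refl])
    fix k assume "k \<in> freq n"
    then have "x \<tau> (- k) = cnj (x \<tau> k)"
      using g that unfolding galerkin_def by (intro real_seqD) (auto simp: freq_def)
    then show "x \<tau> k * x \<tau> (- k) = of_real ((cmod (x \<tau> k))\<^sup>2)"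
      by (simp only: complex_norm_square)
  qed
  have "(\<Sum>k\<in>freq n. (cmod (x t k))\<^sup>2) = (\<Sum>k\<in>freq n. (cmod (x 0 k))\<^sup>2)"
    using eq sq[OF t] sq[of 0] T by (metis atLeastAtMost_iff of_real_eq_iff order_refl)
  also have "\<dots> = (\<Sum>k\<in>freq n. (cmod (a k))\<^sup>2)"
    using g unfolding galerkin_def by (intro sum.cong) auto
  finally show ?thesis .
qed

text \<open>Energy conservation keeps every coefficient below the same \<open>M\<close>, the l^2
  norm of the truncated data, so local steps of one fixed length can be glued past
  \<open>T\<close>.\<close>

lemma galerkin_exists:
  assumes a: "real_seq a" and T: "T \<ge> 0"
  shows "\<exists>x. galerkin T n a x"
proof -
  define M where "M = sqrt (\<Sum>k\<in>freq n. (cmod (a k))\<^sup>2)"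
  have M: "M \<ge> 0" unfolding M_def by (intro real_sqrt_ge_zero sum_nonneg) auto
  obtain h where h: "h > 0" and loc: "\<forall>s a. (\<forall>k. cmod (a k) \<le> M) \<and> (\<forall>k. k \<notin> freq n \<longrightarrow> a k = 0) \<and> real_seq a \<longrightarrow>
    (\<exists>x. (\<forall>k. continuous_on {s..s+h} (\<lambda>t. x t k)) \<and> (\<forall>t k. k \<notin> freq n \<longrightarrow> x t k = 0) \<and> (\<forall>t. real_seq (x t)) \<and>
      (\<forall>t\<in>{s..s+h}. \<forall>k\<in>freq n. x t k = a k + integral {s..t} (\<lambda>\<tau>. gal_rhs n (x \<tau>) \<tau> k)))"
    using galerkin_local[OF M, of n] by (elim exE conjE)
  have ex: "\<exists>x. galerkin (real j * h) n a x" for j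
  proof (induction j)
    case 0
    define x where "x k = (if k \<in> freq n then a k else 0)" for k
    have "galerkin 0 n a (\<lambda>_. x)"
      unfolding galerkin_def
    proof (intro conjI ballI allI impI)
      show "prim 0 (\<lambda>t. x k) (\<lambda>t. gal_rhs n x t k)" for k
        by (intro primI bmeas_continuous continuous_quad continuous_on_const) auto
      show "real_seq x" using a by (auto simp: real_seq_def x_def freq_uminus)
    qed (simp_all add: x_def)
    then show ?case by auto
  next
    case (Suc j)
    define s where "s = real j * h"
    have s: "s \<ge> 0" unfolding s_def using h by simp
    obtain x where x: "galerkin s n a x" using Suc unfolding s_def by blast
    note xp = x[unfolded galerkin_def]
    have bound: "cmod (x s k) \<le> M" for k
    proof (cases "k \<in> freq n")
      case True
      have "(cmod (x s k))\<^sup>2 \<le> (\<Sum>k\<in>freq n. (cmod (x s k))\<^sup>2)"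
        using True finite_freq by (intro member_le_sum) auto
      also have "\<dots> = M\<^sup>2"
        unfolding M_def using galerkin_energy[OF x s, of s] s by (simp add: sum_nonneg)
      finally show ?thesis using M by (rule power2_le_imp_le)
    next
      case False
      then show ?thesis using xp M by simp
    qed
    have "(\<forall>k. cmod (x s k) \<le> M) \<and> (\<forall>k. k \<notin> freq n \<longrightarrow> x s k = 0) \<and> real_seq (x s)"
      using bound xp s by auto
    from loc[rule_format, OF this, of s] obtain y where y: "\<And>k. continuous_on {s..s+h} (\<lambda>t. y t k)" "\<And>t k. k \<notin> freq n \<Longrightarrow> y t k = 0"
      "\<And>t. real_seq (y t)" "\<And>t k. t \<in> {s..s+h} \<Longrightarrow> k \<in> freq n \<Longrightarrow> y t k = x s k + integral {s..t} (\<lambda>\<tau>. gal_rhs n (y \<tau>) \<tau> k)"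
      by blast
    define z where "z t = (if t \<le> s then x t else y t)" for t
    have ys: "y s k = x s k" for k
      using y(4)[of s k] y(2)[of k s] xp h by (cases "k \<in> freq n") auto
    have zy: "z t = y t" if "t \<in> {s..s+h}" for t
      using that ys by (auto simp: z_def fun_eq_iff)
    have zc: "continuous_on {0..s+h} (\<lambda>t. z t k)" if k: "k \<in> freq n" for k
    proof -
      have "continuous_on {0..s} (\<lambda>t. z t k)"
        by (rule continuous_on_eq[OF prim_continuous[of s "\<lambda>t. x t k"]]) (use xp k in \<open>auto simp: z_def\<close>)
      moreover have "continuous_on {s..s+h} (\<lambda>t. z t k)"
        using zy by (intro continuous_on_eq[OF y(1)[of k]]) auto
      ultimately have "continuous_on ({0..s} \<union> {s..s+h}) (\<lambda>t. z t k)"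
        by (intro continuous_on_closed_Un) auto
      moreover have "{0..s} \<union> {s..s+h} = {0..s+h}" using s h by auto
      ultimately show ?thesis by simp
    qed
    have "prim (s + h) (\<lambda>t. z t k) (\<lambda>t. gal_rhs n (z t) t k)" if k: "k \<in> freq n" for k
    proof (rule primI)
      show bm: "bmeas (s + h) (\<lambda>t. gal_rhs n (z t) t k)"
        by (intro bmeas_continuous continuous_quad zc)
      fix t assume t: "t \<in> {0..s+h}"
      have low: "z t k = z 0 k + integral {0..t} (\<lambda>t. gal_rhs n (z t) t k)" if "t \<in> {0..s}" for t
      proof -
        have "x t k = x 0 k + integral {0..t} (\<lambda>t. gal_rhs n (x t) t k)"
          using primD[OF bspec[OF conjunct1[OF xp] k] that] .
        also have "integral {0..t} (\<lambda>t. gal_rhs n (x t) t k) = integral {0..t} (\<lambda>t. gal_rhs n (z t) t k)"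
          using that by (intro Henstock_Kurzweil_Integration.integral_cong) (auto simp: z_def)
        finally show ?thesis using that s by (simp add: z_def)
      qed
      show "z t k = z 0 k + integral {0..t} (\<lambda>t. gal_rhs n (z t) t k)"
      proof (cases "t \<le> s")
        case True
        then show ?thesis using t by (intro low) auto
      next
        case False
        then have ts: "t \<in> {s..s+h}" using t by auto
        have "y t k = x s k + integral {s..t} (\<lambda>\<tau>. gal_rhs n (y \<tau>) \<tau> k)" by (rule y(4)[OF ts k])
        also have "integral {s..t} (\<lambda>\<tau>. gal_rhs n (y \<tau>) \<tau> k) = integral {s..t} (\<lambda>\<tau>. gal_rhs n (z \<tau>) \<tau> k)"
          using ts zy by (intro Henstock_Kurzweil_Integration.integral_cong) auto
        also have "x s k = z 0 k + integral {0..s} (\<lambda>t. gal_rhs n (z t) t k)"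
          using low[of s] s by (simp add: z_def)
        also have "z 0 k + integral {0..s} (\<lambda>t. gal_rhs n (z t) t k) + integral {s..t} (\<lambda>\<tau>. gal_rhs n (z \<tau>) \<tau> k)
           = z 0 k + integral {0..t} (\<lambda>t. gal_rhs n (z t) t k)"
          unfolding add.assoc using ts s bmeas_integrable[OF bm, of 0 t]
          by (subst Henstock_Kurzweil_Integration.integral_combine) auto
        finally show ?thesis using zy[OF ts] by simp
      qed
    qed
    moreover have "real_seq (z t)" if "t \<in> {0..s+h}" for t
      using xp y(3) that by (auto simp: z_def)
    ultimately have "galerkin (s + h) n a z"
      unfolding galerkin_def using xp y(2) s by (auto simp: z_def)
    moreover have "s + h = real (Suc j) * h" unfolding s_def by (simp add: algebra_simps)
    ultimately show ?case by metis
  qed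
  obtain j :: nat where j: "T \<le> real j * h"
    using ex_less_of_nat_mult[OF h, of T] by (metis less_imp_le)
  obtain x where x: "galerkin (real j * h) n a x" using ex by blast
  have "prim T (\<lambda>t. x t k) (\<lambda>t. gal_rhs n (x t) t k)" if "k \<in> freq n" for k
  proof -
    have c: "continuous_on {0..real j * h} (\<lambda>t. x t k)" if "k \<in> freq n" for k
      by (rule prim_continuous[OF bspec[OF conjunct1[OF x[unfolded galerkin_def]] that]])
    have "continuous_on {0..T} (\<lambda>t. gal_rhs n (x t) t k)"
      using j by (intro continuous_quad continuous_on_subset[OF c]) auto
    moreover have "x t k = x 0 k + integral {0..t} (\<lambda>t. gal_rhs n (x t) t k)" if "t \<in> {0..T}" for t
      using x \<open>k \<in> freq n\<close> that j unfolding galerkin_def by (intro primD[of "real j * h" "\<lambda>t. x t k"]) auto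
    ultimately show ?thesis by (intro primI bmeas_continuous)
  qed
  then show ?thesis
    using x j unfolding galerkin_def by (intro exI[of _ x]) auto
qed

text \<open>A Galerkin solution satisfies its truncated system exactly, so zero forcing at the
  single level \<open>n\<close> serves every accuracy.\<close>

lemma galerkin_pair:
  assumes "galerkin T n a x" "T \<ge> 0" shows "kdv_pair T (freq n) x (\<lambda>_ _. 0)"
  unfolding kdv_pair_def
proof (intro conjI ballI allI impI)
  fix k :: int and \<epsilon> :: real assume "k \<in> freq n" "\<epsilon> > 0"
  have "forced_kdv T n (\<lambda>_. 0) x"
    unfolding forced_kdv_def
    by (intro exI[of _ "\<lambda>k t. gal_rhs n (x t) t k"] exI[of _ "\<lambda>_ _. 0"])
       (use assms in \<open>auto simp: galerkin_def gal_rhs_def\<close>)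
  moreover have "forced_kdv T n (\<lambda>_. 0) (\<lambda>_ _. 0)"
    unfolding forced_kdv_def
    by (intro exI[of _ "\<lambda>_ _. 0"]) (auto simp: quad_def prim_const)
  ultimately show "\<exists>m \<eta>. k \<in> freq m \<and> bmeas T \<eta> \<and> (\<forall>t\<in>{0..T}. 0 \<le> \<eta> t) \<and> integral {0..T} \<eta> \<le> \<epsilon> \<and> forced_kdv T m \<eta> x \<and> forced_kdv T m \<eta> (\<lambda>_ _. 0)"
    using \<open>k \<in> freq n\<close> \<open>\<epsilon> > 0\<close> by (intro exI[of _ n] exI[of _ "\<lambda>_. 0"]) (auto intro: bmeas_const)
qed (use assms zero_notin_freq in \<open>auto simp: galerkin_def\<close>)

section \<open>Well-posedness\<close>

lemma l2bd_cong: "(\<And>k. k \<noteq> 0 \<Longrightarrow> f k = g k) \<Longrightarrow> l2bd f B \<longleftrightarrow> l2bd g B"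
  unfolding l2bd_def by (metis L2_set_cong)

lemma l2bd_tendsto:
  assumes "\<And>k. k \<noteq> 0 \<Longrightarrow> (\<lambda>j. f j k) \<longlonglongrightarrow> g k" "\<And>j. l2bd (f j) B" shows "l2bd g B"
  unfolding l2bd_def
proof (intro allI impI, elim conjE)
  fix F :: "int set" assume F: "finite F" "0 \<notin> F"
  have "(\<lambda>j. L2_set (f j) F) \<longlonglongrightarrow> L2_set g F"
    unfolding L2_set_def using F by (intro tendsto_intros assms(1)) metis
  then show "L2_set g F \<le> B" by (rule LIMSEQ_le_const2) (use l2bdD[OF assms(2) F] in auto)
qed

text \<open>The mechanism behind the compact embedding of H^s into H^\<sigma>: beyond
  \<open>N\<close> the weaker weight gains \<open>N powr (\<sigma> - s)\<close>, and the rest is a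
  finite sum. The filter is arbitrary because the lemma is applied both to sequences and to limits
  in time.\<close>

lemma l2bd_eventually_small:
  fixes x :: "'a \<Rightarrow> int \<Rightarrow> complex"
  assumes s: "0 \<le> \<sigma>" "\<sigma> < s" and \<epsilon>: "\<epsilon> > 0"
    and conv: "\<And>k. k \<noteq> 0 \<Longrightarrow> ((\<lambda>i. x i k) \<longlongrightarrow> v k) F"
    and bd: "\<forall>\<^sub>F i in F. l2bd (\<lambda>k. hw s k * cmod (x i k)) B" "l2bd (\<lambda>k. hw s k * cmod (v k)) B"
  shows "\<forall>\<^sub>F i in F. l2bd (\<lambda>k. hw \<sigma> k * cmod (x i k - v k)) \<epsilon>"
proof -
  have B: "B \<ge> 0" using bd(2) by (rule l2bd_nonneg)
  have "(\<lambda>N. real N powr (\<sigma> - s)) \<longlonglongrightarrow> 0"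
    using s by (intro tendsto_neg_powr filterlim_real_sequentially) auto
  then have "(\<lambda>N. real N powr (\<sigma> - s) * (B + B)) \<longlonglongrightarrow> 0 * (B + B)" by (intro tendsto_intros)
  then have "\<forall>\<^sub>F N in sequentially. real N powr (\<sigma> - s) * (B + B) < \<epsilon> / 2" using \<epsilon> by (intro order_tendstoD) auto
  moreover have "\<forall>\<^sub>F N in sequentially. N \<ge> (1::nat)" by (rule eventually_ge_at_top)
  ultimately have "\<forall>\<^sub>F N in sequentially. real N powr (\<sigma> - s) * (B + B) < \<epsilon> / 2 \<and> N \<ge> 1" by (rule eventually_conj)
  then obtain N :: nat where N: "real N powr (\<sigma> - s) * (B + B) < \<epsilon> / 2" "N \<ge> 1"
    using eventually_happens'[OF sequentially_bot] by blast
  have "((\<lambda>i. \<Sum>k\<in>freq N. hw \<sigma> k * cmod (x i k - v k)) \<longlongrightarrow> (\<Sum>k\<in>freq N. hw \<sigma> k * cmod (v k - v k))) F"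
    by (intro tendsto_intros conv) (auto simp: freq_def)
  then have "((\<lambda>i. \<Sum>k\<in>freq N. hw \<sigma> k * cmod (x i k - v k)) \<longlongrightarrow> 0) F" by simp
  then have "\<forall>\<^sub>F i in F. (\<Sum>k\<in>freq N. hw \<sigma> k * cmod (x i k - v k)) < \<epsilon> / 2"
    using \<epsilon> by (intro order_tendstoD) auto
  then show ?thesis
    using bd(1)
  proof eventually_elim
    fix i assume low: "(\<Sum>k\<in>freq N. hw \<sigma> k * cmod (x i k - v k)) < \<epsilon> / 2" and xi: "l2bd (\<lambda>k. hw s k * cmod (x i k)) B"
    define lo where "lo k = (if k \<in> freq N then hw \<sigma> k * cmod (x i k - v k) else 0)" for k
    have lo: "l2bd lo (\<epsilon> / 2)"
      unfolding l2bd_def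
    proof (intro allI impI, elim conjE)
      fix F :: "int set" assume F: "finite F" "0 \<notin> F"
      have "L2_set lo F \<le> (\<Sum>k\<in>F. \<bar>lo k\<bar>)" by (rule L2_set_le_sum_abs)
      also have "\<dots> = (\<Sum>k\<in>F \<inter> freq N. hw \<sigma> k * cmod (x i k - v k))"
        using F by (intro sum.mono_neutral_cong_right) (auto simp: lo_def hw_nonneg)
      also have "\<dots> \<le> (\<Sum>k\<in>freq N. hw \<sigma> k * cmod (x i k - v k))"
        using finite_freq by (intro sum_mono2) (auto simp: hw_nonneg)
      finally show "L2_set lo F \<le> \<epsilon> / 2" using low by linarith
    qed
    have "l2bd (\<lambda>k. hw s k * cmod (x i k) + hw s k * cmod (v k)) (B + B)"
      using xi bd(2) by (rule l2bd_add)
    then have "l2bd (\<lambda>k. real N powr (\<sigma> - s) * (hw s k * cmod (x i k) + hw s k * cmod (v k))) (real N powr (\<sigma> - s) * (B + B))"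
      by (rule l2bd_cmult) simp
    then have "l2bd (\<lambda>k. lo k + real N powr (\<sigma> - s) * (hw s k * cmod (x i k) + hw s k * cmod (v k))) (\<epsilon> / 2 + real N powr (\<sigma> - s) * (B + B))"
      using lo by (intro l2bd_add)
    then have "l2bd (\<lambda>k. hw \<sigma> k * cmod (x i k - v k)) (\<epsilon> / 2 + real N powr (\<sigma> - s) * (B + B))"
    proof (rule l2bd_dominated)
      fix k :: int assume k: "k \<noteq> 0"
      show "\<bar>hw \<sigma> k * cmod (x i k - v k)\<bar> \<le> lo k + real N powr (\<sigma> - s) * (hw s k * cmod (x i k) + hw s k * cmod (v k))"
      proof (cases "k \<in> freq N")
        case False
        then have "real N \<le> real_of_int \<bar>k\<bar>" using k by (auto simp: freq_def)
        then have "real_of_int \<bar>k\<bar> powr (\<sigma> - s) \<le> real N powr (\<sigma> - s)"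
          using N(2) s by (intro powr_mono2') auto
        then have "hw s k * real_of_int \<bar>k\<bar> powr (\<sigma> - s) \<le> hw s k * real N powr (\<sigma> - s)"
          by (intro mult_left_mono hw_nonneg)
        moreover have "hw \<sigma> k = hw s k * real_of_int \<bar>k\<bar> powr (\<sigma> - s)"
          unfolding hw_def using k by (simp flip: powr_add)
        ultimately have "hw \<sigma> k \<le> real N powr (\<sigma> - s) * hw s k" by (simp add: mult.commute)
        then have "hw \<sigma> k * cmod (x i k - v k) \<le> (real N powr (\<sigma> - s) * hw s k) * (cmod (x i k) + cmod (v k))"
          by (intro mult_mono norm_triangle_ineq4) (auto simp: hw_nonneg)
        then show ?thesis using False by (simp add: lo_def hw_nonneg algebra_simps)
      qed (auto simp: lo_def hw_nonneg)
    qed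
    then show "l2bd (\<lambda>k. hw \<sigma> k * cmod (x i k - v k)) \<epsilon>" by (rule l2bd_mono) (use N(1) in simp)
  qed
qed

section \<open>Persistence, stability and uniqueness in Sobolev norms\<close>

lemma in_Hs_iff: "in_Hs s v \<longleftrightarrow> real_seq v \<and> Hs_weight s v summable_on {k. k \<noteq> 0}"
  unfolding in_Hs_def real_seq_def ..

lemma in_HsD: "in_Hs s v \<Longrightarrow> l2bd (\<lambda>k. hw s k * cmod (v k)) (Hs_norm s v)"
  unfolding in_Hs_iff by (blast intro: Hs_l2bd)

lemma in_Hs_l2bd: "s \<ge> 0 \<Longrightarrow> in_Hs s v \<Longrightarrow> l2bd (\<lambda>k. cmod (v k)) (Hs_norm s v)"
  by (rule l2bd_unweighted[OF _ in_HsD]) auto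

lemma l2bd_Hs0: "l2bd (\<lambda>k. cmod (v k)) B \<Longrightarrow> Hs_norm 0 v \<le> B"
  by (rule l2bd_Hs(2)) (simp add: l2bd_hw0_iff)

lemma Hs0_l2bd: "l2bd (\<lambda>k. cmod (v k)) B \<Longrightarrow> l2bd (\<lambda>k. cmod (v k)) (Hs_norm 0 v)"
  using Hs_l2bd[OF l2bd_Hs(1)[of 0 v B]] by (simp add: l2bd_hw0_iff)

text \<open>The constant is uniform in the cut-off of the bounded weights, so the cut-off can be
  removed; finiteness of the full H^s norm at later times is part of the conclusion.\<close>

lemma l2bd_hw_persistence:
  assumes s: "s \<ge> 0" and D: "D > 0" and T: "T \<ge> 0"
  shows "\<exists>A\<ge>0. \<forall>K x B t. kdv_pair T K x (\<lambda>_ _. 0) \<and> (\<forall>t\<in>{0..T}. l2bd (\<lambda>k. cmod (x t k)) D) \<and>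
    l2bd (\<lambda>k. hw s k * cmod (x 0 k)) B \<and> t \<in> {0..T} \<longrightarrow> l2bd (\<lambda>k. hw s k * cmod (x t k)) (A * B)"
proof -
  have "1 \<le> 2 powr s" using s by (intro ge_one_powr_ge_zero) auto
  then obtain A where A: "A \<ge> 0" "\<And>K x m W B t. kdv_pair T K x (\<lambda>_ _. 0) \<Longrightarrow> weight (2 powr s) m \<Longrightarrow> (\<And>k. m k \<le> W) \<Longrightarrow>
    (\<And>t. t \<in> {0..T} \<Longrightarrow> l2bd (\<lambda>k. cmod (x t k)) D) \<Longrightarrow> l2bd (\<lambda>k. m k * cmod (x 0 k)) B \<Longrightarrow>
    t \<in> {0..T} \<Longrightarrow> l2bd (\<lambda>k. m k * cmod (x t k)) (A * B)"
    using persistence[OF _ D T] by blast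
  show ?thesis
  proof (intro exI[of _ A] conjI A(1) allI impI, elim conjE)
    fix K x B t
    assume a: "kdv_pair T K x (\<lambda>_ _. 0)" "\<forall>t\<in>{0..T}. l2bd (\<lambda>k. cmod (x t k)) D" "l2bd (\<lambda>k. hw s k * cmod (x 0 k)) B" "t \<in> {0..T}"
    have "l2bd (\<lambda>k. hwt s N k * cmod (x t k)) (A * B)" if "N \<ge> 1" for N
      using A(2)[OF a(1) weight_hwt[OF s] hwt_bounded[OF s], of N B t] a that l2bd_hwt_iff[OF s, of "\<lambda>k. cmod (x 0 k)" B] by auto
    then show "l2bd (\<lambda>k. hw s k * cmod (x t k)) (A * B)"
      using l2bd_hwt_iff[OF s, of "\<lambda>k. cmod (x t k)" "A * B"] by auto
  qed
qed

lemma l2bd_hw_lipschitz: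
  assumes s: "s \<ge> 0" and D: "D > 0" and T: "T \<ge> 0"
  shows "\<exists>A\<ge>0. \<forall>K x y B t. kdv_pair T K x y \<and> (\<forall>t\<in>{0..T}. l2bd (\<lambda>k. hw s k * (cmod (x t k) + cmod (y t k))) D) \<and>
    l2bd (\<lambda>k. hw s k * cmod (x 0 k - y 0 k)) B \<and> t \<in> {0..T} \<longrightarrow> l2bd (\<lambda>k. hw s k * cmod (x t k - y t k)) (A * B)"
proof -
  have "1 \<le> 2 powr s" using s by (intro ge_one_powr_ge_zero) auto
  show ?thesis
  proof (rule lipschitz_dependence[OF \<open>1 \<le> 2 powr s\<close> D T])
    fix A assume A: "A \<ge> 0" "\<And>K x y m B t. kdv_pair T K x y \<Longrightarrow> weight (2 powr s) m \<Longrightarrow> (\<And>k. k \<noteq> 0 \<Longrightarrow> 1 \<le> m k) \<Longrightarrow>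
      (\<And>t. t \<in> {0..T} \<Longrightarrow> l2bd (\<lambda>k. m k * (cmod (x t k) + cmod (y t k))) D) \<Longrightarrow> l2bd (\<lambda>k. m k * cmod (x 0 k - y 0 k)) B \<Longrightarrow>
      t \<in> {0..T} \<Longrightarrow> l2bd (\<lambda>k. m k * cmod (x t k - y t k)) (A * B)"
    show ?thesis
    proof (intro exI[of _ A] conjI A(1) allI impI, elim conjE)
      fix K x y B t
      assume a: "kdv_pair T K x y" "\<forall>t\<in>{0..T}. l2bd (\<lambda>k. hw s k * (cmod (x t k) + cmod (y t k))) D" "l2bd (\<lambda>k. hw s k * cmod (x 0 k - y 0 k)) B" "t \<in> {0..T}"
      have "l2bd (\<lambda>k. hwt s N k * cmod (x t k - y t k)) (A * B)" if N: "N \<ge> 1" for N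
      proof (rule A(2)[OF a(1) weight_hwt[OF s] one_le_hwt[OF s N] _ _ a(4)])
        show "l2bd (\<lambda>k. hwt s N k * (cmod (x t k) + cmod (y t k))) D" if "t \<in> {0..T}" for t
          using a(2) that N l2bd_hwt_iff[OF s, of "\<lambda>k. cmod (x t k) + cmod (y t k)" D] by auto
        show "l2bd (\<lambda>k. hwt s N k * cmod (x 0 k - y 0 k)) B"
          using a(3) N l2bd_hwt_iff[OF s, of "\<lambda>k. cmod (x 0 k - y 0 k)" B] by auto
      qed
      then show "l2bd (\<lambda>k. hw s k * cmod (x t k - y t k)) (A * B)"
        using l2bd_hwt_iff[OF s, of "\<lambda>k. cmod (x t k - y t k)" "A * B"] by auto
    qed
  qed
qed

text \<open>Lipschitz dependence with trivial weight: an l^2 bound on both solutions is enough. The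
  summand 1 in \<open>D\<close> only makes it positive.\<close>

lemma kdv_sol_unique:
  assumes T: "T \<ge> 0" and x: "kdv_sol T x" and y: "kdv_sol T y"
    and init: "\<And>k. k \<noteq> 0 \<Longrightarrow> x 0 k = y 0 k" and t: "t \<in> {0..T}" and k: "k \<noteq> 0"
  shows "x t k = y t k"
proof -
  obtain M1 where M1: "\<And>t. t \<in> {0..T} \<Longrightarrow> l2bd (\<lambda>k. cmod (x t k)) M1" using kdv_solE[OF x] by blast
  obtain M2 where M2: "\<And>t. t \<in> {0..T} \<Longrightarrow> l2bd (\<lambda>k. cmod (y t k)) M2" using kdv_solE[OF y] by blast
  have M0: "M1 \<ge> 0" "M2 \<ge> 0" using l2bd_nonneg[OF M1[of 0]] l2bd_nonneg[OF M2[of 0]] T by auto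
  define D where "D = M1 + M2 + 1"
  have D: "D > 0" using M0 unfolding D_def by simp
  obtain A where A: "\<And>K x y B t. kdv_pair T K x y \<and> (\<forall>t\<in>{0..T}. l2bd (\<lambda>k. hw 0 k * (cmod (x t k) + cmod (y t k))) D) \<and>
    l2bd (\<lambda>k. hw 0 k * cmod (x 0 k - y 0 k)) B \<and> t \<in> {0..T} \<longrightarrow> l2bd (\<lambda>k. hw 0 k * cmod (x t k - y t k)) (A * B)"
    using l2bd_hw_lipschitz[OF order_refl D T] by blast
  have "l2bd (\<lambda>k. cmod (x t k) + cmod (y t k)) D" if "t \<in> {0..T}" for t
    unfolding D_def using l2bd_add[OF M1[OF that] M2[OF that]] by (rule l2bd_mono) simp
  moreover have "l2bd (\<lambda>k. cmod (x 0 k - y 0 k)) 0"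
  proof -
    have "l2bd (\<lambda>k. cmod (x 0 k - y 0 k)) 0 \<longleftrightarrow> l2bd (\<lambda>k. 0) 0" using init by (intro l2bd_cong) simp
    then show ?thesis by (simp add: l2bd_def L2_set_def)
  qed
  ultimately have "l2bd (\<lambda>k. cmod (x t k - y t k)) (A * 0)"
    using A[of nonzero x y 0 t] kdv_sol_pair[OF x y T] t unfolding l2bd_hw0_iff by blast
  from l2bd_point[OF this k] show ?thesis by simp
qed

section \<open>Compactness of the Galerkin sequence and existence\<close>

lemma galerkin_l2bd:
  assumes g: "galerkin T n a x" and T: "T \<ge> 0" and t: "t \<in> {0..T}" and a: "l2bd (\<lambda>k. cmod (a k)) M"
  shows "l2bd (\<lambda>k. cmod (x t k)) M"
  unfolding l2bd_def
proof (intro allI impI, elim conjE)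
  fix F :: "int set" assume F: "finite F" "0 \<notin> F"
  have "(\<Sum>k\<in>F. (cmod (x t k))\<^sup>2) = (\<Sum>k\<in>F \<inter> freq n. (cmod (x t k))\<^sup>2)"
    using g F unfolding galerkin_def by (intro sum.mono_neutral_cong_right) auto
  also have "\<dots> \<le> (\<Sum>k\<in>freq n. (cmod (x t k))\<^sup>2)" using finite_freq by (intro sum_mono2) auto
  also have "\<dots> = (\<Sum>k\<in>freq n. (cmod (a k))\<^sup>2)" by (rule galerkin_energy[OF g T t])
  finally have "L2_set (\<lambda>k. cmod (x t k)) F \<le> L2_set (\<lambda>k. cmod (a k)) (freq n)"
    unfolding L2_set_def by (rule real_sqrt_le_mono)
  also have "\<dots> \<le> M" by (rule l2bdD[OF a finite_freq zero_notin_freq])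
  finally show "L2_set (\<lambda>k. cmod (x t k)) F \<le> M" .
qed

lemma galerkin_rhs:
  assumes "galerkin T n a x"
  shows "kdv_rhs (x t) t k = quad (freq n) (x t) t k"
  using assms by (intro kdv_rhs_truncated) (auto simp: galerkin_def)

text \<open>Equicontinuity in time: for fixed \<open>k\<close> the Lipschitz constant is independent
  of \<open>n\<close>.\<close>

lemma galerkin_lipschitz:
  assumes g: "galerkin T n a x" and T: "T \<ge> 0" and a: "l2bd (\<lambda>k. cmod (a k)) M" and st: "s \<in> {0..T}" "t \<in> {0..T}"
  shows "cmod (x t k - x s k) \<le> mag k / 2 * (M * M) * \<bar>t - s\<bar>"
proof (cases "k \<in> freq n")
  case True
  then have p: "prim T (\<lambda>t. x t k) (\<lambda>t. gal_rhs n (x t) t k)" using g unfolding galerkin_def by blast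
  have "cmod (gal_rhs n (x \<tau>) \<tau> k) \<le> mag k / 2 * (M * M)" if "\<tau> \<in> {0..T}" for \<tau>
    using kdv_rhs_bound(2)[OF galerkin_l2bd[OF g T that a], of \<tau> k] galerkin_rhs[OF g, of \<tau> k]
    by (simp add: gal_rhs_def norm_mult norm_divide mult_left_mono)
  then have *: "cmod (x t k - x s k) \<le> mag k / 2 * (M * M) * (t - s)" if "0 \<le> s" "s \<le> t" "t \<le> T" for s t
    using weighted_increment_le[OF p that bmeas_const[of T "mag k / 2 * (M * M)"], of 1] that
    by (simp add: mult_ac)
  show ?thesis
    using *[of s t] *[of t s] st by (cases "s \<le> t") (auto simp: norm_minus_commute)
next
  case False
  then show ?thesis using g unfolding galerkin_def by simp
qed

text \<open>The Arzela-Ascoli argument: a subsequence converging at all rational times and all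
  frequencies, extended to every time by equicontinuity.\<close>

lemma galerkin_subsequence:
  assumes T: "T > 0" and x: "\<And>n. galerkin T n a (x n)" and a: "l2bd (\<lambda>k. cmod (a k)) M"
  obtains r where "strict_mono (r :: nat \<Rightarrow> nat)" "\<And>t k. t \<in> {0..T} \<Longrightarrow> convergent (\<lambda>j. x (r j) t k)"
proof -
  have T0: "T \<ge> 0" using T by simp
  define S where "S = ((\<rat> \<inter> {0..T}) \<times> (UNIV :: int set))"
  have "countable S" unfolding S_def by (intro countable_SIGMA countable_Int1 countable_rat) auto
  moreover have "cmod (x n (fst z) (snd z)) \<le> M" if "z \<in> S" for n z
  proof (cases "snd z = 0")
    case True
    then show ?thesis using x[of n] l2bd_nonneg[OF a] zero_notin_freq unfolding galerkin_def by auto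
  next
    case False
    then show ?thesis using l2bd_point[OF galerkin_l2bd[OF x T0 _ a]] that unfolding S_def by fastforce
  qed
  ultimately obtain r where r: "strict_mono (r :: nat \<Rightarrow> nat)" "\<And>z. z \<in> S \<Longrightarrow> \<exists>l. (\<lambda>n. x (r n) (fst z) (snd z)) \<longlonglongrightarrow> l"
    using function_convergent_subsequence[of S "\<lambda>n z. x n (fst z) (snd z)" M] by blast
  show ?thesis
  proof (rule that[OF r(1)])
    fix t k assume t: "t \<in> {0..T}"
    define c where "c = mag k / 2 * (M * M) + 1"
    have c: "c > 0" unfolding c_def by (intro add_nonneg_pos) auto
    have "Cauchy (\<lambda>j. x (r j) t k)"
      unfolding Cauchy_def
    proof (intro allI impI)
      fix e :: real assume e: "e > 0"
      have "\<exists>q\<in>\<rat> \<inter> {0..T}. \<bar>q - t\<bar> < e / (3 * c)"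
      proof -
        have "0 < e / (3 * c)" using e c by simp
        \<comment> \<open>The clipped interval is nonempty even when \<open>t\<close> is an
          endpoint, because \<open>T > 0\<close>; so it contains a rational time of [0,T].\<close>
        then have "max 0 (t - e / (3 * c)) < min T (t + e / (3 * c))" using T t by auto
        then obtain q where "q \<in> \<rat>" "max 0 (t - e / (3 * c)) < q" "q < min T (t + e / (3 * c))"
          using Rats_dense_in_real by blast
        then show ?thesis by (intro bexI[of _ q]) auto
      qed
      then obtain q where q: "q \<in> \<rat>" "q \<in> {0..T}" "\<bar>q - t\<bar> < e / (3 * c)" by blast
      have close: "dist (x n t k) (x n q k) < e / 3" for n
      proof -
        have "cmod (x n t k - x n q k) \<le> mag k / 2 * (M * M) * \<bar>t - q\<bar>"
          by (rule galerkin_lipschitz[OF x T0 a q(2) t])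
        also have "\<dots> \<le> c * \<bar>q - t\<bar>"
          unfolding abs_minus_commute[of t q] by (rule mult_right_mono) (simp_all add: c_def)
        also have "\<dots> < c * (e / (3 * c))" using q(3) c by (intro mult_strict_left_mono)
        also have "\<dots> = e / 3" using c by simp
        finally show ?thesis by (simp add: dist_norm)
      qed
      have "Cauchy (\<lambda>j. x (r j) q k)"
        using r(2)[of "(q, k)"] q by (auto simp: S_def intro: LIMSEQ_imp_Cauchy)
      then obtain N where N: "\<And>m n. m \<ge> N \<Longrightarrow> n \<ge> N \<Longrightarrow> dist (x (r m) q k) (x (r n) q k) < e / 3"
        using e unfolding Cauchy_def by (meson divide_pos_pos zero_less_numeral)
      show "\<exists>N. \<forall>m\<ge>N. \<forall>n\<ge>N. dist (x (r m) t k) (x (r n) t k) < e"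
      proof (intro exI[of _ N] allI impI)
        fix m n assume "m \<ge> N" "n \<ge> N"
        then show "dist (x (r m) t k) (x (r n) t k) < e"
          using N[of m n] close[of "r m"] close[of "r n"] dist_triangle[of "x (r m) t k" "x (r n) t k" "x (r m) q k"]
            dist_triangle[of "x (r m) q k" "x (r n) t k" "x (r n) q k"] by (simp add: dist_commute)
      qed
    qed
    then show "convergent (\<lambda>j. x (r j) t k)" by (rule Cauchy_convergent)
  qed
qed

text \<open>Persistence bounds the approximations in H^s uniformly. As \<open>s > 0\<close>,
  coefficientwise convergence becomes strong l^2 convergence, which is needed twice: for the limit
  of the quadratic term and to prevent a loss of energy in the limit.\<close>

lemma kdv_exists:
  assumes s: "s > 0" and T: "T > 0" and v0: "in_Hs s v0"
  obtains v B where "kdv_sol T v" "\<forall>t\<in>{0..T}. real_seq (v t)" "\<forall>k. k \<noteq> 0 \<longrightarrow> v 0 k = v0 k" "\<forall>t. v t 0 = 0"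
    "\<forall>t\<in>{0..T}. Hs_norm 0 (v t) = Hs_norm 0 v0 \<and> l2bd (\<lambda>k. hw s k * cmod (v t k)) B"
proof -
  have T0: "T \<ge> 0" using T by simp
  have r0: "real_seq v0" using v0 unfolding in_Hs_iff by blast
  define M where "M = Hs_norm 0 v0"
  have M: "l2bd (\<lambda>k. cmod (v0 k)) M"
    unfolding M_def using in_Hs_l2bd[OF _ v0] s by (intro Hs0_l2bd) auto
  have M0: "M \<ge> 0" using M by (rule l2bd_nonneg)
  obtain x where x: "\<And>n. galerkin T n v0 (x n)" using galerkin_exists[OF r0 T0] by metis
  have xM: "l2bd (\<lambda>k. cmod (x n t k)) M" if "t \<in> {0..T}" for n t
    by (rule galerkin_l2bd[OF x T0 that M])
  obtain A where A: "\<And>K x B t. kdv_pair T K x (\<lambda>_ _. 0) \<and> (\<forall>t\<in>{0..T}. l2bd (\<lambda>k. cmod (x t k)) (M + 1)) \<and>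
    l2bd (\<lambda>k. hw s k * cmod (x 0 k)) B \<and> t \<in> {0..T} \<longrightarrow> l2bd (\<lambda>k. hw s k * cmod (x t k)) (A * B)"
    using l2bd_hw_persistence[of s "M + 1" T] s M0 T0 by auto
  define B where "B = A * Hs_norm s v0"
  have xB: "l2bd (\<lambda>k. hw s k * cmod (x n t k)) B" if t: "t \<in> {0..T}" for n t
  proof -
    have "l2bd (\<lambda>k. hw s k * cmod (x n 0 k)) (Hs_norm s v0)"
    proof (rule l2bd_dominated[OF in_HsD[OF v0]])
      fix k :: int
      show "\<bar>hw s k * cmod (x n 0 k)\<bar> \<le> hw s k * cmod (v0 k)"
        using x[of n] unfolding galerkin_def by (cases "k \<in> freq n") (auto simp: hw_nonneg)
    qed
    moreover have "\<forall>t\<in>{0..T}. l2bd (\<lambda>k. cmod (x n t k)) (M + 1)" using l2bd_mono[OF xM] by auto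
    ultimately show ?thesis
      using A[of "freq n" "x n" "Hs_norm s v0" t] galerkin_pair[OF x T0] t unfolding B_def by blast
  qed
  obtain r where r: "strict_mono (r :: nat \<Rightarrow> nat)" "\<And>t k. t \<in> {0..T} \<Longrightarrow> convergent (\<lambda>j. x (r j) t k)"
    using galerkin_subsequence[OF T x M] by blast
  define v where "v t k = lim (\<lambda>j. x (r j) t k)" for t k
  have lim: "(\<lambda>j. x (r j) t k) \<longlonglongrightarrow> v t k" if "t \<in> {0..T}" for t k
    using r(2)[OF that] unfolding v_def by (simp add: convergent_LIMSEQ_iff)
  have ev: "\<forall>\<^sub>F j in sequentially. k \<in> freq (r j)" if "k \<noteq> 0" for k
  proof -
    have "\<forall>\<^sub>F j in sequentially. j \<ge> nat \<bar>k\<bar>" by (rule eventually_ge_at_top)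
    then show ?thesis
    proof eventually_elim
      fix j assume "j \<ge> nat \<bar>k\<bar>"
      then have "r j \<ge> nat \<bar>k\<bar>" using seq_suble[OF r(1), of j] by linarith
      then show "k \<in> freq (r j)" using that by (auto simp: freq_def nat_le_iff)
    qed
  qed
  have vM: "l2bd (\<lambda>k. cmod (v t k)) M" if "t \<in> {0..T}" for t
    by (rule l2bd_tendsto[where f = "\<lambda>j k. cmod (x (r j) t k)"]) (intro tendsto_intros lim xM that)+
  have vB: "l2bd (\<lambda>k. hw s k * cmod (v t k)) B" if "t \<in> {0..T}" for t
    by (rule l2bd_tendsto[where f = "\<lambda>j k. hw s k * cmod (x (r j) t k)"]) (intro tendsto_intros lim xB that)+
  have strong: "\<forall>\<^sub>F j in sequentially. l2bd (\<lambda>k. cmod (x (r j) t k - v t k)) \<epsilon>" if t: "t \<in> {0..T}" and "\<epsilon> > 0" for t \<epsilon>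
    using l2bd_eventually_small[of 0 s \<epsilon> "\<lambda>j. x (r j) t" "v t" sequentially B] s that xB[OF t] vB[OF t] lim[OF t]
    unfolding l2bd_hw0_iff by simp
  have rhs_lim: "(\<lambda>j. kdv_rhs (x (r j) t) t k) \<longlonglongrightarrow> kdv_rhs (v t) t k" if t: "t \<in> {0..T}" for t k
  proof (rule tendstoI)
    fix e :: real assume e: "e > 0"
    have "e / (2 * M + 1) > 0" using e M0 by simp
    from strong[OF t this] show "\<forall>\<^sub>F j in sequentially. dist (kdv_rhs (x (r j) t) t k) (kdv_rhs (v t) t k) < e"
    proof eventually_elim
      fix j assume "l2bd (\<lambda>k. cmod (x (r j) t k - v t k)) (e / (2 * M + 1))"
      from kdv_rhs_diff[OF xM[OF t] vM[OF t] this, of t k]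
      have "cmod (kdv_rhs (x (r j) t) t k - kdv_rhs (v t) t k) \<le> e / (2 * M + 1) * (M + M)" .
      also have "\<dots> < e / (2 * M + 1) * (2 * M + 1)" using e M0 by (intro mult_strict_left_mono) auto
      also have "\<dots> = e" using M0 by simp
      finally show "dist (kdv_rhs (x (r j) t) t k) (kdv_rhs (v t) t k) < e" by (simp add: dist_norm)
    qed
  qed
  have xc: "continuous_on {0..T} (\<lambda>t. x n t k)" for n k
  proof (cases "k \<in> freq n")
    case True
    then show ?thesis using x[of n] unfolding galerkin_def by (intro prim_continuous[of T "\<lambda>t. x n t k"]) auto
  next
    case False
    then show ?thesis using x[of n] unfolding galerkin_def by simp
  qed
  have rhs_eq: "\<i> / 2 * of_int k * kdv_rhs (x n t) t k = gal_rhs n (x n t) t k" for n t k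
    unfolding gal_rhs_def galerkin_rhs[OF x] ..
  have rhs_bmeas: "bmeas T (\<lambda>t. \<i> / 2 * of_int k * kdv_rhs (x n t) t k)" for n k
    unfolding rhs_eq by (intro bmeas_continuous continuous_quad xc)
  have rhs_le: "cmod (\<i> / 2 * of_int k * kdv_rhs u \<tau> k) \<le> mag k / 2 * (M * M)" if "l2bd (\<lambda>k. cmod (u k)) M" for u \<tau> k
    using kdv_rhs_bound(2)[OF that, of \<tau> k] by (simp add: norm_mult norm_divide mult_left_mono)
  have v_init: "v 0 k = v0 k" if k: "k \<noteq> 0" for k
  proof (rule LIMSEQ_unique[OF lim])
    have "\<forall>\<^sub>F j in sequentially. v0 k = x (r j) 0 k"
      using ev[OF k] by eventually_elim (use x in \<open>auto simp: galerkin_def\<close>)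
    then show "(\<lambda>j. x (r j) 0 k) \<longlonglongrightarrow> v0 k" by (rule Lim_transform_eventually[OF tendsto_const])
  qed (use T in auto)
  have sol: "kdv_sol T v"
  proof (rule kdv_solI[OF vM])
    fix k :: int assume k: "k \<noteq> 0"
    show "prim T (\<lambda>t. v t k) (\<lambda>t. \<i> / 2 * of_int k * kdv_rhs (v t) t k)"
    proof (rule primI)
      show "bmeas T (\<lambda>t. \<i> / 2 * of_int k * kdv_rhs (v t) t k)"
      proof (rule bmeas_limit[where f = "\<lambda>j t. \<i> / 2 * of_int k * kdv_rhs (x (r j) t) t k"])
        show "bmeas T (\<lambda>t. \<i> / 2 * of_int k * kdv_rhs (x (r j) t) t k)" for j by (rule rhs_bmeas)
        show "(\<lambda>j. \<i> / 2 * of_int k * kdv_rhs (x (r j) t) t k) \<longlonglongrightarrow> \<i> / 2 * of_int k * kdv_rhs (v t) t k" if "t \<in> {0..T}" for t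
          by (intro tendsto_intros rhs_lim that)
        show "norm (\<i> / 2 * of_int k * kdv_rhs (v t) t k) \<le> mag k / 2 * (M * M)" if "t \<in> {0..T}" for t
          by (rule rhs_le[OF vM[OF that]])
      qed
      fix t assume t: "t \<in> {0..T}"
      have "(\<lambda>j. integral {0..t} (\<lambda>\<tau>. \<i> / 2 * of_int k * kdv_rhs (x (r j) \<tau>) \<tau> k)) \<longlonglongrightarrow> integral {0..t} (\<lambda>\<tau>. \<i> / 2 * of_int k * kdv_rhs (v \<tau>) \<tau> k)"
      proof (rule dominated_convergence(2))
        show "(\<lambda>\<tau>. \<i> / 2 * of_int k * kdv_rhs (x (r j) \<tau>) \<tau> k) integrable_on {0..t}" for j
          using t by (intro bmeas_integrable[OF rhs_bmeas]) auto
        show "(\<lambda>_. mag k / 2 * (M * M)) integrable_on {0..t}" by (rule integrable_const_ivl)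
        show "norm (\<i> / 2 * of_int k * kdv_rhs (x (r j) \<tau>) \<tau> k) \<le> mag k / 2 * (M * M)" if "\<tau> \<in> {0..t}" for j \<tau>
          using that t by (intro rhs_le xM) auto
        show "(\<lambda>j. \<i> / 2 * of_int k * kdv_rhs (x (r j) \<tau>) \<tau> k) \<longlonglongrightarrow> \<i> / 2 * of_int k * kdv_rhs (v \<tau>) \<tau> k" if "\<tau> \<in> {0..t}" for \<tau>
          using that t by (intro tendsto_intros rhs_lim) auto
      qed
      then have "(\<lambda>j. v0 k + integral {0..t} (\<lambda>\<tau>. \<i> / 2 * of_int k * kdv_rhs (x (r j) \<tau>) \<tau> k)) \<longlonglongrightarrow> v0 k + integral {0..t} (\<lambda>\<tau>. \<i> / 2 * of_int k * kdv_rhs (v \<tau>) \<tau> k)"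
        by (intro tendsto_intros)
      moreover have "\<forall>\<^sub>F j in sequentially. v0 k + integral {0..t} (\<lambda>\<tau>. \<i> / 2 * of_int k * kdv_rhs (x (r j) \<tau>) \<tau> k) = x (r j) t k"
        using ev[OF k]
      proof eventually_elim
        fix j assume j: "k \<in> freq (r j)"
        have "x (r j) t k = x (r j) 0 k + integral {0..t} (\<lambda>\<tau>. gal_rhs (r j) (x (r j) \<tau>) \<tau> k)"
          using x[of "r j"] j unfolding galerkin_def by (intro primD[OF _ t]) auto
        then show "v0 k + integral {0..t} (\<lambda>\<tau>. \<i> / 2 * of_int k * kdv_rhs (x (r j) \<tau>) \<tau> k) = x (r j) t k"
          unfolding rhs_eq using x[of "r j"] j unfolding galerkin_def by simp
      qed
      ultimately have "(\<lambda>j. x (r j) t k) \<longlonglongrightarrow> v0 k + integral {0..t} (\<lambda>\<tau>. \<i> / 2 * of_int k * kdv_rhs (v \<tau>) \<tau> k)"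
        by (rule Lim_transform_eventually)
      from LIMSEQ_unique[OF lim[OF t] this]
      show "v t k = v 0 k + integral {0..t} (\<lambda>\<tau>. \<i> / 2 * of_int k * kdv_rhs (v \<tau>) \<tau> k)"
        unfolding v_init[OF k] .
    qed
  qed
  have v_real: "real_seq (v t)" if t: "t \<in> {0..T}" for t
    unfolding real_seq_def
  proof (intro allI impI)
    fix k :: int assume k: "k \<noteq> 0"
    have "x (r j) t (- k) = cnj (x (r j) t k)" for j
      using x[of "r j"] t k unfolding galerkin_def by (intro real_seqD) auto
    then have "(\<lambda>j. x (r j) t (- k)) \<longlonglongrightarrow> cnj (v t k)" using tendsto_cnj[OF lim[OF t, of k]] by simp
    then show "v t (- k) = cnj (v t k)" by (rule LIMSEQ_unique[OF lim[OF t]])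
  qed
  \<comment> \<open>\<open>is_solution\<close> also asks for measurability of the coefficient with
    index 0.\<close>
  have v_zero: "v t 0 = 0" for t
  proof -
    have "x (r j) t 0 = 0" for j using x[of "r j"] zero_notin_freq unfolding galerkin_def by blast
    then show ?thesis unfolding v_def by simp
  qed
  have energy: "Hs_norm 0 (v t) = Hs_norm 0 v0" if t: "t \<in> {0..T}" for t
  proof (rule antisym)
    show "Hs_norm 0 (v t) \<le> Hs_norm 0 v0" using l2bd_Hs0[OF vM[OF t]] unfolding M_def .
    \<comment> \<open>The other inequality is lower semicontinuity. For this one a finite section of
      the data is enlarged to \<open>freq (r j)\<close>, where the Galerkin energy is conserved, and
      strong convergence compares the approximation with \<open>v t\<close>.\<close>
    have "l2bd (\<lambda>k. cmod (v0 k)) (Hs_norm 0 (v t))"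
      unfolding l2bd_def
    proof (intro allI impI, elim conjE, rule field_le_epsilon)
      fix F :: "int set" and e :: real assume F: "finite F" "0 \<notin> F" and e: "e > 0"
      have "\<forall>\<^sub>F j in sequentially. \<forall>k\<in>F. k \<in> freq (r j)"
        using F(2) by (intro eventually_ball_finite F(1) ballI ev) metis
      then have "\<forall>\<^sub>F j in sequentially. (\<forall>k\<in>F. k \<in> freq (r j)) \<and> l2bd (\<lambda>k. cmod (x (r j) t k - v t k)) e"
        using strong[OF t e] by (rule eventually_conj)
      then obtain j where j: "\<forall>k\<in>F. k \<in> freq (r j)" "l2bd (\<lambda>k. cmod (x (r j) t k - v t k)) e"
        using eventually_happens'[OF sequentially_bot] by blast
      have "L2_set (\<lambda>k. cmod (v0 k)) F \<le> L2_set (\<lambda>k. cmod (v0 k)) (freq (r j))"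
        unfolding L2_set_def using j(1) finite_freq by (intro real_sqrt_le_mono sum_mono2) auto
      also have "\<dots> = L2_set (\<lambda>k. cmod (x (r j) t k)) (freq (r j))"
        unfolding L2_set_def using galerkin_energy[OF x T0 t] by simp
      also have "\<dots> \<le> L2_set (\<lambda>k. cmod (v t k) + cmod (x (r j) t k - v t k)) (freq (r j))"
        by (intro L2_set_mono norm_triangle_sub) auto
      also have "\<dots> \<le> L2_set (\<lambda>k. cmod (v t k)) (freq (r j)) + L2_set (\<lambda>k. cmod (x (r j) t k - v t k)) (freq (r j))"
        by (rule L2_set_triangle_ineq)
      also have "\<dots> \<le> Hs_norm 0 (v t) + e"
        by (intro add_mono l2bdD[OF Hs0_l2bd[OF vM[OF t]]] l2bdD[OF j(2)] finite_freq zero_notin_freq)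
      finally show "L2_set (\<lambda>k. cmod (v0 k)) F \<le> Hs_norm 0 (v t) + e" .
    qed
    then show "Hs_norm 0 v0 \<le> Hs_norm 0 (v t)" by (rule l2bd_Hs0)
  qed
  show ?thesis
    using sol v_real v_init v_zero energy vB by (intro that[of v B] ballI allI impI conjI)
qed

lemma kdv_sol_is_solution:
  assumes T: "T > 0" and v: "kdv_sol T v" "\<And>t. t \<in> {0..T} \<Longrightarrow> real_seq (v t)" "\<And>k. k \<noteq> 0 \<Longrightarrow> v 0 k = v0 k" "\<And>t. v t 0 = 0"
  shows "is_solution T v0 v"
  unfolding is_solution_def
proof (intro conjI allI impI)
  fix k
  have "bmeas T (\<lambda>t. v t k)"
    using v(4) prim_bmeas[OF kdv_solD[OF v(1)]] bmeas_const[of T 0] by (cases "k = 0") auto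
  then show "(\<lambda>t. v t k) \<in> borel_measurable (lebesgue_on {0..T})" unfolding bmeas_def by blast
next
  obtain M where M: "\<And>t. t \<in> {0..T} \<Longrightarrow> l2bd (\<lambda>k. cmod (v t k)) M" using kdv_solE[OF v(1)] by blast
  have "in_Hs 0 (v t) \<and> Hs_norm 0 (v t) \<le> M" if "t \<in> {0..T}" for t
    using v(2)[OF that] l2bd_Hs[of 0 "v t" M] M[OF that] unfolding in_Hs_iff l2bd_hw0_iff by blast
  then show "\<exists>C. AE t in lebesgue_on {0..T}. in_Hs 0 (v t) \<and> Hs_norm 0 (v t) \<le> C"
    by (intro exI[of _ M] AE_I2) auto
next
  fix k :: int and t :: real assume kt: "k \<noteq> 0 \<and> t \<in> {0..T}"
  let ?c = "\<i> / 2 * of_int k :: complex"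
  have p: "prim T (\<lambda>t. v t k) (\<lambda>t. ?c * kdv_rhs (v t) t k)" using kdv_solD[OF v(1)] kt by blast
  have "bmeas T (\<lambda>t. (1 / ?c) * (?c * kdv_rhs (v t) t k))"
    by (rule bmeas_cmult[OF prim_bmeas_deriv[OF p]])
  moreover have "?c \<noteq> 0" using kt by simp
  ultimately have b: "bmeas T (\<lambda>t. kdv_rhs (v t) t k)" by simp
  show si: "set_integrable lebesgue {0..t} (\<lambda>\<tau>. kdv_rhs (v \<tau>) \<tau> k)"
    using kt by (intro bmeas_absolutely_integrable[OF b]) auto
  have "v t k = v0 k + integral {0..t} (\<lambda>t. ?c * kdv_rhs (v t) t k)"
    using primD[OF p] kt v(3) by auto
  then show "v t k - v0 k = 1/2 * \<i> * of_int k * (LINT \<tau>:{0..t}|lebesgue. kdv_rhs (v \<tau>) \<tau> k)"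
    by (simp add: set_lebesgue_integral_eq_integral(2)[OF si])
qed

section \<open>Lipschitz dependence and continuity in time\<close>

lemma Hs0_le_Hs: "s \<ge> 0 \<Longrightarrow> in_Hs s v \<Longrightarrow> Hs_norm 0 v \<le> Hs_norm s v"
  by (rule l2bd_Hs0[OF in_Hs_l2bd])

text \<open>By definition a solution comes with some unspecified l^2 bound. Uniqueness identifies it
  with the constructed one and so yields a bound in terms of the data, as is needed for constants
  that depend on the norms of the data only.\<close>

lemma solution_energy:
  assumes s: "s > 0" and T: "T > 0" and v0: "in_Hs s v0" and v: "is_solution T v0 v" and t: "t \<in> {0..T}"
  shows "l2bd (\<lambda>k. cmod (v t k)) (Hs_norm s v0)"
proof -
  obtain u B where "kdv_sol T u" "\<forall>t\<in>{0..T}. real_seq (u t)" "\<forall>k. k \<noteq> 0 \<longrightarrow> u 0 k = v0 k" "\<forall>t. u t 0 = 0"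
    "\<forall>t\<in>{0..T}. Hs_norm 0 (u t) = Hs_norm 0 v0 \<and> l2bd (\<lambda>k. hw s k * cmod (u t k)) B"
    by (rule kdv_exists[OF s T v0])
  then have u: "kdv_sol T u" "\<And>k. k \<noteq> 0 \<Longrightarrow> u 0 k = v0 k" "\<And>t. t \<in> {0..T} \<Longrightarrow> Hs_norm 0 (u t) = Hs_norm 0 v0"
    by simp_all
  note w = is_solution_kdv_sol[OF T v]
  have eq: "v t k = u t k" if "k \<noteq> 0" for k
  proof (rule kdv_sol_unique[OF _ w(1) u(1) _ t that])
    show "v 0 k = u 0 k" if "k \<noteq> 0" for k using w(2)[OF that] u(2)[OF that] by simp
  qed (use T in simp)
  obtain M where "\<And>t. t \<in> {0..T} \<Longrightarrow> l2bd (\<lambda>k. cmod (u t k)) M" using kdv_solE[OF u(1)] by blast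
  then have "l2bd (\<lambda>k. cmod (u t k)) (Hs_norm 0 (u t))" using t by (intro Hs0_l2bd) auto
  then have "l2bd (\<lambda>k. cmod (u t k)) (Hs_norm s v0)"
    unfolding u(3)[OF t] by (rule l2bd_mono) (use s v0 in \<open>auto intro: Hs0_le_Hs\<close>)
  moreover have "l2bd (\<lambda>k. cmod (v t k)) (Hs_norm s v0) \<longleftrightarrow> l2bd (\<lambda>k. cmod (u t k)) (Hs_norm s v0)"
    using eq by (intro l2bd_cong) simp
  ultimately show ?thesis by simp
qed

text \<open>Two stages: the l^2 bound by \<open>r\<close> fixes the persistence constant
  \<open>A\<close>, and the resulting H^s bounds fix the size \<open>D\<close> for Lipschitz
  dependence. Hence \<open>L\<close> depends on \<open>s\<close>, \<open>T\<close> and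
  \<open>r\<close> alone.\<close>

lemma solutions_lipschitz:
  assumes s: "s > 0" and T: "T > 0"
  shows "\<exists>L\<ge>0. \<forall>v0 w0 v w t. in_Hs s v0 \<and> in_Hs s w0 \<and> is_solution T v0 v \<and> is_solution T w0 w \<and>
     Hs_norm s v0 + Hs_norm s w0 \<le> r \<and> t \<in> {0..T} \<longrightarrow>
     l2bd (\<lambda>k. hw s k * cmod (w t k - v t k)) (L * Hs_norm s (\<lambda>k. w0 k - v0 k))"
proof -
  have s0: "s \<ge> 0" and T0: "T \<ge> 0" using s T by auto
  have "\<bar>r\<bar> + 1 > 0" by simp
  then obtain A where A: "A \<ge> 0" and pers: "\<And>K x B t. kdv_pair T K x (\<lambda>_ _. 0) \<and> (\<forall>t\<in>{0..T}. l2bd (\<lambda>k. cmod (x t k)) (\<bar>r\<bar> + 1)) \<and>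
    l2bd (\<lambda>k. hw s k * cmod (x 0 k)) B \<and> t \<in> {0..T} \<longrightarrow> l2bd (\<lambda>k. hw s k * cmod (x t k)) (A * B)"
    using l2bd_hw_persistence[OF s0 _ T0] by meson
  \<comment> \<open>One summand for the H^s bound of each solution, and 1 for positivity.\<close>
  have "A * \<bar>r\<bar> + A * \<bar>r\<bar> + 1 > 0" using A by (intro add_nonneg_pos) auto
  note l2bd_hw_lipschitz[OF s0 this T0]
  then obtain L where L: "L \<ge> 0" and lip: "\<forall>K x y B t. kdv_pair T K x y \<and>
     (\<forall>t\<in>{0..T}. l2bd (\<lambda>k. hw s k * (cmod (x t k) + cmod (y t k))) (A * \<bar>r\<bar> + A * \<bar>r\<bar> + 1)) \<and>
    l2bd (\<lambda>k. hw s k * cmod (x 0 k - y 0 k)) B \<and> t \<in> {0..T} \<longrightarrow> l2bd (\<lambda>k. hw s k * cmod (x t k - y t k)) (L * B)"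
    by (elim exE conjE)
  have bound: "l2bd (\<lambda>k. hw s k * cmod (v t k)) (A * \<bar>r\<bar>)"
    if v0: "in_Hs s v0" and v: "is_solution T v0 v" and r: "Hs_norm s v0 \<le> r" and t: "t \<in> {0..T}" for v0 v t
  proof -
    note w = is_solution_kdv_sol[OF T v]
    have "\<forall>t\<in>{0..T}. l2bd (\<lambda>k. cmod (v t k)) (\<bar>r\<bar> + 1)"
      by (intro ballI l2bd_mono[OF solution_energy[OF s T v0 v]]) (use r in auto)
    moreover have "l2bd (\<lambda>k. hw s k * cmod (v 0 k)) \<bar>r\<bar>"
    proof -
      have "l2bd (\<lambda>k. hw s k * cmod (v 0 k)) \<bar>r\<bar> \<longleftrightarrow> l2bd (\<lambda>k. hw s k * cmod (v0 k)) \<bar>r\<bar>"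
        using w(2) by (intro l2bd_cong) simp
      then show ?thesis using l2bd_mono[OF in_HsD[OF v0]] r by auto
    qed
    ultimately show ?thesis
      using pers[of nonzero v "\<bar>r\<bar>" t] kdv_sol_pair[OF w(1) kdv_sol_zero T0] t by blast
  qed
  show ?thesis
  proof (intro exI[of _ L] conjI L allI impI, elim conjE)
    fix v0 w0 v w t
    assume a: "in_Hs s v0" "in_Hs s w0" "is_solution T v0 v" "is_solution T w0 w" "Hs_norm s v0 + Hs_norm s w0 \<le> r" "t \<in> {0..T}"
    have le: "Hs_norm s v0 \<le> r" "Hs_norm s w0 \<le> r" using a(5) Hs_norm_nonneg[of s v0] Hs_norm_nonneg[of s w0] by linarith+
    note vs = is_solution_kdv_sol[OF T a(3)] and ws = is_solution_kdv_sol[OF T a(4)]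
    have "l2bd (\<lambda>k. hw s k * (cmod (w t k) + cmod (v t k))) (A * \<bar>r\<bar> + A * \<bar>r\<bar> + 1)" if "t \<in> {0..T}" for t
    proof -
      have "l2bd (\<lambda>k. hw s k * cmod (w t k) + hw s k * cmod (v t k)) (A * \<bar>r\<bar> + A * \<bar>r\<bar>)"
        by (intro l2bd_add bound[OF a(2,4) le(2) that] bound[OF a(1,3) le(1) that])
      then show ?thesis unfolding distrib_left[symmetric] by (rule l2bd_mono) simp
    qed
    moreover have "l2bd (\<lambda>k. hw s k * cmod (w 0 k - v 0 k)) (Hs_norm s (\<lambda>k. w0 k - v0 k))"
    proof -
      have "l2bd (\<lambda>k. hw s k * cmod (w0 k - v0 k)) (Hs_norm s w0 + Hs_norm s v0)"
      proof (rule l2bd_dominated[OF l2bd_add[OF in_HsD[OF a(2)] in_HsD[OF a(1)]]])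
        fix k :: int
        show "\<bar>hw s k * cmod (w0 k - v0 k)\<bar> \<le> hw s k * cmod (w0 k) + hw s k * cmod (v0 k)"
          unfolding distrib_left[symmetric] using hw_nonneg[of s k] by (auto simp: abs_mult intro!: mult_left_mono norm_triangle_ineq4)
      qed
      then have "l2bd (\<lambda>k. hw s k * cmod (w0 k - v0 k)) (Hs_norm s (\<lambda>k. w0 k - v0 k))"
        by (intro Hs_l2bd l2bd_Hs(1))
      moreover have "l2bd (\<lambda>k. hw s k * cmod (w 0 k - v 0 k)) (Hs_norm s (\<lambda>k. w0 k - v0 k)) \<longleftrightarrow> l2bd (\<lambda>k. hw s k * cmod (w0 k - v0 k)) (Hs_norm s (\<lambda>k. w0 k - v0 k))"
        using vs(2) ws(2) by (intro l2bd_cong) simp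
      ultimately show ?thesis by simp
    qed
    ultimately show "l2bd (\<lambda>k. hw s k * cmod (w t k - v t k)) (L * Hs_norm s (\<lambda>k. w0 k - v0 k))"
      using lip[THEN spec[of _ nonzero], THEN spec[of _ w], THEN spec[of _ v], THEN spec[of _ "Hs_norm s (\<lambda>k. w0 k - v0 k)"], THEN spec[of _ t]] kdv_sol_pair[OF ws(1) vs(1) T0] a(6) by blast
  qed
qed

text \<open>Continuity in \<open>H\<^sup>s\<close>: truncated data give solutions bounded in \<open>H\<^sup>s\<^sup>+\<^sup>1\<close>, hence continuous in
  \<open>H\<^sup>s\<close>, and these converge uniformly in time by Lipschitz dependence.\<close>

lemma solution_continuous:
  assumes s: "s > 0" and T: "T > 0" and v0: "in_Hs s v0" and v: "is_solution T v0 v" and t: "t \<in> {0..T}" and \<epsilon>: "\<epsilon> > 0"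
  shows "\<exists>\<delta>>0. \<forall>t'\<in>{0..T}. \<bar>t' - t\<bar> < \<delta> \<longrightarrow> Hs_norm s (\<lambda>k. v t' k - v t k) < \<epsilon>"
proof -
  \<comment> \<open>Truncating the data does not increase their norm, so \<open>v0\<close> and its
    truncation together stay below twice the norm of \<open>v0\<close>.\<close>
  let ?r = "2 * Hs_norm s v0"
  obtain L where L: "L \<ge> 0" and lip: "\<And>v0 w0 v w t. in_Hs s v0 \<and> in_Hs s w0 \<and> is_solution T v0 v \<and> is_solution T w0 w \<and>
     Hs_norm s v0 + Hs_norm s w0 \<le> ?r \<and> t \<in> {0..T} \<longrightarrow>
     l2bd (\<lambda>k. hw s k * cmod (w t k - v t k)) (L * Hs_norm s (\<lambda>k. w0 k - v0 k))"
    using solutions_lipschitz[OF s T, of ?r] by meson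
  \<comment> \<open>Dividing by \<open>L + 1\<close> covers the case \<open>L = 0\<close>.\<close>
  define e where "e = \<epsilon> / 4 / (L + 1)"
  have e: "e > 0" "L * e \<le> \<epsilon> / 4"
  proof -
    show "e > 0" unfolding e_def using \<epsilon> L by simp
    then have "L * e \<le> (L + 1) * e" by simp
    also have "\<dots> = \<epsilon> / 4" proof -
      have "L + 1 \<noteq> 0" using L by linarith
      then show ?thesis unfolding e_def by (rule nonzero_mult_div_cancel_left[of "L + 1" "\<epsilon> / 4", unfolded times_divide_eq_right[symmetric]])
    qed
    finally show "L * e \<le> \<epsilon> / 4" .
  qed
  \<comment> \<open>Moving the weight into the sequence turns the H^s tail of the data into an l^2
    tail, to which \<open>tail_norm\<close> applies.\<close>
  define u where "u k = of_real (hw s k) * v0 k" for k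
  have u_norm: "cmod (u k) = hw s k * cmod (v0 k)" for k unfolding u_def by (simp add: norm_mult hw_nonneg)
  have u: "l2bd (\<lambda>k. cmod (u k)) (Hs_norm s v0)" unfolding u_norm by (rule in_HsD[OF v0])
  have "\<forall>\<^sub>F n in sequentially. tail_norm n u < e"
    using tail_norm_tendsto[OF u] e(1) by (rule order_tendstoD)
  then obtain n where n: "tail_norm n u < e" using eventually_happens'[OF sequentially_bot] by blast
  define w0 where "w0 k = (if k \<in> freq n then v0 k else 0)" for k
  have w0_real: "real_seq w0" using v0 unfolding in_Hs_iff real_seq_def w0_def by (auto simp: freq_uminus)
  have w0_le: "l2bd (\<lambda>k. hw s k * cmod (w0 k)) (Hs_norm s v0)"
    by (rule l2bd_dominated[OF in_HsD[OF v0]]) (auto simp: w0_def hw_nonneg)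
  have w0: "in_Hs s w0" "Hs_norm s w0 \<le> Hs_norm s v0"
    using l2bd_Hs[OF w0_le] w0_real unfolding in_Hs_iff by blast+
  \<comment> \<open>The additional derivative costs at most the factor \<open>n\<close> on
    frequencies up to \<open>n\<close>.\<close>
  have w0': "in_Hs (s + 1) w0"
  proof -
    have "l2bd (\<lambda>k. hw (s + 1) k * cmod (w0 k)) (real n * Hs_norm s v0)"
    proof (rule l2bd_dominated[OF l2bd_cmult[OF in_HsD[OF v0]]])
      fix k :: int assume k: "k \<noteq> 0"
      have "hw (s + 1) k = mag k * hw s k" unfolding hw_def using k by (simp add: powr_add)
      moreover have "mag k * (hw s k * cmod (v0 k)) \<le> real n * (hw s k * cmod (v0 k))" if "k \<in> freq n"
        using that by (intro mult_right_mono) (auto simp: freq_def hw_nonneg)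
      ultimately show "\<bar>hw (s + 1) k * cmod (w0 k)\<bar> \<le> real n * (hw s k * cmod (v0 k))"
        by (auto simp: w0_def hw_nonneg abs_mult mult.assoc)
    qed simp
    then show ?thesis using l2bd_Hs(1) w0_real unfolding in_Hs_iff by blast
  qed
  have diff: "Hs_norm s (\<lambda>k. w0 k - v0 k) \<le> e"
  proof (rule l2bd_Hs(2))
    have "l2bd (\<lambda>k. cmod (tail n u k)) e"
      using tail_norm_l2bd(1)[OF u, of n] by (rule l2bd_mono) (use n in simp)
    then show "l2bd (\<lambda>k. hw s k * cmod (w0 k - v0 k)) e"
      by (rule l2bd_dominated) (auto simp: w0_def tail_def freq_def u_norm hw_nonneg)
  qed
  have "s + 1 > 0" using s by simp
  obtain w B where w: "kdv_sol T w" "\<forall>t\<in>{0..T}. real_seq (w t)" "\<forall>k. k \<noteq> 0 \<longrightarrow> w 0 k = w0 k" "\<forall>t. w t 0 = 0"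
    "\<forall>t\<in>{0..T}. Hs_norm 0 (w t) = Hs_norm 0 w0 \<and> l2bd (\<lambda>k. hw (s + 1) k * cmod (w t k)) B"
    by (rule kdv_exists[OF \<open>s + 1 > 0\<close> T w0'])
  have ws: "is_solution T w0 w" using w by (intro kdv_sol_is_solution[OF T w(1)]) auto
  have close: "l2bd (\<lambda>k. hw s k * cmod (w \<tau> k - v \<tau> k)) (\<epsilon> / 4)" if "\<tau> \<in> {0..T}" for \<tau>
  proof (rule l2bd_mono)
    show "l2bd (\<lambda>k. hw s k * cmod (w \<tau> k - v \<tau> k)) (L * Hs_norm s (\<lambda>k. w0 k - v0 k))"
      using lip[of v0 w0 v w \<tau>] v0 w0 v ws that by auto
    have "L * Hs_norm s (\<lambda>k. w0 k - v0 k) \<le> L * e" using diff L by (rule mult_left_mono)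
    then show "L * Hs_norm s (\<lambda>k. w0 k - v0 k) \<le> \<epsilon> / 4" using e(2) by linarith
  qed
  have "\<forall>\<^sub>F t' in at t within {0..T}. l2bd (\<lambda>k. hw s k * cmod (w t' k - w t k)) (\<epsilon> / 4)"
  proof (rule l2bd_eventually_small[of s "s + 1"])
    show "((\<lambda>t'. w t' k) \<longlongrightarrow> w t k) (at t within {0..T})" if "k \<noteq> 0" for k
      using prim_continuous[OF kdv_solD[OF w(1) that]] t by (simp add: continuous_on_def)
    show "\<forall>\<^sub>F t' in at t within {0..T}. l2bd (\<lambda>k. hw (s + 1) k * cmod (w t' k)) B"
      using w(5) by (auto simp: eventually_at_filter)
  qed (use s \<epsilon> w(5) t in auto)
  then obtain \<delta> where \<delta>: "\<delta> > 0" "\<And>t'. t' \<in> {0..T} \<Longrightarrow> t' \<noteq> t \<Longrightarrow> dist t' t < \<delta> \<Longrightarrow> l2bd (\<lambda>k. hw s k * cmod (w t' k - w t k)) (\<epsilon> / 4)"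
    unfolding eventually_at by blast
  show ?thesis
  proof (intro exI[of _ \<delta>] conjI \<delta>(1) ballI impI)
    fix t' assume t': "t' \<in> {0..T}" "\<bar>t' - t\<bar> < \<delta>"
    show "Hs_norm s (\<lambda>k. v t' k - v t k) < \<epsilon>"
    proof (cases "t' = t")
      case True
      then show ?thesis using \<epsilon> by (simp add: Hs_norm_def Hs_weight_def[abs_def])
    next
      case False
      have "l2bd (\<lambda>k. hw s k * cmod (w t' k - v t' k) + hw s k * cmod (w t' k - w t k) + hw s k * cmod (w t k - v t k)) (\<epsilon> / 4 + \<epsilon> / 4 + \<epsilon> / 4)"
        using close \<delta>(2)[OF t'(1) False] t' t by (intro l2bd_add) (auto simp: dist_real_def)
      then have "l2bd (\<lambda>k. hw s k * cmod (v t' k - v t k)) (\<epsilon> / 4 + \<epsilon> / 4 + \<epsilon> / 4)"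
      proof (rule l2bd_dominated)
        fix k :: int
        have eq: "v t' k - v t k = (w t' k - w t k) + (w t k - v t k) - (w t' k - v t' k)" by simp
        have tri: "cmod (p + q - r) \<le> cmod r + cmod p + cmod q" for p q r
          using norm_triangle_ineq4[of "p + q" r] norm_triangle_ineq[of p q] by linarith
        have "cmod (v t' k - v t k) \<le> cmod (w t' k - v t' k) + cmod (w t' k - w t k) + cmod (w t k - v t k)"
          unfolding eq by (rule tri)
        then show "\<bar>hw s k * cmod (v t' k - v t k)\<bar> \<le> hw s k * cmod (w t' k - v t' k) + hw s k * cmod (w t' k - w t k) + hw s k * cmod (w t k - v t k)"
          unfolding distrib_left[symmetric] using hw_nonneg[of s k] by (simp add: abs_mult mult_left_mono)
      qed
      then have "Hs_norm s (\<lambda>k. v t' k - v t k) \<le> \<epsilon> / 4 + \<epsilon> / 4 + \<epsilon> / 4" by (rule l2bd_Hs(2))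
      then show ?thesis using \<epsilon> by linarith
    qed
  qed
qed

theorem theorem5p5:
  shows "(\<forall>s T v0. s > 1/2 \<and> T > 0 \<and> in_Hs s v0 \<longrightarrow>
      (\<exists>v. is_solution T v0 v
         \<and> (\<forall>w. is_solution T v0 w \<longrightarrow> (\<forall>t\<in>{0..T}. \<forall>k. k \<noteq> 0 \<longrightarrow> w t k = v t k))
         \<and> (\<forall>t\<in>{0..T}. in_Hs s (v t))
         \<and> (\<forall>t\<in>{0..T}. \<forall>\<epsilon>>0. \<exists>\<delta>>0. \<forall>t'\<in>{0..T}. \<bar>t' - t\<bar> < \<delta> \<longrightarrow>
               Hs_norm s (\<lambda>k. v t' k - v t k) < \<epsilon>)
         \<and> (\<forall>t\<in>{0..T}. Hs_norm 0 (v t) = Hs_norm 0 v0)))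
   \<and> (\<exists>L :: real \<Rightarrow> real \<Rightarrow> real \<Rightarrow> real. \<forall>s T v0 w0 v w.
        s > 1/2 \<and> T > 0 \<and> in_Hs s v0 \<and> in_Hs s w0 \<and> is_solution T v0 v \<and> is_solution T w0 w
        \<longrightarrow> (\<forall>t\<in>{0..T}. Hs_norm s (\<lambda>k. w t k - v t k)
               \<le> L s T (Hs_norm s v0 + Hs_norm s w0) * Hs_norm s (\<lambda>k. w0 k - v0 k)))"
proof (intro conjI allI impI, elim conjE)
  fix s T :: real and v0
  assume "s > 1/2" and T: "T > 0" and v0: "in_Hs s v0"
  then have s: "s > 0" by simp
  obtain v B where v: "kdv_sol T v" "\<forall>t\<in>{0..T}. real_seq (v t)" "\<forall>k. k \<noteq> 0 \<longrightarrow> v 0 k = v0 k" "\<forall>t. v t 0 = 0"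
    "\<forall>t\<in>{0..T}. Hs_norm 0 (v t) = Hs_norm 0 v0 \<and> l2bd (\<lambda>k. hw s k * cmod (v t k)) B"
    by (rule kdv_exists[OF s T v0])
  have sol: "is_solution T v0 v" using v by (intro kdv_sol_is_solution[OF T v(1)]) auto
  show "\<exists>v. is_solution T v0 v
         \<and> (\<forall>w. is_solution T v0 w \<longrightarrow> (\<forall>t\<in>{0..T}. \<forall>k. k \<noteq> 0 \<longrightarrow> w t k = v t k))
         \<and> (\<forall>t\<in>{0..T}. in_Hs s (v t))
         \<and> (\<forall>t\<in>{0..T}. \<forall>\<epsilon>>0. \<exists>\<delta>>0. \<forall>t'\<in>{0..T}. \<bar>t' - t\<bar> < \<delta> \<longrightarrow>
               Hs_norm s (\<lambda>k. v t' k - v t k) < \<epsilon>)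
         \<and> (\<forall>t\<in>{0..T}. Hs_norm 0 (v t) = Hs_norm 0 v0)"
  proof (intro exI[of _ v] conjI sol allI ballI impI)
    show "w t k = v t k" if "is_solution T v0 w" "t \<in> {0..T}" "k \<noteq> 0" for w t k
    proof (rule kdv_sol_unique[OF _ is_solution_kdv_sol(1)[OF T that(1)] v(1) _ that(2,3)])
      show "w 0 k = v 0 k" if "k \<noteq> 0" for k
        using is_solution_kdv_sol(2)[OF T \<open>is_solution T v0 w\<close> that] v(3) that by simp
    qed (use T in simp)
    show "in_Hs s (v t)" if "t \<in> {0..T}" for t
      using v(2,5) that l2bd_Hs(1) unfolding in_Hs_iff by blast
  qed (use solution_continuous[OF s T v0 sol] v(5) in blast)+
next
  \<comment> \<open>\<open>P\<close> quantifies over all data whose norms add up to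
    \<open>r\<close>, so choosing a witness for it yields a function of \<open>s\<close>,
    \<open>T\<close> and \<open>r\<close> only, fixed before the data.\<close>
  define P where "P s T r L \<longleftrightarrow> (\<forall>v0 w0 v w. s > 1/2 \<and> T > 0 \<and> in_Hs s v0 \<and> in_Hs s w0 \<and> is_solution T v0 v \<and> is_solution T w0 w \<and>
      Hs_norm s v0 + Hs_norm s w0 = r \<longrightarrow> (\<forall>t\<in>{0..T}. Hs_norm s (\<lambda>k. w t k - v t k) \<le> L * Hs_norm s (\<lambda>k. w0 k - v0 k)))" for s T r L
  have ex: "\<exists>L. P s T r L" for s T r
  proof (cases "s > 1/2 \<and> T > 0")
    case True
    then have "s > 0" "T > 0" by simp_all
    from solutions_lipschitz[OF this, of r] obtain L where "\<forall>v0 w0 v w t. in_Hs s v0 \<and> in_Hs s w0 \<and>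
       is_solution T v0 v \<and> is_solution T w0 w \<and> Hs_norm s v0 + Hs_norm s w0 \<le> r \<and> t \<in> {0..T} \<longrightarrow>
       l2bd (\<lambda>k. hw s k * cmod (w t k - v t k)) (L * Hs_norm s (\<lambda>k. w0 k - v0 k))"
      by (elim exE conjE)
    then show ?thesis
      unfolding P_def by (intro exI[of _ L] allI impI ballI l2bd_Hs(2)) auto
  next
    case False
    then show ?thesis unfolding P_def by blast
  qed
  define L where "L s T r = (SOME L. P s T r L)" for s T r
  have L: "P s T r (L s T r)" for s T r
    unfolding L_def by (rule someI_ex[OF ex])
  show "\<exists>L :: real \<Rightarrow> real \<Rightarrow> real \<Rightarrow> real. \<forall>s T v0 w0 v w.
        s > 1/2 \<and> T > 0 \<and> in_Hs s v0 \<and> in_Hs s w0 \<and> is_solution T v0 v \<and> is_solution T w0 w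
        \<longrightarrow> (\<forall>t\<in>{0..T}. Hs_norm s (\<lambda>k. w t k - v t k)
               \<le> L s T (Hs_norm s v0 + Hs_norm s w0) * Hs_norm s (\<lambda>k. w0 k - v0 k))"
  proof (intro exI[of _ L] allI impI)
    fix s T :: real and v0 w0 :: "int \<Rightarrow> complex" and v w :: "real \<Rightarrow> int \<Rightarrow> complex"
    assume "s > 1/2 \<and> T > 0 \<and> in_Hs s v0 \<and> in_Hs s w0 \<and> is_solution T v0 v \<and> is_solution T w0 w"
    with L[of s T "Hs_norm s v0 + Hs_norm s w0"]
    show "\<forall>t\<in>{0..T}. Hs_norm s (\<lambda>k. w t k - v t k)
               \<le> L s T (Hs_norm s v0 + Hs_norm s w0) * Hs_norm s (\<lambda>k. w0 k - v0 k)"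
      unfolding P_def by simp
  qed
qed

end
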